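(* Let $S=K[x_1,\dots,x_n]$ be a polynomial ring over a field $K$ and let $I\subset S$ be a squarefree monomial ideal with minimal prime ideals $P_1,\dots,P_s$. Suppose that the sum of every three different minimal prime ideals of $I$ is the maximal ideal $m=(x_1,\dots,x_n)$ of $S$, or more generally that there is a fixed ideal $J$ of $S$ such that $P_i+P_j+P_k=J$ for all pairwise distinct $i,j,k\in\{1,\dots,s\}$. Then $\operatorname{depth}_S I$ does not depend on the characteristic of $K$.
   Context: The depth of a finitely generated graded $S$-module is taken with respect to $m=(x_1,\dots,x_n)$. "Does not depend on the characteristic of $K$" means: if $K'$ is any other field and $I'\subset K'[x_1,\dots,x_n]$ is the ideal generated by the same squarefree monomials as $I$, then $\operatorname{depth} I'=\operatorname{depth} I$. (The minimal primes of a squarefree monomial ideal are generated by subsets of the variables, and these subsets do not depend on the field.) *)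

theory Defs
  imports
    "HOL-Library.Poly_Mapping"
    "HOL-Library.Extended_Nat"
    "HOL-Algebra.Ideal"
    "HOL-Algebra.Module"
    "HOL-Algebra.Algebraic_Closure_Type"
begin

section \<open>Minimal primes and depth\<close>

definition minimal_primes :: "('a, 'c) ring_scheme \<Rightarrow> 'a set \<Rightarrow> 'a set set" where
  "minimal_primes R I =
     {P. primeideal P R \<and> I \<subseteq> P \<and> (\<forall>Q. primeideal Q R \<longrightarrow> I \<subseteq> Q \<longrightarrow> Q \<subseteq> P \<longrightarrow> Q = P)}"

text \<open>
  For a set \<open>A\<close> of ring elements this is \<open>(A)M\<close>, the product of the ideal generated by \<open>A\<close>
  with the module \<open>M\<close>.
\<close>

definition smult_submodule ::
    "('a, 'c) ring_scheme \<Rightarrow> 'a set \<Rightarrow> ('a, 'b, 'd) module_scheme \<Rightarrow> 'b set" where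
  "smult_submodule R A M =
     \<Inter>{N. submodule N R M \<and> (\<forall>a\<in>A. \<forall>x\<in>carrier M. a \<odot>\<^bsub>M\<^esub> x \<in> N)}"

text \<open>
  In a regular sequence \<open>r\<^sub>0, r\<^sub>1, \<dots>\<close> the element \<open>r\<^sub>i\<close> is a non-zero-divisor on
  \<open>M / (r\<^sub>0, \<dots>, r\<^bsub>i-1\<^esub>)M\<close>; this is expressed without forming the quotient module.
\<close>

definition regular_sequence ::
    "('a, 'c) ring_scheme \<Rightarrow> ('a, 'b, 'd) module_scheme \<Rightarrow> 'a list \<Rightarrow> bool" where
  "regular_sequence R M rs \<longleftrightarrow>
     set rs \<subseteq> carrier R \<and>
     (\<forall>i < length rs. \<forall>x \<in> carrier M.
        rs ! i \<odot>\<^bsub>M\<^esub> x \<in> smult_submodule R (set (take i rs)) M \<longrightarrow>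
        x \<in> smult_submodule R (set (take i rs)) M) \<and>
     smult_submodule R (set rs) M \<noteq> carrier M"

text \<open>
  Depth of \<open>M\<close> with respect to the ideal \<open>A\<close>. It is \<open>\<infinity>\<close> if \<open>AM = M\<close>, in particular for the
  zero module.
\<close>

definition depth ::
    "('a, 'c) ring_scheme \<Rightarrow> 'a set \<Rightarrow> ('a, 'b, 'd) module_scheme \<Rightarrow> enat" where
  "depth R A M =
     (if smult_submodule R A M = carrier M then \<infinity>
      else Sup {enat (length rs) | rs. set rs \<subseteq> A \<and> regular_sequence R M rs})"

text \<open>
  An ideal as a module over the ring. Modules are records extending rings, but \<open>module\<close> ignores
  the fields \<open>mult\<close> and \<open>one\<close>.
\<close>

definition ideal_module :: "('a, 'c) ring_scheme \<Rightarrow> 'a set \<Rightarrow> ('a, 'a) module" where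
  "ideal_module R I =
     \<lparr>carrier = I, monoid.mult = monoid.mult R, one = one R, zero = zero R, add = add R,
      module.smult = monoid.mult R\<rparr>"

lemma (in cring) module_ideal_module:
  assumes "ideal I R"
  shows "module R (ideal_module R I)"
proof -
  interpret I: ideal I R by fact
  show ?thesis
  proof (rule moduleI)
    show "cring R" by (rule cring_axioms)
    show "abelian_group (ideal_module R I)"
    proof (rule abelian_groupI)
      fix x assume x: "x \<in> carrier (ideal_module R I)"
      show "\<exists>y\<in>carrier (ideal_module R I). y \<oplus>\<^bsub>ideal_module R I\<^esub> x = \<zero>\<^bsub>ideal_module R I\<^esub>"
        using x I.a_inv_closed I.a_Hcarr l_neg
        by (auto simp: ideal_module_def intro!: bexI[of _ "\<ominus> x"])
    qed (auto simp: ideal_module_def a_ac)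
  qed (auto simp: ideal_module_def I.I_l_closed l_distr r_distr m_assoc)
qed

section \<open>Polynomial rings\<close>

text \<open>
  Polynomials over \<open>'k\<close> in variables indexed by the finite type \<open>'n\<close>, i.e. in \<open>CARD('n)\<close> variables:
  finitely supported functions from exponent vectors to coefficients, with convolution as product.
\<close>

type_synonym ('n, 'k) mpoly = "('n \<Rightarrow>\<^sub>0 nat) \<Rightarrow>\<^sub>0 'k"

abbreviation poly_ring_over :: "('n, 'k::field) mpoly ring" where
  "poly_ring_over \<equiv> ring_of_type_algebra"

definition monomial :: "('n \<Rightarrow>\<^sub>0 nat) \<Rightarrow> ('n, 'k::field) mpoly" where
  "monomial e = Poly_Mapping.single e 1"

definition var :: "'n \<Rightarrow> ('n, 'k::field) mpoly" where
  "var i = monomial (Poly_Mapping.single i 1)"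

definition squarefree_exponent :: "('n \<Rightarrow>\<^sub>0 nat) \<Rightarrow> bool" where
  "squarefree_exponent e \<longleftrightarrow> (\<forall>i. Poly_Mapping.lookup e i \<le> 1)"

definition monomial_ideal :: "('n \<Rightarrow>\<^sub>0 nat) set \<Rightarrow> ('n, 'k::field) mpoly set" where
  "monomial_ideal G = Idl\<^bsub>poly_ring_over\<^esub> (monomial ` G)"

definition variables_ideal :: "('n, 'k::field) mpoly set" where
  "variables_ideal = Idl\<^bsub>poly_ring_over\<^esub> (range var)"

text \<open>The depth of an ideal as a module over the polynomial ring, with respect to the ideal
  generated by the variables.\<close>

definition ideal_depth :: "('n, 'k::field) mpoly set \<Rightarrow> enat" where
  "ideal_depth I = depth poly_ring_over variables_ideal (ideal_module poly_ring_over I)"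

end

theory Submission
  imports Defs
begin

text \<open>
  A squarefree monomial ideal \<open>I\<close> is the ideal of a simplicial complex \<open>\<Delta>\<close> on the variables: its
  minimal primes are generated by the complements of the facets of \<open>\<Delta>\<close>, and \<open>I\<close> is spanned by the
  monomials whose support is not a face. In terms of facets the hypothesis says that any three of them
  meet in the same set \<open>C\<close>. So \<open>\<Delta>\<close> is a cone over \<open>C\<close> in which every vertex outside \<open>C\<close> lies in at
  most two facets, and the link of \<open>C\<close> has the homotopy type of a graph, the nerve: the vertices are the
  facets, and two of them are joined when they meet outside \<open>C\<close>. Graphs have no torsion in their
  homology, which is why the field cannot matter. Accordingly the proof computes the depth from the nerve. For \<open>I \<noteq> 0\<close> the
  depth of the module \<open>I\<close> is

    \<^item> the number of variables if there is no facet, and \<open>|F| + 1\<close> if \<open>F\<close> is the only facet;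
    \<^item> \<open>|C| + 2\<close> if the nerve is disconnected (with two facets, \<open>C\<close> is taken to be their intersection);
    \<^item> \<open>|C| + 3\<close> if the nerve is connected and has a cycle;
    \<^item> \<open>|A \<inter> B| + 2\<close> if the nerve is a tree, where \<open>A\<close>, \<open>B\<close> are the adjacent facets with the smallest
      intersection.

  None of these numbers mentions the field. They are established by two estimates that work directly
  with regular sequences.

  Lower bound: a long regular sequence is written down with coefficients in the prime ring. Most of its
  entries are sums over colour classes of variables. Such linear forms are regular modulo a prime of
  \<open>\<Delta>\<close> as soon as every colour occurs on the face (\<open>weakly_regular_colours\<close>), and the
  regularity is carried from the primes to \<open>I\<close> by the depth lemma for
  \<open>0 \<rightarrow> R/(I \<inter> J) \<rightarrow> R/I \<oplus> R/J \<rightarrow> R/(I + J) \<rightarrow> 0\<close>, adding one facet after the other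
  (\<open>depth_lemma\<close>, \<open>weakly_regular_cone\<close>, \<open>weakly_regular_conn\<close>, \<open>weakly_regular_tree\<close>). Since the
  intersections of adjacent facets are disjoint outside \<open>C\<close>, they can be coloured independently. One
  further entry is a sum of distinct powers of all variables, which avoids the primes in question over
  every field, even a finite one; the last entry is a single variable, which accounts for the step
  from \<open>R/I\<close> to \<open>I\<close>.

  Upper bound: if \<open>I\<close> has a regular sequence of length \<open>k\<close> in the ideal of the variables, then the
  Koszul complex of the variables with coefficients in \<open>I\<close> is exact in degrees below \<open>k\<close>
  (\<open>koszul_exact\<close>). A multigraded slice of this complex is a simplicial cochain complex, so that a
  nontrivial cohomology class of \<open>\<Delta>\<close> outside a set \<open>W\<close> of variables bounds the length
  (\<open>koszul_obstruction\<close>). The classes needed separate two parts of the nerve or go around a cycle of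
  it; they have coefficients \<open>0\<close> and \<open>\<plusminus>1\<close> and are nontrivial over every field.
\<close>

section \<open>Regular sequences modulo an ideal and on an ideal\<close>

text \<open>
  Ideals of a commutative ring are its submodules over itself, so \<open>idl.span\<close> is the ideal generated by
  a set.
\<close>

interpretation idl: Modules.module "(*) :: 'a::comm_ring_1 \<Rightarrow> 'a \<Rightarrow> 'a"
  by unfold_locales (auto simp: algebra_simps)

\<comment> \<open>this rule is opposite to \<open>mult.assoc\<close>, and the two together do not terminate\<close>
declare idl.scale_scale [simp del]

text \<open>
  Regularity of a sequence on \<open>R/I\<close>, up to the condition that the quotient be nonzero. The successive
  quotients \<open>R/(I + (r\<^sub>0, \<dots>, r\<^bsub>i-1\<^esub>))\<close> are represented by their ideals.
\<close>

definition weakly_regular :: "'a::comm_ring_1 set \<Rightarrow> 'a list \<Rightarrow> bool" where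
  "weakly_regular I rs \<longleftrightarrow> (\<forall>i<length rs. \<forall>x. rs ! i * x \<in> idl.span (I \<union> set (take i rs)) \<longrightarrow>
     x \<in> idl.span (I \<union> set (take i rs)))"

definition ideal_prod :: "'a::comm_ring_1 set \<Rightarrow> 'a set \<Rightarrow> 'a set" where
  "ideal_prod A I = idl.span {a * x | a x. a \<in> A \<and> x \<in> I}"

text \<open>
  The same condition for the module \<open>I\<close> itself in place of \<open>R/I\<close>.
\<close>

definition regular_on :: "'a::comm_ring_1 set \<Rightarrow> 'a list \<Rightarrow> bool" where
  "regular_on I rs \<longleftrightarrow> (\<forall>i<length rs. \<forall>x\<in>I. rs ! i * x \<in> ideal_prod (set (take i rs)) I \<longrightarrow>
     x \<in> ideal_prod (set (take i rs)) I)"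

lemma weakly_regular_Nil [simp]: "weakly_regular I []"
  by (simp add: weakly_regular_def)

lemma weakly_regular_snoc:
  "weakly_regular I (rs @ [y]) \<longleftrightarrow> weakly_regular I rs \<and>
     (\<forall>x. y * x \<in> idl.span (I \<union> set rs) \<longrightarrow> x \<in> idl.span (I \<union> set rs))"
  by (auto simp: weakly_regular_def nth_append less_Suc_eq)

lemma weakly_regular_append: "weakly_regular I (rs @ ss) \<Longrightarrow> weakly_regular I rs"
  by (induction ss rule: rev_induct) (auto simp: weakly_regular_snoc simp flip: append_assoc)

lemma weakly_regular_take: "weakly_regular I rs \<Longrightarrow> weakly_regular I (take i rs)"
  using weakly_regular_append[of I "take i rs" "drop i rs"] by simp

lemma ideal_prod_base: "a \<in> A \<Longrightarrow> x \<in> I \<Longrightarrow> a * x \<in> ideal_prod A I"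
  unfolding ideal_prod_def by (rule idl.span_base) auto

lemma subspace_ideal_prod [simp]: "idl.subspace (ideal_prod A I)"
  unfolding ideal_prod_def by simp

lemma ideal_prod_mono: "A \<subseteq> B \<Longrightarrow> I \<subseteq> J \<Longrightarrow> ideal_prod A I \<subseteq> ideal_prod B J"
  unfolding ideal_prod_def by (rule idl.span_mono) auto

lemma ideal_prod_minimal:
  "idl.subspace T \<Longrightarrow> (\<And>a x. a \<in> A \<Longrightarrow> x \<in> I \<Longrightarrow> a * x \<in> T) \<Longrightarrow> ideal_prod A I \<subseteq> T"
  unfolding ideal_prod_def by (rule idl.span_minimal) auto

lemma ideal_prod_subset_right: "idl.subspace I \<Longrightarrow> ideal_prod A I \<subseteq> I"
  by (rule ideal_prod_minimal) (auto intro: idl.subspace_scale)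

lemma ideal_prod_subset_left: "ideal_prod A I \<subseteq> idl.span A"
proof (rule ideal_prod_minimal)
  fix a x assume "a \<in> A" "x \<in> I"
  then have "x * a \<in> idl.span A" by (intro idl.span_scale idl.span_base)
  then show "a * x \<in> idl.span A" by (simp add: mult.commute)
qed simp

lemma span_Un_subspaceE:
  assumes "x \<in> idl.span (I \<union> A)" "idl.subspace I"
  obtains b c where "x = b + c" "b \<in> I" "c \<in> idl.span A"
proof -
  have "idl.span I = I" using assms(2) by simp
  with assms(1) that show ?thesis unfolding idl.span_Un by auto
qed

text \<open>
  This is the vanishing of \<open>Tor\<^sub>1(R/I, R/(rs))\<close>: relations modulo \<open>I\<close> between the entries of a regular
  sequence are the trivial ones. In \<open>x = \<dots> + k y\<close> with \<open>y\<close> the last entry, regularity puts \<open>k\<close> into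
  \<open>I + (rs)\<close>; the part of \<open>k y\<close> from \<open>I\<close> is already a product and the rest has one entry less.
\<close>

lemma tor_vanishing:
  assumes "idl.subspace I" "weakly_regular I rs" "x \<in> I" "x \<in> idl.span (set rs)"
  shows "x \<in> ideal_prod (set rs) I"
  using assms(2-)
proof (induction rs arbitrary: x rule: rev_induct)
  case Nil
  then show ?case by (simp add: ideal_prod_def)
next
  case (snoc y rs)
  from snoc.prems(3) obtain k where k: "x - k * y \<in> idl.span (set rs)"
    by (auto simp: idl.span_insert)
  have "x \<in> idl.span (I \<union> set rs)" by (rule idl.span_base) (use snoc.prems in auto)
  moreover have "x - k * y \<in> idl.span (I \<union> set rs)"
    using k idl.span_mono[of "set rs" "I \<union> set rs"] by auto
  ultimately have "x - (x - k * y) \<in> idl.span (I \<union> set rs)" by (rule idl.span_diff)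
  then have "y * k \<in> idl.span (I \<union> set rs)" by (simp add: mult.commute)
  with snoc.prems(1) have "k \<in> idl.span (I \<union> set rs)" by (auto simp: weakly_regular_snoc)
  then obtain b c where bc: "k = b + c" "b \<in> I" "c \<in> idl.span (set rs)"
    by (rule span_Un_subspaceE) (rule assms(1))
  have "(x - k * y) + y * c \<in> idl.span (set rs)"
    by (intro idl.span_add idl.span_scale k bc)
  then have "x - y * b \<in> idl.span (set rs)" by (simp add: bc algebra_simps)
  moreover have "x - y * b \<in> I"
    by (intro idl.subspace_diff[OF assms(1)] idl.subspace_scale[OF assms(1)] snoc.prems bc)
  ultimately have "x - y * b \<in> ideal_prod (set rs) I"
    using snoc.IH snoc.prems(1) by (auto simp: weakly_regular_snoc)
  then have "x - y * b \<in> ideal_prod (set (rs @ [y])) I" 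
    using ideal_prod_mono[of "set rs" "set (rs @ [y])" I I] by auto
  moreover have "y * b \<in> ideal_prod (set (rs @ [y])) I" by (rule ideal_prod_base) (use bc in auto)
  ultimately show ?case using idl.subspace_add[OF subspace_ideal_prod] by fastforce
qed

text \<open>
  The depth of \<open>I\<close> exceeds that of \<open>R/I\<close> by one, in terms of sequences: by \<open>tor_vanishing\<close> the quotient
  \<open>I/(rs)I\<close> embeds into \<open>R/(rs)\<close>, on which \<open>y\<close> is still regular.
\<close>

lemma regular_on_of_weakly_regular:
  assumes I: "idl.subspace I" and "weakly_regular I rs" and 0: "weakly_regular {0} (rs @ [y])"
  shows "regular_on I (rs @ [y])"
  unfolding regular_on_def
proof (intro allI impI ballI)
  fix i x assume i: "i < length (rs @ [y])" and x: "x \<in> I"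
    and rx: "(rs @ [y]) ! i * x \<in> ideal_prod (set (take i (rs @ [y]))) I"
  have t: "take i (rs @ [y]) = take i rs" using i by simp
  have eq: "idl.span ({0} \<union> A) = idl.span A" for A :: "'a set"
    by (simp add: idl.span_insert)
  have "(rs @ [y]) ! i * x \<in> idl.span (set (take i rs))"
    using rx ideal_prod_subset_left unfolding t by blast
  then have "x \<in> idl.span (set (take i rs))"
    using 0 i unfolding weakly_regular_def t eq by (metis t)
  then show "x \<in> ideal_prod (set (take i (rs @ [y]))) I"
    unfolding t using I x weakly_regular_take[OF assms(2)] by (intro tor_vanishing) auto
qed

text \<open>
  Reduction modulo \<open>(rs)\<close> commutes with the intersection of \<open>I\<close> and \<open>J\<close> if \<open>rs\<close> is regular modulo
  \<open>I + J\<close>: two representations \<open>a + u = b + w\<close> of an element differ by \<open>a - b \<in> (rs) \<inter> (I + J)\<close>, and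
  \<open>tor_vanishing\<close> splits this difference into a part in \<open>I\<close> and a part in \<open>J\<close> that can be
  absorbed.
\<close>

lemma span_inter_of_weakly_regular:
  assumes I: "idl.subspace I" and J: "idl.subspace J" and reg: "weakly_regular (idl.span (I \<union> J)) rs"
    and xI: "x \<in> idl.span (I \<union> set rs)" and xJ: "x \<in> idl.span (J \<union> set rs)"
  shows "x \<in> idl.span ((I \<inter> J) \<union> set rs)"
proof -
  let ?A = "set rs"
  obtain a u where a: "x = a + u" "a \<in> I" "u \<in> idl.span ?A" by (rule span_Un_subspaceE[OF xI I])
  obtain b w where b: "x = b + w" "b \<in> J" "w \<in> idl.span ?A" by (rule span_Un_subspaceE[OF xJ J])
  have "a - b = w - u" using a(1) b(1) by (simp add: algebra_simps)
  then have "a - b \<in> idl.span ?A" using a b by (auto intro: idl.span_diff)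
  moreover have "a - b \<in> idl.span (I \<union> J)"
    by (intro idl.span_diff idl.span_base) (use a b in auto)
  ultimately have "a - b \<in> ideal_prod ?A (idl.span (I \<union> J))" using reg by (intro tor_vanishing) auto
  moreover have "ideal_prod ?A (idl.span (I \<union> J)) \<subseteq> idl.span (ideal_prod ?A I \<union> ideal_prod ?A J)"
  proof (rule ideal_prod_minimal)
    fix r y assume r: "r \<in> ?A" and y: "y \<in> idl.span (I \<union> J)"
    obtain p q where pq: "y = p + q" "p \<in> I" "q \<in> idl.span J" by (rule span_Un_subspaceE[OF y I])
    moreover have "q \<in> J" using pq(3) J idl.span_eq_iff by blast
    ultimately have "r * p \<in> ideal_prod ?A I" "r * q \<in> ideal_prod ?A J"
      using r by (auto intro: ideal_prod_base)
    then show "r * y \<in> idl.span (ideal_prod ?A I \<union> ideal_prod ?A J)"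
      unfolding \<open>y = p + q\<close> distrib_left by (intro idl.span_add idl.span_base) auto
  qed simp
  ultimately have "a - b \<in> idl.span (ideal_prod ?A I \<union> ideal_prod ?A J)" by blast
  then obtain p q where pq: "a - b = p + q" "p \<in> ideal_prod ?A I" "q \<in> idl.span (ideal_prod ?A J)"
    by (rule span_Un_subspaceE) simp
  have q: "q \<in> ideal_prod ?A J" using pq(3) idl.span_eq_iff[THEN iffD2, OF subspace_ideal_prod] by metis
  have "a - p \<in> I" using a pq ideal_prod_subset_right[OF I] by (auto intro: idl.subspace_diff[OF I])
  moreover have "a - p = b + q" using pq(1) by (simp add: algebra_simps)
  moreover have "b + q \<in> J" using b q ideal_prod_subset_right[OF J] by (auto intro: idl.subspace_add[OF J])
  ultimately have "a - p \<in> (I \<inter> J) \<union> ?A" by auto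
  then have 1: "a - p \<in> idl.span ((I \<inter> J) \<union> ?A)" by (rule idl.span_base)
  have "p + u \<in> idl.span ?A" using a pq ideal_prod_subset_left by (auto intro: idl.span_add)
  then have 2: "p + u \<in> idl.span ((I \<inter> J) \<union> ?A)"
    using idl.span_mono[of ?A "(I \<inter> J) \<union> ?A"] by auto
  have "x = (a - p) + (p + u)" using a by simp
  then show ?thesis using idl.span_add[OF 1 2] by simp
qed

text \<open>
  The depth lemma for \<open>0 \<rightarrow> R/(I \<inter> J) \<rightarrow> R/I \<oplus> R/J \<rightarrow> R/(I + J) \<rightarrow> 0\<close>, where the third module may have
  depth one less. It holds for a fixed sequence, which avoids any statement that different maximal
  regular sequences have equal lengths.
\<close>

lemma depth_lemma:
  assumes I: "idl.subspace I" and J: "idl.subspace J" and reg: "weakly_regular (idl.span (I \<union> J)) rs"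
    and regI: "weakly_regular I (rs @ [g])" and regJ: "weakly_regular J (rs @ [g])"
  shows "weakly_regular (I \<inter> J) (rs @ [g])"
  unfolding weakly_regular_def
proof (intro allI impI)
  fix i x assume i: "i < length (rs @ [g])"
  let ?A = "set (take i (rs @ [g]))" and ?r = "(rs @ [g]) ! i"
  assume *: "?r * x \<in> idl.span (I \<inter> J \<union> ?A)"
  have "idl.span (I \<inter> J \<union> ?A) \<subseteq> idl.span (I \<union> ?A)" "idl.span (I \<inter> J \<union> ?A) \<subseteq> idl.span (J \<union> ?A)"
    by (auto intro!: idl.span_mono)
  then have "x \<in> idl.span (I \<union> ?A)" "x \<in> idl.span (J \<union> ?A)"
    using * regI regJ i unfolding weakly_regular_def by blast+
  moreover have "take i (rs @ [g]) = take i rs" using i by simp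
  ultimately show "x \<in> idl.span (I \<inter> J \<union> ?A)"
    using span_inter_of_weakly_regular[OF I J weakly_regular_take[OF reg]] by metis
qed

section \<open>The Koszul complex\<close>

text \<open>The function \<open>f\<close> only serves to order the variables.\<close>

definition koszul_sign :: "('n \<Rightarrow> nat) \<Rightarrow> 'n \<Rightarrow> 'n set \<Rightarrow> 'a::comm_ring_1" where
  "koszul_sign f v A = (-1) ^ card {u\<in>A. f u < f v}"

text \<open>
  A cochain is a function on all sets of variables, whose part of degree \<open>i\<close> consists of the values on sets
  of cardinality \<open>i\<close>. The formula is the differential of the Koszul cochain complex of \<open>\<xi>\<close>.
\<close>

definition koszul_d :: "('n \<Rightarrow> nat) \<Rightarrow> ('n \<Rightarrow> 'a) \<Rightarrow> ('n set \<Rightarrow> 'a) \<Rightarrow> 'n set \<Rightarrow> 'a::comm_ring_1" where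
  "koszul_d f \<xi> \<phi> A = (\<Sum>v\<in>A. koszul_sign f v A * \<xi> v * \<phi> (A - {v}))"

text \<open>
  Contraction with the vector \<open>a\<close>, the homotopy that makes multiplication by \<open>\<Sum> a\<^sub>v \<xi>\<^sub>v\<close> null-homotopic.
\<close>

definition koszul_h :: "('n \<Rightarrow> nat) \<Rightarrow> ('n \<Rightarrow> 'a) \<Rightarrow> ('n set \<Rightarrow> 'a) \<Rightarrow> 'n set \<Rightarrow> 'a::comm_ring_1" where
  "koszul_h f a \<phi> A = (\<Sum>v\<in>-A. koszul_sign f v A * a v * \<phi> (insert v A))"

lemma koszul_sign_square [simp]: "koszul_sign f v A * koszul_sign f v A = (1::'a::comm_ring_1)"
  by (simp add: koszul_sign_def flip: power_mult_distrib)

lemma koszul_sign_minus_self [simp]: "koszul_sign f v (A - {v}) = koszul_sign f v A"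
  unfolding koszul_sign_def by (rule arg_cong[where f="\<lambda>S. (-1) ^ card S"]) auto

lemma koszul_sign_insert_self [simp]: "koszul_sign f v (insert v A) = koszul_sign f v A"
  unfolding koszul_sign_def by (rule arg_cong[where f="\<lambda>S. (-1) ^ card S"]) auto

lemma koszul_sign_insert:
  assumes "finite A" "u \<notin> A"
  shows "koszul_sign f v (insert u A) = (if f u < f v then - koszul_sign f v A else koszul_sign f v A)"
proof -
  have "{w \<in> insert u A. f w < f v} = (if f u < f v then insert u {w\<in>A. f w < f v} else {w\<in>A. f w < f v})"
    by auto
  then show ?thesis using assms by (auto simp: koszul_sign_def)
qed

lemma koszul_sign_swap:
  fixes f :: "'n::finite \<Rightarrow> nat"
  assumes "inj f" "v \<in> A" "u \<notin> A"
  shows "koszul_sign f u A * koszul_sign f v (insert u A) = - (koszul_sign f v A * koszul_sign f u (A - {v}) :: 'a::comm_ring_1)"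
proof -
  have "u \<noteq> v" using assms by auto
  then have ne: "f u \<noteq> f v" using assms(1) by (auto dest: injD)
  have "koszul_sign f u A = (koszul_sign f u (insert v (A - {v})) :: 'a)" using assms by (simp add: insert_absorb)
  then have "koszul_sign f u A = (if f v < f u then - koszul_sign f u (A - {v}) else koszul_sign f u (A - {v}) :: 'a)"
    by (simp only: koszul_sign_insert finite Diff_iff insertI1 simp_thms)
  moreover have "koszul_sign f v (insert u A) = (if f u < f v then - koszul_sign f v A else koszul_sign f v A :: 'a)"
    using assms by (simp add: koszul_sign_insert)
  ultimately show ?thesis using ne by (auto simp: mult.commute)
qed

text \<open>
  The summands for \<open>(v, u)\<close> and \<open>(u, v)\<close> cancel. The sum is split according to the order of the pair,
  because in characteristic two it does not suffice that it equals its negative.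
\<close>

lemma koszul_d_d:
  fixes f :: "'n::finite \<Rightarrow> nat" and \<phi> :: "'n set \<Rightarrow> 'a::comm_ring_1"
  assumes "inj f"
  shows "koszul_d f \<xi> (koszul_d f \<xi> \<phi>) A = 0"
proof -
  define T where "T = (\<lambda>(v, u). (koszul_sign f v A * koszul_sign f u (A - {v}) * \<xi> v * \<xi> u * \<phi> (A - {v} - {u}) :: 'a))"
  have "koszul_d f \<xi> (koszul_d f \<xi> \<phi>) A = (\<Sum>v\<in>A. \<Sum>u\<in>A - {v}. T (v, u))"
    unfolding koszul_d_def T_def by (simp add: sum_distrib_left algebra_simps)
  also have "\<dots> = sum T (SIGMA v:A. A - {v})" by (subst sum.Sigma) auto
  also have "(SIGMA v:A. A - {v}) = {(v,u). v \<in> A \<and> u \<in> A \<and> f v < f u} \<union> {(v,u). v \<in> A \<and> u \<in> A \<and> f u < f v}"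
    using assms by (auto dest: injD) (metis injD linorder_neqE_nat)
  also have "sum T \<dots> = sum T {(v,u). v \<in> A \<and> u \<in> A \<and> f v < f u} + sum T {(v,u). v \<in> A \<and> u \<in> A \<and> f u < f v}"
    by (rule sum.union_disjoint) (auto intro: finite_subset[OF _ finite])
  also have "sum T {(v,u). v \<in> A \<and> u \<in> A \<and> f u < f v} = sum (\<lambda>(v,u). T (u,v)) {(v,u). v \<in> A \<and> u \<in> A \<and> f v < f u}"
    by (rule sum.reindex_bij_witness[of _ "\<lambda>(v,u). (u,v)" "\<lambda>(v,u). (u,v)"]) auto
  also have "\<dots> = sum (\<lambda>x. - T x) {(v,u). v \<in> A \<and> u \<in> A \<and> f v < f u}"
  proof (rule sum.cong)
    fix x assume "x \<in> {(v,u). v \<in> A \<and> u \<in> A \<and> f v < f u}"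
    then obtain v u where x: "x = (v,u)" "v \<in> A" "u \<in> A" "f v < f u" by auto
    define B where "B = A - {v} - {u}"
    have B: "A - {v} = insert u B" "A - {u} = insert v B" "u \<notin> B" "v \<notin> B"
      using x by (auto simp: B_def)
    have "koszul_sign f v A = (koszul_sign f v (A - {v}) :: 'a)" "koszul_sign f u A = (koszul_sign f u (A - {u}) :: 'a)"
      by (simp_all only: koszul_sign_minus_self)
    then have "koszul_sign f v A = (koszul_sign f v B :: 'a)" "koszul_sign f u A = (- koszul_sign f u B :: 'a)"
      "koszul_sign f u (A - {v}) = (koszul_sign f u B :: 'a)" "koszul_sign f v (A - {u}) = (koszul_sign f v B :: 'a)"
      unfolding B(1,2) using x(4) B by (simp_all add: koszul_sign_insert)
    moreover have "A - {u} - {v} = B" "A - {v} - {u} = B" by (auto simp: B_def)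
    ultimately show "(case x of (v,u) \<Rightarrow> T (u,v)) = - T x"
      by (simp only: T_def x(1) prod.case) (simp add: mult.commute mult.left_commute)
  qed simp
  finally show ?thesis by (simp add: sum_negf)
qed

lemma koszul_homotopy:
  fixes f :: "'n::finite \<Rightarrow> nat" and \<phi> :: "'n set \<Rightarrow> 'a::comm_ring_1"
  assumes "inj f"
  shows "(\<Sum>v\<in>UNIV. a v * \<xi> v) * \<phi> A = koszul_d f \<xi> (koszul_h f a \<phi>) A + koszul_h f a (koszul_d f \<xi> \<phi>) A"
proof -
  let ?s = "koszul_sign f :: 'n \<Rightarrow> 'n set \<Rightarrow> 'a"
  let ?M = "\<lambda>v u. ?s v A * \<xi> v * ?s u (A - {v}) * a u * \<phi> (insert u (A - {v}))"
  have "koszul_d f \<xi> (koszul_h f a \<phi>) A = (\<Sum>v\<in>A. ?s v A * \<xi> v * (\<Sum>u\<in>insert v (-A). ?s u (A - {v}) * a u * \<phi> (insert u (A - {v}))))"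
    unfolding koszul_d_def koszul_h_def by (rule sum.cong) (auto intro!: arg_cong2[where f="(*)"] sum.cong)
  also have "\<dots> = (\<Sum>v\<in>A. a v * \<xi> v * \<phi> A + (\<Sum>u\<in>-A. ?M v u))"
  proof (rule sum.cong)
    fix v assume v: "v \<in> A"
    have "?s v A * \<xi> v * (?s v (A - {v}) * a v * \<phi> (insert v (A - {v}))) = (?s v A * ?s v A) * (a v * \<xi> v * \<phi> A)"
      using v by (simp add: insert_absorb mult.commute mult.left_commute del: koszul_sign_square)
    then show "?s v A * \<xi> v * (\<Sum>u\<in>insert v (-A). ?s u (A - {v}) * a u * \<phi> (insert u (A - {v})))
       = a v * \<xi> v * \<phi> A + (\<Sum>u\<in>-A. ?M v u)"
      using v by (simp add: distrib_left sum_distrib_left mult.assoc)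
  qed simp
  finally have 1: "koszul_d f \<xi> (koszul_h f a \<phi>) A = (\<Sum>v\<in>A. a v * \<xi> v * \<phi> A) + (\<Sum>v\<in>A. \<Sum>u\<in>-A. ?M v u)"
    by (simp add: sum.distrib)
  have "koszul_h f a (koszul_d f \<xi> \<phi>) A = (\<Sum>u\<in>-A. a u * \<xi> u * \<phi> A - (\<Sum>v\<in>A. ?M v u))"
    unfolding koszul_h_def koszul_d_def
  proof (rule sum.cong)
    fix u assume u: "u \<in> - A"
    have "(\<Sum>v\<in>insert u A. ?s v (insert u A) * \<xi> v * \<phi> (insert u A - {v}))
       = ?s u A * \<xi> u * \<phi> A + (\<Sum>v\<in>A. ?s v (insert u A) * \<xi> v * \<phi> (insert u (A - {v})))"
      using u by (simp add: sum.insert_if insert_Diff_if) (rule sum.cong, auto intro!: arg_cong2[where f="(*)"] arg_cong[where f=\<phi>])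
    moreover have "?s u A * a u * (?s u A * \<xi> u * \<phi> A) = (?s u A * ?s u A) * (a u * \<xi> u * \<phi> A)"
      by (simp add: mult.commute mult.left_commute del: koszul_sign_square)
    moreover have "?s u A * a u * (?s v (insert u A) * \<xi> v * \<phi> (insert u (A - {v}))) = - ?M v u" if "v \<in> A" for v
    proof -
      have "?s u A * a u * (?s v (insert u A) * \<xi> v * \<phi> (insert u (A - {v}))) = (?s u A * ?s v (insert u A)) * (a u * \<xi> v * \<phi> (insert u (A - {v})))"
        by (simp add: mult.commute mult.left_commute)
      also have "\<dots> = - ?M v u" using koszul_sign_swap[OF assms that, of u, where ?'a='a] u
        by (simp add: mult.commute mult.left_commute)
      finally show ?thesis .
    qed
    ultimately show "?s u A * a u * (\<Sum>v\<in>insert u A. ?s v (insert u A) * \<xi> v * \<phi> (insert u A - {v}))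
      = a u * \<xi> u * \<phi> A - (\<Sum>v\<in>A. ?M v u)"
      by (simp add: distrib_left sum_distrib_left sum_negf)
  qed simp
  also have "\<dots> = (\<Sum>u\<in>-A. a u * \<xi> u * \<phi> A) - (\<Sum>v\<in>A. \<Sum>u\<in>-A. ?M v u)"
    by (simp add: sum_subtractf sum.swap[of _ A])
  finally have 2: "koszul_h f a (koszul_d f \<xi> \<phi>) A = \<dots>" .
  have "(\<Sum>v\<in>UNIV. a v * \<xi> v) * \<phi> A = (\<Sum>v\<in>A \<union> - A. a v * \<xi> v * \<phi> A)"
    by (simp add: sum_distrib_right Compl_partition)
  also have "\<dots> = (\<Sum>v\<in>A. a v * \<xi> v * \<phi> A) + (\<Sum>u\<in>-A. a u * \<xi> u * \<phi> A)"
    by (rule sum.union_disjoint) auto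
  finally show ?thesis using 1 2 by simp
qed

lemma koszul_d_in:
  assumes "idl.subspace I" "\<And>v. v \<in> A \<Longrightarrow> \<phi> (A - {v}) \<in> I"
  shows "koszul_d f \<xi> \<phi> A \<in> I"
  unfolding koszul_d_def by (intro idl.subspace_sum idl.subspace_scale assms)

lemma koszul_h_in:
  assumes "idl.subspace I" "\<And>v. v \<notin> A \<Longrightarrow> \<phi> (insert v A) \<in> I"
  shows "koszul_h f \<xi> \<phi> A \<in> I"
  unfolding koszul_h_def by (intro idl.subspace_sum idl.subspace_scale assms) auto

lemma span_range_finite:
  fixes \<xi> :: "'n::finite \<Rightarrow> 'a::comm_ring_1"
  assumes "r \<in> idl.span (range \<xi>)"
  shows "\<exists>a. r = (\<Sum>v\<in>UNIV. a v * \<xi> v)"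
  using assms
proof (induction rule: idl.span_induct_alt)
  case base
  then show ?case by (intro exI[of _ "\<lambda>_. 0"]) simp
next
  case (step c x y)
  then obtain a w where "y = (\<Sum>v\<in>UNIV. a v * \<xi> v)" "x = \<xi> w" by auto
  then have "c * x + y = (\<Sum>v\<in>UNIV. (a v + (if v = w then c else 0)) * \<xi> v)"
    by (simp add: distrib_right sum.distrib if_distrib[of "\<lambda>z. z * _"] cong: if_cong)
  then show ?case by (rule exI[of _ "\<lambda>v. a v + (if v = w then c else 0)"])
qed

text \<open>
  Koszul cohomology with coefficients in \<open>I/(r\<^sub>0, \<dots>, r\<^bsub>j-1\<^esub>)I\<close> vanishes in degree \<open>i\<close> as long as \<open>i + j\<close> is
  less than the length of the sequence. The next entry \<open>r\<close> lies in \<open>(\<xi>)\<close>, so \<open>r \<phi>\<close> is a coboundary \<open>d \<eta>\<close>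
  by the homotopy. Modulo \<open>r\<close> the cochain \<open>\<eta>\<close> of degree \<open>i - 1\<close> is a cocycle, hence a coboundary by
  induction, and \<open>\<eta> = d \<psi>\<^sub>1 + r \<psi>'\<close> gives \<open>r \<phi> = r d \<psi>'\<close>. As \<open>r\<close> is a nonzerodivisor, \<open>\<phi> = d \<psi>'\<close>.
\<close>

lemma koszul_exact_relative:
  fixes \<xi> :: "'n::finite \<Rightarrow> 'a::comm_ring_1"
  assumes f: "inj f" and I: "idl.subspace I" and reg: "regular_on I rs" and sub: "set rs \<subseteq> idl.span (range \<xi>)"
    and "i + j < length rs"
    and "\<And>A. card A = i \<Longrightarrow> \<phi> A \<in> I"
    and "\<And>A. card A = Suc i \<Longrightarrow> koszul_d f \<xi> \<phi> A \<in> ideal_prod (set (take j rs)) I"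
  shows "\<exists>\<psi>. (\<forall>A. Suc (card A) = i \<longrightarrow> \<psi> A \<in> I) \<and>
      (\<forall>A. card A = i \<longrightarrow> \<phi> A - koszul_d f \<xi> \<psi> A \<in> ideal_prod (set (take j rs)) I)"
  using assms(5-)
proof (induction i arbitrary: j \<phi>)
  case 0
  let ?N = "ideal_prod (set (take j rs)) I"
  have j: "j < length rs" using 0 by simp
  then have "rs ! j \<in> idl.span (range \<xi>)" using sub by (auto simp: subset_iff)
  then obtain a where a: "rs ! j = (\<Sum>v\<in>UNIV. a v * \<xi> v)" using span_range_finite by blast
  have "rs ! j * \<phi> {} = koszul_d f \<xi> (koszul_h f a \<phi>) {} + koszul_h f a (koszul_d f \<xi> \<phi>) {}"
    unfolding a by (rule koszul_homotopy[OF f])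
  also have "koszul_d f \<xi> (koszul_h f a \<phi>) {} = 0" by (simp add: koszul_d_def)
  also have "0 + koszul_h f a (koszul_d f \<xi> \<phi>) {} \<in> ?N" using 0(3) by (auto intro!: koszul_h_in)
  finally have "\<phi> {} \<in> ?N" using reg j 0(2)[of "{}"] unfolding regular_on_def by auto
  then show ?case by (intro exI[of _ "\<lambda>_. 0"]) (auto simp: koszul_d_def)
next
  case (Suc i)
  let ?N = "ideal_prod (set (take j rs)) I"
  have j: "j < length rs" using Suc.prems by simp
  define r where "r = rs ! j"
  have "rs ! j \<in> idl.span (range \<xi>)" using sub j by (auto simp: subset_iff)
  then obtain a where a: "r = (\<Sum>v\<in>UNIV. a v * \<xi> v)" unfolding r_def using span_range_finite by blast
  define \<eta> where "\<eta> = koszul_h f a \<phi>"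
  have hom: "r * \<phi> A = koszul_d f \<xi> \<eta> A + koszul_h f a (koszul_d f \<xi> \<phi>) A" for A
    unfolding a \<eta>_def by (rule koszul_homotopy[OF f])
  have khN: "koszul_h f a (koszul_d f \<xi> \<phi>) A \<in> ?N" if "card A = Suc i" for A
    by (rule koszul_h_in) (use Suc.prems(3) that in auto)
  have take: "set (take (Suc j) rs) = insert r (set (take j rs))"
    using j by (simp add: take_Suc_conv_app_nth r_def)
  have NN: "?N \<subseteq> ideal_prod (insert r (set (take j rs))) I" by (rule ideal_prod_mono) auto
  have \<eta>I: "\<eta> A \<in> I" if "card A = i" for A
    unfolding \<eta>_def by (rule koszul_h_in[OF I]) (use Suc.prems(2) that in auto)
  have "koszul_d f \<xi> \<eta> A \<in> ideal_prod (set (take (Suc j) rs)) I" if A: "card A = Suc i" for A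
  proof -
    have "r * \<phi> A - koszul_h f a (koszul_d f \<xi> \<phi>) A \<in> ideal_prod (insert r (set (take j rs))) I"
      by (intro idl.subspace_diff[OF subspace_ideal_prod] ideal_prod_base) (use khN[OF A] NN Suc.prems(2) A in auto)
    then show ?thesis unfolding take using hom[of A] by simp
  qed
  then obtain \<psi>1 where \<psi>1: "\<And>A. card A = i \<Longrightarrow> \<eta> A - koszul_d f \<xi> \<psi>1 A \<in> ideal_prod (set (take (Suc j) rs)) I"
    using Suc.IH[of "Suc j" \<eta>] Suc.prems(1) \<eta>I by auto
  have "\<exists>y. y \<in> I \<and> z - r * y \<in> ?N" if "z \<in> ideal_prod (insert r (set (take j rs))) I" for z
  proof -
    let ?T = "{z. \<exists>y. y \<in> I \<and> z - r * y \<in> ?N}"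
    have N: "idl.subspace ?N" by simp
    have "idl.subspace ?T"
    proof (rule idl.subspaceI)
      show "0 \<in> ?T" using idl.subspace_0[OF I] idl.subspace_0[OF N] by (auto intro!: exI[of _ 0])
      fix x y assume "x \<in> ?T" "y \<in> ?T"
      then obtain x' y' where "x' \<in> I" "y' \<in> I" "x - r * x' \<in> ?N" "y - r * y' \<in> ?N" by auto
      moreover have "(x + y) - r * (x' + y') = (x - r * x') + (y - r * y')" by (simp add: algebra_simps)
      ultimately show "x + y \<in> ?T" using idl.subspace_add[OF I] idl.subspace_add[OF N] by (metis (mono_tags, lifting) mem_Collect_eq)
    next
      fix c x assume "x \<in> ?T"
      then obtain x' where "x' \<in> I" "x - r * x' \<in> ?N" by auto
      moreover have "c * x - r * (c * x') = c * (x - r * x')" by (simp add: algebra_simps)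
      ultimately show "c * x \<in> ?T" using idl.subspace_scale[OF I] idl.subspace_scale[OF N] by (metis (mono_tags, lifting) mem_Collect_eq)
    qed
    then have "ideal_prod (insert r (set (take j rs))) I \<subseteq> ?T"
    proof (rule ideal_prod_minimal)
      fix b x assume b: "b \<in> insert r (set (take j rs))" and x: "x \<in> I"
      show "b * x \<in> ?T"
      proof (cases "b = r")
        case True
        then show ?thesis using x idl.subspace_0[OF N] by (auto intro!: exI[of _ x])
      next
        case False
        then show ?thesis using b x idl.subspace_0[OF I] by (auto intro!: exI[of _ 0] ideal_prod_base)
      qed
    qed
    then show ?thesis using that by blast
  qed
  then have "\<forall>A. \<exists>y. card A = i \<longrightarrow> y \<in> I \<and> \<eta> A - koszul_d f \<xi> \<psi>1 A - r * y \<in> ?N"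
    using \<psi>1 unfolding take by blast
  then obtain \<psi>' where \<psi>': "\<And>A. card A = i \<Longrightarrow> \<psi>' A \<in> I"
    "\<And>A. card A = i \<Longrightarrow> \<eta> A - koszul_d f \<xi> \<psi>1 A - r * \<psi>' A \<in> ?N" by metis
  have "\<phi> A - koszul_d f \<xi> \<psi>' A \<in> ?N" if A: "card A = Suc i" for A
  proof -
    have cardA: "card (A - {v}) = i" if "v \<in> A" for v using A that by simp
    have "koszul_d f \<xi> (\<lambda>A. \<eta> A - koszul_d f \<xi> \<psi>1 A - r * \<psi>' A) A = koszul_d f \<xi> \<eta> A - koszul_d f \<xi> (koszul_d f \<xi> \<psi>1) A - r * koszul_d f \<xi> \<psi>' A"
      unfolding koszul_d_def[of f \<xi> _ A] by (simp add: algebra_simps sum.distrib sum_subtractf sum_distrib_left)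
    then have "koszul_d f \<xi> \<eta> A - r * koszul_d f \<xi> \<psi>' A = koszul_d f \<xi> (\<lambda>A. \<eta> A - koszul_d f \<xi> \<psi>1 A - r * \<psi>' A) A"
      by (simp add: koszul_d_d[OF f])
    also have "\<dots> \<in> ?N" by (rule koszul_d_in) (use \<psi>' cardA in auto)
    finally have "(koszul_d f \<xi> \<eta> A - r * koszul_d f \<xi> \<psi>' A) + koszul_h f a (koszul_d f \<xi> \<phi>) A \<in> ?N"
      using khN[OF A] by (intro idl.subspace_add[OF subspace_ideal_prod])
    then have "r * (\<phi> A - koszul_d f \<xi> \<psi>' A) \<in> ?N" using hom[of A] by (simp add: algebra_simps)
    moreover have "\<phi> A - koszul_d f \<xi> \<psi>' A \<in> I"
      by (intro idl.subspace_diff[OF I] koszul_d_in[OF I]) (use Suc.prems(2) A \<psi>' cardA in auto)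
    ultimately show ?thesis using reg j unfolding regular_on_def r_def by blast
  qed
  then show ?case using \<psi>'(1) by (intro exI[of _ \<psi>']) auto
qed

lemma koszul_exact:
  fixes \<xi> :: "'n::finite \<Rightarrow> 'a::comm_ring_1"
  assumes f: "inj f" and I: "idl.subspace I" and reg: "regular_on I rs" and sub: "set rs \<subseteq> idl.span (range \<xi>)"
    and i: "i < length rs"
    and \<phi>: "\<And>A. card A = i \<Longrightarrow> \<phi> A \<in> I" "\<And>A. card A = Suc i \<Longrightarrow> koszul_d f \<xi> \<phi> A = 0"
  obtains \<psi> where "\<And>A. Suc (card A) = i \<Longrightarrow> \<psi> A \<in> I" "\<And>A. card A = i \<Longrightarrow> \<phi> A = koszul_d f \<xi> \<psi> A"
  using koszul_exact_relative[OF f I reg sub, of i 0 \<phi>] i \<phi> that by (auto simp: ideal_prod_def)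

section \<open>Substitution in polynomials\<close>

lemma monomial_mult: "(monomial a :: ('n, 'k::field) mpoly) * monomial b = monomial (a + b)"
  by (simp add: monomial_def mult_single)

lemma monomial_0: "(monomial 0 :: ('n, 'k::field) mpoly) = 1"
  by (simp add: monomial_def)

lemma var_power: "(var v :: ('n, 'k::field) mpoly) ^ k = monomial (Poly_Mapping.single v k)"
  by (induction k) (simp_all add: monomial_0 var_def monomial_mult flip: single_add)

lemma prod_monomial: "(\<Prod>v\<in>A. (monomial (h v) :: ('n, 'k::field) mpoly)) = monomial (\<Sum>v\<in>A. h v)"
  by (induction A rule: infinite_finite_induct) (simp_all add: monomial_0 monomial_mult)

lemma single_eq_const_mult: "Poly_Mapping.single e c = Poly_Mapping.single 0 c * (monomial e :: ('n, 'k::field) mpoly)"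
  by (simp add: monomial_def mult_single)

lemma poly_mapping_sum_single: "p = (\<Sum>e\<in>Poly_Mapping.keys p. Poly_Mapping.single e (Poly_Mapping.lookup p e))"
  by (rule poly_mapping_eqI)
    (simp add: lookup_sum lookup_single when_def in_keys_iff sum.delta)

text \<open>
  The homomorphism over the field that sends the variable \<open>v\<close> to \<open>\<sigma> v\<close>.
\<close>

definition subst :: "('n::finite \<Rightarrow> ('m, 'k::field) mpoly) \<Rightarrow> ('n, 'k) mpoly \<Rightarrow> ('m, 'k) mpoly" where
  "subst \<sigma> p = (\<Sum>e\<in>Poly_Mapping.keys p. Poly_Mapping.single 0 (Poly_Mapping.lookup p e) *
      (\<Prod>v\<in>UNIV. \<sigma> v ^ Poly_Mapping.lookup e v))"

lemma subst_add: "subst \<sigma> (p + q) = subst \<sigma> p + subst \<sigma> q"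
  unfolding subst_def
  by (rule setsum_keys_plus_distrib) (simp_all add: single_add distrib_right)

lemma subst_0 [simp]: "subst \<sigma> 0 = 0"
  by (simp add: subst_def)

lemma subst_sum: "subst \<sigma> (sum h A) = (\<Sum>x\<in>A. subst \<sigma> (h x))"
  by (induction A rule: infinite_finite_induct) (simp_all add: subst_add)

lemma subst_single:
  "subst \<sigma> (Poly_Mapping.single e c) = Poly_Mapping.single 0 c * (\<Prod>v\<in>UNIV. \<sigma> v ^ Poly_Mapping.lookup e v)"
  by (cases "c = 0") (simp_all add: subst_def)

lemma subst_uminus: "subst \<sigma> (- p) = - subst \<sigma> p"
  using subst_add[of \<sigma> p "- p"] by (simp add: eq_neg_iff_add_eq_0 add.commute)

lemma subst_diff: "subst \<sigma> (p - q) = subst \<sigma> p - subst \<sigma> q"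
  using subst_add[of \<sigma> p "- q"] by (simp add: subst_uminus)

lemma subst_mult: "subst \<sigma> (p * q) = subst \<sigma> p * subst \<sigma> q"
proof -
  have s: "subst \<sigma> (Poly_Mapping.single a c * Poly_Mapping.single b d) =
      subst \<sigma> (Poly_Mapping.single a c) * subst \<sigma> (Poly_Mapping.single b d)" for a b c d
    unfolding mult_single subst_single
    by (simp add: lookup_add power_add prod.distrib mult.assoc mult.left_commute mult_single[of 0 _ 0, simplified, symmetric])
  have "subst \<sigma> (p * q) = subst \<sigma> ((\<Sum>a\<in>Poly_Mapping.keys p. Poly_Mapping.single a (Poly_Mapping.lookup p a)) *
      (\<Sum>b\<in>Poly_Mapping.keys q. Poly_Mapping.single b (Poly_Mapping.lookup q b)))"
    by (simp flip: poly_mapping_sum_single)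
  also have "\<dots> = subst \<sigma> (\<Sum>a\<in>Poly_Mapping.keys p. Poly_Mapping.single a (Poly_Mapping.lookup p a)) *
      subst \<sigma> (\<Sum>b\<in>Poly_Mapping.keys q. Poly_Mapping.single b (Poly_Mapping.lookup q b))"
    by (simp add: sum_product subst_sum s)
  finally show ?thesis by (simp flip: poly_mapping_sum_single)
qed

lemma subst_1 [simp]: "subst \<sigma> 1 = 1"
  using subst_single[of \<sigma> 0 1] by simp

lemma subst_power: "subst \<sigma> (p ^ k) = subst \<sigma> p ^ k"
  by (induction k) (simp_all add: subst_mult)

lemma prod_single_power:
  "(\<Prod>u\<in>UNIV. (h u :: 'a::comm_monoid_mult) ^ Poly_Mapping.lookup (Poly_Mapping.single (v::'n::finite) k) u) = h v ^ k"
proof -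
  have "(\<Prod>u\<in>UNIV. h u ^ Poly_Mapping.lookup (Poly_Mapping.single v k) u) = (\<Prod>u\<in>UNIV. if u = v then h v ^ k else 1)"
    by (rule prod.cong) (auto simp: lookup_single when_def)
  then show ?thesis by simp
qed

lemma subst_var [simp]: "subst \<sigma> (var v) = \<sigma> v"
  by (simp add: var_def monomial_def subst_single prod_single_power)

lemma var_neq_0 [simp]: "(var v :: ('n, 'k::field) mpoly) \<noteq> 0"
  by (simp add: var_def monomial_def flip: keys_eq_empty)

text \<open>
  A numbering of the variables embeds the ring into the polynomial ring in variables indexed by the
  natural numbers, whose exponents are linearly ordered and which is therefore already known to be a
  domain.
\<close>

lemma mpoly_integral:
  fixes p q :: "('n::finite, 'k::field) mpoly"
  assumes "p * q = 0"
  shows "p = 0 \<or> q = 0"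
proof -
  obtain f :: "'n \<Rightarrow> nat" where f: "inj f" using finite_imp_inj_to_nat_seg[of "UNIV :: 'n set"] by auto
  \<comment> \<open>\<open>g\<close> renumbers exponents and is injective; \<open>h\<close> is the induced map of polynomials\<close>
  define g where "g = (\<lambda>e :: 'n \<Rightarrow>\<^sub>0 nat. \<Sum>v\<in>UNIV. Poly_Mapping.single (f v) (Poly_Mapping.lookup e v))"
  have g: "Poly_Mapping.lookup (g e) (f v) = Poly_Mapping.lookup e v" for e v
    unfolding g_def using f by (simp add: lookup_sum lookup_single when_def inj_eq)
  have g_inj: "g a = g b \<longleftrightarrow> a = b" for a b
    using g by (metis poly_mapping_eqI)
  define h where "h = (subst (\<lambda>v. var (f v)) :: ('n,'k) mpoly \<Rightarrow> (nat,'k) mpoly)"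
  have h: "h r = (\<Sum>e\<in>Poly_Mapping.keys r. Poly_Mapping.single (g e) (Poly_Mapping.lookup r e))" for r
    unfolding h_def subst_def var_power prod_monomial g_def single_eq_const_mult[symmetric] ..
  have "Poly_Mapping.lookup (h r) (g e) = Poly_Mapping.lookup r e" for r e
    unfolding h by (simp add: lookup_sum lookup_single when_def g_inj in_keys_iff)
  then have inj: "h r = 0 \<Longrightarrow> r = 0" for r
    by (metis lookup_zero poly_mapping_eqI)
  have "h p * h q = 0" using assms unfolding h_def by (simp flip: subst_mult)
  then have "h p = 0 \<or> h q = 0" by simp
  then show ?thesis using inj by blast
qed

text \<open>
  For an ideal \<open>I\<close>, a substitution that moves every variable by an element of \<open>I\<close> is the identity modulo
  \<open>I\<close>. This turns kernels of substitutions into explicit ideals.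
\<close>

lemma subst_congruence:
  assumes I: "idl.subspace I" and \<sigma>: "\<And>v. var v - \<sigma> v \<in> I"
  shows "p - subst \<sigma> p \<in> (I :: ('n::finite, 'k::field) mpoly set)"
proof -
  \<comment> \<open>congruence modulo \<open>I\<close> is compatible with products, powers and sums\<close>
  define R where "R = (\<lambda>a b. a - b \<in> I)"
  have R_mult: "R (a * b) (a' * b')" if "R a a'" "R b b'" for a b a' b'
  proof -
    have "b * (a - a') + a' * (b - b') \<in> I"
      using that unfolding R_def by (intro idl.subspace_add[OF I] idl.subspace_scale[OF I])
    then show ?thesis by (simp add: R_def algebra_simps)
  qed
  have R_refl: "R a a" for a using idl.subspace_0[OF I] by (simp add: R_def)
  have R_pow: "R (a ^ k) (b ^ k)" if "R a b" for a b k
    by (induction k) (auto intro: R_mult R_refl that)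
  have R_prod: "R (\<Prod>v\<in>A. h v) (\<Prod>v\<in>A. h' v)" if "\<And>v. R (h v) (h' v)" for h h' and A :: "'n set"
    by (induction A rule: infinite_finite_induct) (auto intro: R_mult R_refl that)
  have R_sum: "R (\<Sum>v\<in>A. h v) (\<Sum>v\<in>A. h' v)" if "\<And>v. R (h v) (h' v)" for h h' and A :: "('n \<Rightarrow>\<^sub>0 nat) set"
    unfolding R_def sum_subtractf[symmetric] using that by (intro idl.subspace_sum[OF I]) (simp add: R_def)
  have e: "e = (\<Sum>v\<in>UNIV. Poly_Mapping.single v (Poly_Mapping.lookup e v))" for e :: "'n \<Rightarrow>\<^sub>0 nat"
    by (rule poly_mapping_eqI) (simp add: lookup_sum lookup_single when_def)
  have "p = subst var p"
    unfolding subst_def var_power prod_monomial e[symmetric] single_eq_const_mult[symmetric]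
    by (rule poly_mapping_sum_single)
  also have "R (subst var p) (subst \<sigma> p)"
    unfolding subst_def by (intro R_sum R_mult R_refl R_prod R_pow) (use \<sigma> in \<open>simp add: R_def\<close>)
  finally show ?thesis unfolding R_def .
qed

section \<open>Ideals of simplicial complexes\<close>

text \<open>
  If \<open>S\<close> is closed under supersets, this is the ideal spanned by the monomials with support in \<open>S\<close>. Sums
  and intersections of such ideals are unions and intersections of the set systems.
\<close>

definition supported :: "'n set set \<Rightarrow> ('n, 'k::field) mpoly set" where
  "supported S = {p. \<forall>e\<in>Poly_Mapping.keys p. Poly_Mapping.keys e \<in> S}"

definition upclosed :: "'n set set \<Rightarrow> bool" where
  "upclosed S \<longleftrightarrow> (\<forall>A\<in>S. \<forall>B. A \<subseteq> B \<longrightarrow> B \<in> S)"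

lemma keys_exponent_add: "Poly_Mapping.keys (a + b :: 'n \<Rightarrow>\<^sub>0 nat) = Poly_Mapping.keys a \<union> Poly_Mapping.keys b"
  by (auto simp: in_keys_iff lookup_add)

lemma subspace_supported:
  assumes "upclosed S"
  shows "idl.subspace (supported S :: ('n, 'k::field) mpoly set)"
proof (rule idl.subspaceI)
  show "0 \<in> supported S" by (simp add: supported_def)
  fix p q :: "('n, 'k) mpoly" assume "p \<in> supported S" "q \<in> supported S"
  then show "p + q \<in> supported S" using keys_add[of p q] by (auto simp: supported_def)
next
  fix c p :: "('n, 'k) mpoly" assume p: "p \<in> supported S"
  show "c * p \<in> supported S"
    unfolding supported_def
  proof (intro CollectI ballI)
    fix e assume "e \<in> Poly_Mapping.keys (c * p)"
    then obtain a b where "e = a + b" "b \<in> Poly_Mapping.keys p" using keys_mult[of c p] by auto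
    moreover from this have "Poly_Mapping.keys b \<in> S" using p by (simp add: supported_def)
    ultimately show "Poly_Mapping.keys e \<in> S"
      using assms unfolding upclosed_def by (metis keys_exponent_add sup_ge2)
  qed
qed

lemma single_in_supported: "Poly_Mapping.keys e \<in> S \<Longrightarrow> Poly_Mapping.single e c \<in> supported S"
  by (simp add: supported_def)

lemma span_supported_Un:
  assumes "upclosed S" "upclosed T"
  shows "idl.span (supported S \<union> supported T) = (supported (S \<union> T) :: ('n, 'k::field) mpoly set)"
proof
  show "idl.span (supported S \<union> supported T) \<subseteq> supported (S \<union> T)"
    using assms by (intro idl.span_minimal subspace_supported) (auto simp: supported_def upclosed_def)
  show "supported (S \<union> T) \<subseteq> idl.span (supported S \<union> supported T :: ('n, 'k::field) mpoly set)"
  proof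
    fix p :: "('n, 'k) mpoly" assume p: "p \<in> supported (S \<union> T)"
    have "(\<Sum>e\<in>Poly_Mapping.keys p. Poly_Mapping.single e (Poly_Mapping.lookup p e)) \<in> idl.span (supported S \<union> supported T)"
      using p by (intro idl.span_sum idl.span_base) (auto simp: supported_def intro: single_in_supported)
    then show "p \<in> idl.span (supported S \<union> supported T)" by (simp flip: poly_mapping_sum_single)
  qed
qed

text \<open>
  The Stanley-Reisner ideal of the complex whose faces are the subsets of members of \<open>FF\<close>. For one set
  \<open>F\<close> it is the prime generated by the variables outside \<open>F\<close>, for \<open>FF = {}\<close> it is the whole ring.
\<close>

definition face_ideal :: "'n set set \<Rightarrow> ('n, 'k::field) mpoly set" where
  "face_ideal FF = supported {T. \<forall>F\<in>FF. \<not> T \<subseteq> F}"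

lemma upclosed_nonfaces: "upclosed {T. \<forall>F\<in>FF. \<not> T \<subseteq> F}"
  by (auto simp: upclosed_def)

lemma subspace_face_ideal [simp]: "idl.subspace (face_ideal FF)"
  unfolding face_ideal_def by (rule subspace_supported[OF upclosed_nonfaces])

lemma span_face_ideal [simp]: "idl.span (face_ideal FF) = face_ideal FF"
  using idl.span_eq_iff subspace_face_ideal by blast

lemma face_ideal_insert: "face_ideal (insert F FF) = face_ideal FF \<inter> face_ideal {F}"
  by (auto simp: face_ideal_def supported_def)

text \<open>Geometrically: the intersection of a complex with a simplex.\<close>

lemma face_ideal_sum: "idl.span (face_ideal FF \<union> face_ideal {F}) = face_ideal ((\<lambda>G. G \<inter> F) ` FF)"
  unfolding face_ideal_def span_supported_Un[OF upclosed_nonfaces upclosed_nonfaces]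
  by (rule arg_cong[where f=supported]) auto

lemma face_ideal_mono: "(\<And>F. F \<in> FF \<Longrightarrow> \<exists>G\<in>GG. F \<subseteq> G) \<Longrightarrow> face_ideal GG \<subseteq> face_ideal FF"
  by (fastforce simp: face_ideal_def supported_def)

lemma face_ideal_cong:
  assumes "\<And>F. F \<in> FF \<Longrightarrow> \<exists>G\<in>GG. F \<subseteq> G" "\<And>F. F \<in> GG \<Longrightarrow> \<exists>G\<in>FF. F \<subseteq> G"
  shows "face_ideal FF = face_ideal GG"
  using face_ideal_mono[of FF GG] face_ideal_mono[of GG FF] assms by blast

lemma face_ideal_UNIV: "face_ideal {UNIV} = {0}"
  by (auto simp: face_ideal_def supported_def simp flip: keys_eq_empty)

lemma var_in_face_ideal_iff: "var v \<in> face_ideal {F} \<longleftrightarrow> v \<notin> F"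
  by (auto simp: face_ideal_def supported_def var_def monomial_def)

lemma subst_kills_face_ideal:
  assumes "\<And>v. v \<notin> F \<Longrightarrow> \<tau> v = 0" "p \<in> face_ideal {F}"
  shows "subst \<tau> p = 0"
  unfolding subst_def
proof (rule sum.neutral, rule ballI)
  fix e assume "e \<in> Poly_Mapping.keys p"
  then have "\<not> Poly_Mapping.keys e \<subseteq> F" using assms(2) by (auto simp: face_ideal_def supported_def)
  then obtain v where "v \<in> Poly_Mapping.keys e" "v \<notin> F" by auto
  then have "\<tau> v ^ Poly_Mapping.lookup e v = 0" using assms(1) by (simp add: in_keys_iff zero_power)
  then have "(\<Prod>v\<in>UNIV. \<tau> v ^ Poly_Mapping.lookup e v) = 0" by (intro prod_zero bexI) auto
  then show "Poly_Mapping.single 0 (Poly_Mapping.lookup p e) * (\<Prod>v\<in>UNIV. \<tau> v ^ Poly_Mapping.lookup e v) = 0" by simp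
qed

lemma subst_kills_span:
  assumes "\<And>p. p \<in> A \<Longrightarrow> subst \<tau> p = 0" "p \<in> idl.span A"
  shows "subst \<tau> p = 0"
  using assms(2)
proof (induction rule: idl.span_induct_alt)
  case base
  then show ?case by simp
next
  case (step c x y)
  then show ?case using assms(1) by (simp add: subst_add subst_mult)
qed

section \<open>Colour sums modulo the primes of the complex\<close>

definition colour_sum :: "'n set \<Rightarrow> ('n, 'k::field) mpoly" where
  "colour_sum D = (\<Sum>v\<in>D. var v)"

lemma subst_colour_sum: "subst \<tau> (colour_sum (D :: 'n::finite set)) = (\<Sum>v\<in>D. \<tau> v)"
  by (simp add: colour_sum_def subst_sum)

abbreviation colour_ideal :: "'n set \<Rightarrow> 'n set set \<Rightarrow> ('n, 'k::field) mpoly set" where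
  "colour_ideal F DD \<equiv> idl.span (face_ideal {F} \<union> colour_sum ` DD)"

text \<open>
  Every colour class that meets \<open>F\<close> gets a pivot in \<open>F\<close>. The substitution \<open>\<sigma>\<close> kills the variables
  outside \<open>F\<close> and solves each colour sum for its pivot; the quotient is thus a polynomial ring in the
  remaining variables.
\<close>

lemma colour_ideal_kernel:
  fixes F :: "'n::finite set"
  assumes disj: "disjoint DD"
  obtains \<sigma> :: "'n \<Rightarrow> ('n, 'k::field) mpoly" where "(colour_ideal F DD :: ('n, 'k::field) mpoly set) = {p. subst \<sigma> p = 0}"
proof -
  let ?I = "colour_ideal F DD :: ('n, 'k) mpoly set"
  define piv where "piv D = (SOME v. v \<in> D \<inter> F)" for D
  define \<sigma> :: "'n \<Rightarrow> ('n, 'k) mpoly" where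
    "\<sigma> v = (if v \<notin> F then 0 else if \<exists>D\<in>DD. v \<in> D \<and> v = piv D
        then - (\<Sum>u\<in>(THE D. D \<in> DD \<and> v \<in> D) \<inter> F - {v}. var u) else var v)" for v
  have the: "(THE D. D \<in> DD \<and> v \<in> D) = D" if "D \<in> DD" "v \<in> D" for v D
    using that disj by (intro the_equality) (auto simp: disjoint_def)
  have piv: "piv D \<in> D \<inter> F" if "D \<inter> F \<noteq> {}" for D
    unfolding piv_def by (rule someI_ex) (use that in auto)
  have inI: "var v \<in> ?I" if "v \<notin> F" for v
    by (intro idl.span_base) (use that in \<open>simp add: var_in_face_ideal_iff\<close>)
  have "var v - \<sigma> v \<in> ?I" for v
  proof (cases "v \<in> F \<and> (\<exists>D\<in>DD. v \<in> D \<and> v = piv D)")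
    case True
    then obtain D where D: "D \<in> DD" "v \<in> D" "v = piv D" "v \<in> F" by auto
    then have s: "\<sigma> v = - (\<Sum>u\<in>D \<inter> F - {v}. var u)" using the[OF D(1,2)] by (auto simp: \<sigma>_def)
    have "colour_sum D = (\<Sum>u\<in>D \<inter> F. var u) + (\<Sum>u\<in>D - F. var u)"
      unfolding colour_sum_def by (subst sum.union_disjoint[symmetric]) (auto intro: sum.cong)
    also have "(\<Sum>u\<in>D \<inter> F. var u) = var v - \<sigma> v"
      using D s by (simp add: sum.remove[of "D \<inter> F" v])
    finally have "var v - \<sigma> v = colour_sum D - (\<Sum>u\<in>D - F. var u)" by simp
    also have "\<dots> \<in> ?I"
      by (intro idl.span_diff idl.span_sum) (use D in \<open>auto intro: idl.span_base inI\<close>)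
    finally show ?thesis .
  next
    case False
    then show ?thesis using inI[of v] idl.span_zero by (auto simp: \<sigma>_def)
  qed
  then have *: "p - subst \<sigma> p \<in> ?I" for p by (intro subst_congruence) auto
  have "subst \<sigma> p = 0" if "p \<in> ?I" for p
  proof (rule subst_kills_span[OF _ that])
    fix q :: "('n, 'k) mpoly" assume "q \<in> face_ideal {F} \<union> colour_sum ` DD"
    then show "subst \<sigma> q = 0"
    proof
      assume "q \<in> face_ideal {F}"
      then show ?thesis by (rule subst_kills_face_ideal[rotated]) (simp add: \<sigma>_def)
    next
      assume "q \<in> colour_sum ` DD"
      then obtain D where D: "D \<in> DD" "q = colour_sum D" by auto
      have "(\<Sum>v\<in>D. \<sigma> v) = (\<Sum>v\<in>D \<inter> F. \<sigma> v)"
        by (rule sum.mono_neutral_right) (auto simp: \<sigma>_def)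
      also have "\<dots> = 0"
      proof (cases "D \<inter> F = {}")
        case False
        let ?p = "piv D"
        have p: "?p \<in> D \<inter> F" by (rule piv[OF False])
        have "\<sigma> u = var u" if "u \<in> D \<inter> F - {?p}" for u
        proof -
          have "D' = D" if "D' \<in> DD" "u \<in> D'" for D'
            using that D \<open>u \<in> D \<inter> F - {?p}\<close> disj by (auto simp: disjoint_def)
          then have "\<not> (\<exists>D\<in>DD. u \<in> D \<and> u = piv D)" using that by auto
          then show ?thesis using that by (auto simp: \<sigma>_def)
        qed
        moreover have "\<sigma> ?p = - (\<Sum>u\<in>D \<inter> F - {?p}. var u)"
          using p the[OF D(1), of ?p] D(1) by (auto simp: \<sigma>_def)
        ultimately show ?thesis using p by (simp add: sum.remove[of "D \<inter> F" ?p])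
      qed auto
      finally show ?thesis using D by (simp add: subst_colour_sum)
    qed
  qed
  moreover have "p \<in> ?I" if "subst \<sigma> p = 0" for p using *[of p] that by simp
  ultimately have "?I = {p. subst \<sigma> p = 0}" by blast
  then show ?thesis by (rule that)
qed

lemma colour_ideal_prime:
  fixes F :: "'n::finite set"
  assumes "disjoint DD" "x * y \<in> colour_ideal F DD"
  shows "x \<in> colour_ideal F DD \<or> y \<in> (colour_ideal F DD :: ('n, 'k::field) mpoly set)"
proof -
  obtain \<sigma> :: "'n \<Rightarrow> ('n, 'k) mpoly" where \<sigma>: "(colour_ideal F DD :: ('n, 'k::field) mpoly set) = {p. subst \<sigma> p = 0}"
    using colour_ideal_kernel[OF assms(1)] .
  have "subst \<sigma> x * subst \<sigma> y = 0" using assms(2) unfolding \<sigma> by (simp add: subst_mult)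
  from mpoly_integral[OF this] show ?thesis unfolding \<sigma> by simp
qed

lemma face_ideal_prime:
  fixes F :: "'n::finite set"
  assumes "x * y \<in> face_ideal {F}"
  shows "x \<in> face_ideal {F} \<or> y \<in> (face_ideal {F} :: ('n, 'k::field) mpoly set)"
proof -
  have "(colour_ideal F {} :: ('n, 'k::field) mpoly set) = face_ideal {F}" by simp
  then show ?thesis using colour_ideal_prime[of "{}" x y F] assms by (simp add: disjoint_def)
qed

text \<open>
  The tool for all nonmembership proofs below: an evaluation that kills the generators but not \<open>p\<close>.
\<close>

lemma not_in_colour_ideal:
  fixes \<tau> :: "'a::finite \<Rightarrow> ('b, 'c::field) mpoly"
  assumes "subst \<tau> p \<noteq> 0" "\<And>v. v \<notin> F \<Longrightarrow> \<tau> v = 0" "\<And>D. D \<in> DD \<Longrightarrow> (\<Sum>v\<in>D. \<tau> v) = 0"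
  shows "p \<notin> colour_ideal F DD"
proof
  assume p: "p \<in> colour_ideal F DD"
  have "subst \<tau> p = 0"
  proof (rule subst_kills_span[OF _ p])
    fix q :: "('a, 'c) mpoly" assume "q \<in> face_ideal {F} \<union> colour_sum ` DD"
    then show "subst \<tau> q = 0"
      using subst_kills_face_ideal[of F \<tau> q] assms(2,3) by (auto simp: subst_colour_sum)
  qed
  with assms(1) show False by simp
qed

text \<open>
  All ideals met on the way are prime, so it is enough that a new colour sum is not in the previous
  ideal. This is seen by setting all variables to zero except one of the new colour on \<open>F\<close>.
\<close>

lemma weakly_regular_colours:
  fixes F :: "'n::finite set"
  assumes "disjoint (set Ds)" "distinct Ds" "\<And>D. D \<in> set Ds \<Longrightarrow> D \<inter> F \<noteq> {}"
  shows "weakly_regular (face_ideal {F} :: ('n, 'k::field) mpoly set) (map colour_sum Ds)"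
  using assms
proof (induction Ds rule: rev_induct)
  case Nil
  then show ?case by simp
next
  case (snoc D Ds)
  obtain w where w: "w \<in> D" "w \<in> F" using snoc.prems(3)[of D] by auto
  have disj: "disjoint (set Ds)" using snoc.prems(1) by (auto simp: disjoint_def)
  have n: "colour_sum D \<notin> (colour_ideal F (set Ds) :: ('n, 'k) mpoly set)"
  proof (rule not_in_colour_ideal[where \<tau> = "\<lambda>v. if v = w then var w else 0"])
    show "subst (\<lambda>v. if v = w then var w else 0) (colour_sum D) \<noteq> (0 :: ('n, 'k) mpoly)"
      using w by (simp add: subst_colour_sum)
    fix E assume "E \<in> set Ds"
    then have "w \<notin> E" using snoc.prems w by (auto simp: disjoint_def)
    then show "(\<Sum>v\<in>E. if v = w then var w else 0) = (0 :: ('n, 'k) mpoly)" by simp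
  qed (use w in auto)
  have "weakly_regular (face_ideal {F} :: ('n, 'k) mpoly set) (map colour_sum Ds)"
    using snoc.prems by (intro snoc.IH disj) auto
  then show ?case
    using colour_ideal_prime[OF disj, of "colour_sum D" _ F] n by (auto simp: weakly_regular_snoc)
qed

text \<open>
  With distinct positive exponents this element replaces a generic linear form, which need not exist over
  a finite field.
\<close>

definition mixed_powers :: "('n \<Rightarrow> nat) \<Rightarrow> ('n::finite, 'k::field) mpoly" where
  "mixed_powers N = (\<Sum>v\<in>UNIV. var v ^ N v)"

text \<open>
  The condition under which \<open>F\<close> carries a regular element beyond the colour sums: some vertex of \<open>F\<close> is
  not needed to represent the colours.
\<close>

definition transversal :: "'n set set \<Rightarrow> 'n set \<Rightarrow> bool" where
  "transversal DD F \<longleftrightarrow> (\<forall>D\<in>DD. D \<inter> F \<noteq> {}) \<and>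
    ((\<exists>v\<in>F. v \<notin> \<Union>DD) \<or> (\<exists>D\<in>DD. \<exists>v\<in>F \<inter> D. \<exists>w\<in>F \<inter> D. v \<noteq> w))"

text \<open>
  On an uncoloured vertex \<open>v\<close> the sum of powers restricts to \<open>v\<^bsup>N v\<^esup>\<close>. For two vertices \<open>v\<close>, \<open>w\<close> of the
  same colour the evaluation \<open>w = -v\<close> kills the colour sum, but \<open>v\<^bsup>N v\<^esup> \<plusminus> v\<^bsup>N w\<^esup>\<close> is nonzero because
  the exponents differ.
\<close>

lemma mixed_powers_not_in_colour_ideal:
  fixes F :: "'n::finite set"
  assumes N: "inj N" "\<And>v. N v > 0" and "disjoint DD" and t: "transversal DD F"
  shows "(mixed_powers N :: ('n, 'k::field) mpoly) \<notin> colour_ideal F DD"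
proof -
  have z: "(0 :: ('n, 'k) mpoly) ^ N v = 0" for v using N(2)[of v] by (simp add: zero_power)
  have g: "subst \<tau> (mixed_powers N) = (\<Sum>v\<in>UNIV. \<tau> v ^ N v)" for \<tau> :: "'n \<Rightarrow> ('n, 'k) mpoly"
    by (simp add: mixed_powers_def subst_sum subst_power)
  from t consider (free) v where "v \<in> F" "v \<notin> \<Union>DD"
    | (pair) D v w where "D \<in> DD" "v \<in> F" "v \<in> D" "w \<in> F" "w \<in> D" "v \<noteq> w"
    unfolding transversal_def by blast
  then show ?thesis
  proof cases
    case free
    let ?\<tau> = "\<lambda>u. if u = v then var v else 0 :: ('n, 'k) mpoly"
    show ?thesis
    proof (rule not_in_colour_ideal[where \<tau> = ?\<tau>])
      have "subst ?\<tau> (mixed_powers N) = (\<Sum>u\<in>UNIV. if u = v then var v ^ N v else 0)"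
        unfolding g by (rule sum.cong) (auto simp: z)
      also have "\<dots> = monomial (Poly_Mapping.single v (N v))" by (simp add: var_power)
      also have "\<dots> \<noteq> 0" by (simp add: monomial_def flip: keys_eq_empty)
      finally show "subst ?\<tau> (mixed_powers N) \<noteq> 0" .
      fix D assume "D \<in> DD"
      then have "v \<notin> D" using free by auto
      then show "(\<Sum>u\<in>D. ?\<tau> u) = 0" by simp
    qed (use free in auto)
  next
    case pair
    let ?\<tau> = "\<lambda>u. if u = v then var v else if u = w then - var v else 0 :: ('n, 'k) mpoly"
    show ?thesis
    proof (rule not_in_colour_ideal[where \<tau> = ?\<tau>])
      let ?a = "Poly_Mapping.single v (N v)" and ?b = "Poly_Mapping.single v (N w)"
      have "subst ?\<tau> (mixed_powers N) = (\<Sum>u\<in>UNIV. (if u = v then var v ^ N v else 0) + (if u = w then (- var v) ^ N w else 0))"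
        unfolding g by (rule sum.cong) (use pair in \<open>auto simp: z\<close>)
      also have "\<dots> = var v ^ N v + (- var v) ^ N w" by (simp add: sum.distrib)
      also have "\<dots> = monomial ?a + (- 1) ^ N w * monomial ?b"
        by (subst power_minus) (simp add: var_power)
      finally have e: "subst ?\<tau> (mixed_powers N) = monomial ?a + (- 1) ^ N w * monomial ?b" .
      have "N v \<noteq> N w" using N pair by (auto dest: injD)
      then have "?a \<noteq> ?b" by (metis lookup_single_eq)
      then have "Poly_Mapping.lookup (subst ?\<tau> (mixed_powers N)) ?a = 1"
        unfolding e by (cases "even (N w)") (auto simp: lookup_add lookup_minus monomial_def lookup_single)
      then show "subst ?\<tau> (mixed_powers N) \<noteq> 0" by auto
      fix D' assume D': "D' \<in> DD"
      show "(\<Sum>u\<in>D'. ?\<tau> u) = 0"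
      proof (cases "D' = D")
        case True
        have "(\<Sum>u\<in>D'. ?\<tau> u) = (\<Sum>u\<in>{v,w}. ?\<tau> u)"
          by (rule sum.mono_neutral_right) (use pair True in auto)
        then show ?thesis using pair by simp
      next
        case False
        then have "v \<notin> D'" "w \<notin> D'" using pair D' assms(3) by (auto simp: disjoint_def)
        then show ?thesis by (intro sum.neutral) auto
      qed
    qed (use pair in auto)
  qed
qed

lemma weakly_regular_colours_powers:
  fixes F :: "'n::finite set"
  assumes N: "inj N" "\<And>v. N v > 0" and d: "disjoint (set Ds)" "distinct Ds" and t: "transversal (set Ds) F"
  shows "weakly_regular (face_ideal {F} :: ('n, 'k::field) mpoly set) (map colour_sum Ds @ [mixed_powers N])"
  using weakly_regular_colours[OF d, of F] colour_ideal_prime[OF d(1), of "mixed_powers N" _ F] mixed_powers_not_in_colour_ideal[OF N d(1) t] t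
  by (auto simp: weakly_regular_snoc transversal_def)

lemma face_ideal_subset_span_vars: "(face_ideal {F} :: ('n::finite, 'k::field) mpoly set) \<subseteq> idl.span (var ` (- F))"
proof
  fix p :: "('n, 'k) mpoly" assume p: "p \<in> face_ideal {F}"
  have "Poly_Mapping.single e c \<in> idl.span (var ` (- F))" if e: "e \<in> Poly_Mapping.keys p" for e and c :: 'k
  proof -
    have "\<not> Poly_Mapping.keys e \<subseteq> F" using p e by (auto simp: face_ideal_def supported_def)
    then obtain u where u: "u \<in> Poly_Mapping.keys e" "u \<notin> F" by auto
    then have "e = (e - Poly_Mapping.single u 1) + Poly_Mapping.single u 1"
      by (intro poly_mapping_eqI) (auto simp: lookup_add lookup_minus lookup_single when_def in_keys_iff)
    then have "Poly_Mapping.single e c = Poly_Mapping.single (e - Poly_Mapping.single u 1) c * var u"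
      by (simp add: var_def monomial_def mult_single)
    moreover have "var u \<in> idl.span (var ` (- F) :: ('n, 'k) mpoly set)"
      using u by (intro idl.span_base) auto
    ultimately show ?thesis by (metis idl.span_scale)
  qed
  then have "(\<Sum>e\<in>Poly_Mapping.keys p. Poly_Mapping.single e (Poly_Mapping.lookup p e)) \<in> idl.span (var ` (- F))"
    by (intro idl.span_sum)
  then show "p \<in> idl.span (var ` (- F))" by (simp flip: poly_mapping_sum_single)
qed

text \<open>
  Setting another variable of the colour of \<open>u\<close> to \<open>-u\<close> kills the colour sums and keeps \<open>u\<close>. Such a
  variable exists on \<open>F\<close>, where \<open>u\<close> is not.
\<close>

lemma var_not_in_colour_ideal:
  fixes F :: "'n::finite set"
  assumes d: "disjoint DD" and F: "\<And>D. D \<in> DD \<Longrightarrow> D \<inter> F \<noteq> {}" and u: "u \<notin> F"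
  shows "(var u :: ('n, 'k::field) mpoly) \<notin> colour_ideal UNIV DD"
proof (cases "\<exists>D\<in>DD. u \<in> D")
  case True
  then obtain D w where D: "D \<in> DD" "u \<in> D" "w \<in> D" "w \<in> F" using F by blast
  with u have "w \<noteq> u" by auto
  let ?\<tau> = "\<lambda>v. if v = u then var u else if v = w then - var u else 0 :: ('n, 'k) mpoly"
  show ?thesis
  proof (rule not_in_colour_ideal[where \<tau> = ?\<tau>])
    fix D' assume D': "D' \<in> DD"
    show "(\<Sum>u\<in>D'. ?\<tau> u) = 0"
    proof (cases "D' = D")
      case True
      have "(\<Sum>u\<in>D'. ?\<tau> u) = (\<Sum>u\<in>{u,w}. ?\<tau> u)"
        by (rule sum.mono_neutral_right) (use D True in auto)
      then show ?thesis using \<open>w \<noteq> u\<close> by simp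
    next
      case False
      then have "u \<notin> D'" "w \<notin> D'" using D D' d by (auto simp: disjoint_def)
      then show ?thesis by (intro sum.neutral) auto
    qed
  qed auto
next
  case False
  let ?\<tau> = "\<lambda>v. if v = u then var u else 0 :: ('n, 'k) mpoly"
  show ?thesis
    by (rule not_in_colour_ideal[where \<tau> = ?\<tau>]) (use False in \<open>auto intro!: sum.neutral\<close>)
qed

lemma weakly_regular_colours_var:
  fixes F :: "'n::finite set"
  assumes d: "disjoint (set Ds)" "distinct Ds" and F: "\<And>D. D \<in> set Ds \<Longrightarrow> D \<inter> F \<noteq> {}" and u: "u \<notin> F"
  shows "weakly_regular ({0} :: ('n, 'k::field) mpoly set) (map colour_sum Ds @ [var u])"
proof -
  have "weakly_regular (face_ideal {UNIV} :: ('n, 'k) mpoly set) (map colour_sum Ds)"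
    by (rule weakly_regular_colours[OF d]) (use F in fastforce)
  then show ?thesis
    using colour_ideal_prime[OF d(1), of "var u" _ UNIV] var_not_in_colour_ideal[OF d(1) F u]
    by (auto simp: weakly_regular_snoc face_ideal_UNIV)
qed

text \<open>
  Modulo the colour sums the variable \<open>u\<close> is a prime element. It does not divide the sum of powers, since
  this is nonzero even on the face \<open>F\<close>, where \<open>u\<close> vanishes. A prime element that does not divide \<open>g\<close> is
  regular modulo \<open>g\<close>.
\<close>

lemma weakly_regular_colours_powers_var:
  fixes F :: "'n::finite set"
  assumes N: "inj N" "\<And>v. N v > 0" and d: "disjoint (set Ds)" "distinct Ds"
    and t: "transversal (set Ds) F" and u: "u \<notin> F"
  shows "weakly_regular ({0} :: ('n, 'k::field) mpoly set) ((map colour_sum Ds @ [mixed_powers N]) @ [var u])"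
  unfolding weakly_regular_snoc[of _ "map colour_sum Ds @ [mixed_powers N]"]
proof (intro conjI allI impI)
  have F: "\<And>D. D \<in> set Ds \<Longrightarrow> D \<inter> F \<noteq> {}" using t by (auto simp: transversal_def)
  have "transversal (set Ds) UNIV" using t unfolding transversal_def by blast
  from weakly_regular_colours_powers[OF N d this]
  show "weakly_regular ({0} :: ('n, 'k) mpoly set) (map colour_sum Ds @ [mixed_powers N])" by (simp add: face_ideal_UNIV)
  let ?A = "colour_ideal UNIV (set Ds) :: ('n, 'k) mpoly set"
  let ?B = "colour_ideal (- {u}) (set Ds) :: ('n, 'k) mpoly set"
  have eq: "idl.span ({0} \<union> set (map colour_sum Ds @ [mixed_powers N])) = idl.span (insert (mixed_powers N) ({0} \<union> colour_sum ` set Ds))"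
    by (simp add: insert_commute)
  fix x :: "('n, 'k) mpoly"
  assume "var u * x \<in> idl.span ({0} \<union> set (map colour_sum Ds @ [mixed_powers N]))"
  then obtain z where z: "var u * x - z * mixed_powers N \<in> ?A"
    unfolding eq idl.span_insert[of "mixed_powers N"] by (auto simp: face_ideal_UNIV)
  have AB: "?A \<subseteq> ?B" by (intro idl.span_mono) (auto intro: idl.subspace_0[OF subspace_face_ideal] simp: face_ideal_UNIV)
  have "?B \<subseteq> colour_ideal F (set Ds)"
    using face_ideal_mono[of "{F}" "{- {u}}"] u by (intro idl.span_mono) auto
  then have g: "mixed_powers N \<notin> ?B" using mixed_powers_not_in_colour_ideal[OF N d(1) t] by blast
  have "x * var u \<in> ?B"
    by (rule idl.span_scale, rule idl.span_base) (simp add: var_in_face_ideal_iff)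
  then have "var u * x \<in> ?B" by (simp only: mult.commute)
  from idl.span_diff[OF this subsetD[OF AB z]]
  have "z * mixed_powers N \<in> ?B" by simp
  then have "z \<in> ?B" using colour_ideal_prime[OF d(1)] g by blast
  also have "?B \<subseteq> idl.span (insert (var u) (colour_sum ` set Ds))"
  proof (rule idl.span_minimal)
    have "idl.span {var u} \<subseteq> idl.span (insert (var u) (colour_sum ` set Ds)) " by (rule idl.span_mono) auto
    then show "face_ideal {- {u}} \<union> colour_sum ` set Ds \<subseteq> idl.span (insert (var u :: ('n, 'k) mpoly) (colour_sum ` set Ds))"
      using face_ideal_subset_span_vars[of "- {u}"] by (auto intro: idl.span_base)
  qed simp
  finally obtain z' where z': "z - z' * var u \<in> idl.span (colour_sum ` set Ds)"
    by (auto simp: idl.span_insert)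
  have A: "idl.span (colour_sum ` set Ds) \<subseteq> ?A" by (rule idl.span_mono) auto
  have "(var u * x - z * mixed_powers N) + mixed_powers N * (z - z' * var u) \<in> ?A"
    using z z' A by (intro idl.span_add idl.span_scale) auto
  then have "var u * (x - z' * mixed_powers N) \<in> ?A" by (simp add: algebra_simps)
  then have "x - z' * mixed_powers N \<in> ?A"
    using colour_ideal_prime[OF d(1)] var_not_in_colour_ideal[OF d(1) F u] by blast
  then show "x \<in> idl.span ({0} \<union> set (map colour_sum Ds @ [mixed_powers N]))"
    unfolding eq idl.span_insert[of "mixed_powers N"] by (auto simp: face_ideal_UNIV)
qed

section \<open>Depth of an ideal in terms of regular sequences\<close>

lemma ring_simps [simp]:
  "carrier (ring_of_type_algebra :: 'a::comm_ring_1 ring) = UNIV"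
  "x \<otimes>\<^bsub>ring_of_type_algebra\<^esub> y = x * (y :: 'a::comm_ring_1)"
  "x \<oplus>\<^bsub>ring_of_type_algebra\<^esub> y = x + (y :: 'a::comm_ring_1)"
  "\<one>\<^bsub>ring_of_type_algebra\<^esub> = (1 :: 'a::comm_ring_1)"
  "\<zero>\<^bsub>ring_of_type_algebra\<^esub> = (0 :: 'a::comm_ring_1)"
  by (simp_all add: ring_of_type_algebra_def)

lemma ideal_module_simps [simp]:
  "carrier (ideal_module R I) = I"
  "a \<odot>\<^bsub>ideal_module R I\<^esub> x = a \<otimes>\<^bsub>R\<^esub> x"
  "a \<oplus>\<^bsub>ideal_module R I\<^esub> x = a \<oplus>\<^bsub>R\<^esub> x"
  "\<zero>\<^bsub>ideal_module R I\<^esub> = \<zero>\<^bsub>R\<^esub>"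
  by (simp_all add: ideal_module_def)

lemma ideal_iff_subspace:
  "ideal I (ring_of_type_algebra :: 'a::comm_ring_1 ring) \<longleftrightarrow> idl.subspace I"
proof
  assume "ideal I (ring_of_type_algebra :: 'a ring)"
  then interpret J: ideal I "ring_of_type_algebra :: 'a ring" .
  show "idl.subspace I"
    using additive_subgroup.zero_closed[OF J.is_additive_subgroup]
      additive_subgroup.a_closed[OF J.is_additive_subgroup] J.I_l_closed
    by (intro idl.subspaceI) auto
next
  assume I: "idl.subspace I"
  interpret R: cring "ring_of_type_algebra :: 'a ring" by (rule cring_from_type_algebra)
  have "inv\<^bsub>add_monoid (ring_of_type_algebra :: 'a ring)\<^esub> x = - x" for x :: 'a
    using R.minus_equality[of "- x" x] by (simp add: a_inv_def)
  then show "ideal I (ring_of_type_algebra :: 'a ring)"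
    using idl.subspace_0[OF I] idl.subspace_add[OF I] idl.subspace_neg[OF I] idl.subspace_scale[OF I]
    by (intro idealI subgroup.intro R.ring_axioms) (auto simp: mult.commute)
qed

lemma smult_submodule_ideal_module:
  fixes I :: "'a::comm_ring_1 set"
  assumes I: "idl.subspace I"
  shows "smult_submodule ring_of_type_algebra A (ideal_module ring_of_type_algebra I) = ideal_prod A I"
proof -
  let ?R = "ring_of_type_algebra :: 'a ring" and ?M = "ideal_module (ring_of_type_algebra :: 'a ring) I"
  interpret R: cring ?R by (rule cring_from_type_algebra)
  interpret M: module ?R ?M
    using I by (intro R.module_ideal_module) (simp add: ideal_iff_subspace)
  have sub: "idl.subspace N" if "submodule N ?R ?M" for N
    using M.submoduleE[OF that] subgroup.one_closed[OF submodule.axioms(1)[OF that]]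
    by (intro idl.subspaceI) auto
  have inv: "\<ominus>\<^bsub>?M\<^esub> x = - x" if "x \<in> I" for x
    using M.M.minus_equality[of "- x" x] that idl.subspace_neg[OF I that] by simp
  have N: "idl.subspace (ideal_prod A I)" by simp
  have "submodule (ideal_prod A I) ?R ?M"
    using ideal_prod_subset_right[OF I, of A] inv idl.subspace_0[OF N] idl.subspace_add[OF N]
      idl.subspace_neg[OF N] idl.subspace_scale[OF N]
    by (intro M.submoduleI) (auto simp: subset_iff)
  then have "smult_submodule ?R A ?M \<subseteq> ideal_prod A I"
    unfolding smult_submodule_def by (auto intro: ideal_prod_base)
  moreover have "ideal_prod A I \<subseteq> smult_submodule ?R A ?M"
    unfolding smult_submodule_def
    by (intro Inter_greatest ideal_prod_minimal) (auto dest: sub)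
  ultimately show ?thesis by blast
qed

lemma genideal_eq_span: "Idl\<^bsub>ring_of_type_algebra\<^esub> A = idl.span (A :: 'a::comm_ring_1 set)"
proof
  show "Idl\<^bsub>ring_of_type_algebra\<^esub> A \<subseteq> idl.span A"
    unfolding genideal_def ideal_iff_subspace using idl.span_superset by blast
  show "idl.span A \<subseteq> Idl\<^bsub>ring_of_type_algebra\<^esub> A"
    unfolding genideal_def ideal_iff_subspace by (intro Inter_greatest idl.span_minimal) auto
qed

lemma regular_sequence_iff_regular_on:
  assumes "idl.subspace (I :: 'a::comm_ring_1 set)"
  shows "regular_sequence ring_of_type_algebra (ideal_module ring_of_type_algebra I) rs \<longleftrightarrow>
    regular_on I rs \<and> ideal_prod (set rs) I \<noteq> I"
  using assms by (simp add: regular_sequence_def smult_submodule_ideal_module regular_on_def)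

lemma lookup_var_mult:
  "Poly_Mapping.lookup (var v * p :: ('n, 'k::field) mpoly) e =
     (if v \<in> Poly_Mapping.keys e then Poly_Mapping.lookup p (e - Poly_Mapping.single v 1) else 0)"
proof -
  let ?x = "Poly_Mapping.single v (1::nat)"
  have "var v * p = var v * (\<Sum>a\<in>Poly_Mapping.keys p. Poly_Mapping.single a (Poly_Mapping.lookup p a))"
    by (simp flip: poly_mapping_sum_single)
  also have "\<dots> = (\<Sum>a\<in>Poly_Mapping.keys p. Poly_Mapping.single (?x + a) (Poly_Mapping.lookup p a))"
    by (simp add: sum_distrib_left var_def monomial_def mult_single)
  also have "Poly_Mapping.lookup \<dots> e = (\<Sum>a\<in>Poly_Mapping.keys p. Poly_Mapping.lookup p a when ?x + a = e)"
    by (simp add: lookup_sum lookup_single)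
  also have "\<dots> = (if v \<in> Poly_Mapping.keys e then Poly_Mapping.lookup p (e - ?x) else 0)"
  proof (cases "v \<in> Poly_Mapping.keys e")
    case True
    then have "e = ?x + (e - ?x)"
      by (intro poly_mapping_eqI) (auto simp: lookup_add lookup_minus lookup_single when_def in_keys_iff)
    then have "?x + a = e \<longleftrightarrow> a = e - ?x" for a by (metis add_left_cancel)
    then show ?thesis using True by (simp add: when_def in_keys_iff)
  next
    case False
    then have "?x + a \<noteq> e" for a by (auto simp: keys_exponent_add)
    then show ?thesis using False by simp
  qed
  finally show ?thesis .
qed

text \<open>
  Used with \<open>e\<close> of minimal degree among the exponents of \<open>I\<close>: products with variables have no monomial
  \<open>e\<close>.
\<close>

lemma lookup_ideal_prod_eq_0:
  fixes I :: "('n, 'k::field) mpoly set"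
  assumes "\<And>p v. p \<in> I \<Longrightarrow> v \<in> Poly_Mapping.keys e \<Longrightarrow> Poly_Mapping.lookup p (e - Poly_Mapping.single v 1) = 0"
    and "idl.subspace I" "q \<in> ideal_prod (idl.span (range var)) I"
  shows "Poly_Mapping.lookup q e = 0"
proof -
  have *: "Poly_Mapping.lookup (a * x) e = 0" if "a \<in> idl.span (range var)" "x \<in> I" for a x
    using that(1)
  proof (induction rule: idl.span_induct_alt)
    case base
    then show ?case by simp
  next
    case (step c y z)
    then obtain v where "y = var v" by auto
    moreover have "c * x \<in> I" using that(2) assms(2) by (rule idl.subspace_scale[rotated])
    ultimately have "Poly_Mapping.lookup (y * (c * x)) e = 0"
      using assms(1) by (simp add: lookup_var_mult)
    moreover have "(c * y + z) * x = y * (c * x) + z * x" by (simp add: algebra_simps)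
    ultimately show ?case using step.IH by (simp add: lookup_add)
  qed
  have "q \<in> idl.span {a * x | a x. a \<in> idl.span (range var) \<and> x \<in> I}" using assms(3) by (simp add: ideal_prod_def)
  then show ?thesis
  proof (induction rule: idl.span_induct_alt)
    case base
    then show ?case by simp
  next
    case (step c y z)
    then obtain a x where "y = a * x" "a \<in> idl.span (range var)" "x \<in> I" by auto
    moreover have "c * x \<in> I" using \<open>x \<in> I\<close> assms(2) by (rule idl.subspace_scale[rotated])
    ultimately have "Poly_Mapping.lookup (c * y) e = 0" using *[of a "c * x"] by (simp add: mult.left_commute)
    then show ?case using step.IH by (simp add: lookup_add)
  qed
qed

text \<open>
  A monomial of minimal degree among those that occur in elements of \<open>I\<close> cannot occur in a sum of
  products of elements of \<open>I\<close> with variables. This makes the nontriviality condition for regular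
  sequences automatic.
\<close>

lemma nakayama:
  fixes I :: "('n, 'k::field) mpoly set"
  assumes I: "idl.subspace I" and "I \<noteq> {0}" and A: "A \<subseteq> idl.span (range var)"
  shows "ideal_prod A I \<noteq> I"
proof
  assume eq: "ideal_prod A I = I"
  define deg where "deg e = (\<Sum>v\<in>Poly_Mapping.keys e. Poly_Mapping.lookup e v)" for e :: "'n \<Rightarrow>\<^sub>0 nat"
  let ?E = "\<Union>p\<in>I. Poly_Mapping.keys p"
  from assms(2) idl.subspace_0[OF I] obtain p where "p \<in> I" "p \<noteq> 0" by auto
  then have "?E \<noteq> {}" by (auto simp flip: keys_eq_empty)
  then obtain e where e: "e \<in> ?E" "\<And>e'. e' \<in> ?E \<Longrightarrow> deg e \<le> deg e'"
    using ex_has_least_nat[of "\<lambda>e. e \<in> ?E" _ deg] by (metis (no_types, lifting) ex_in_conv)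
  have "Poly_Mapping.lookup p (e - Poly_Mapping.single v 1) = 0"
    if "p \<in> I" and v: "v \<in> Poly_Mapping.keys e" for p v
  proof (rule ccontr)
    let ?e = "e - Poly_Mapping.single v 1"
    assume "Poly_Mapping.lookup p ?e \<noteq> 0"
    then have "?e \<in> ?E" using that by (auto simp: in_keys_iff)
    then have "deg e \<le> deg ?e" by (rule e(2))
    moreover have "deg ?e = (\<Sum>u\<in>Poly_Mapping.keys e. Poly_Mapping.lookup ?e u)"
      unfolding deg_def by (rule sum.mono_neutral_left) (auto simp: in_keys_iff lookup_minus)
    moreover have "\<dots> < deg e"
      unfolding deg_def by (rule sum_strict_mono_ex1)
        (use v in \<open>auto simp: lookup_minus lookup_single in_keys_iff intro!: bexI[of _ v]\<close>)
    ultimately show False by simp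
  qed
  then have "Poly_Mapping.lookup q e = 0" if "q \<in> ideal_prod (idl.span (range var)) I" for q
    using lookup_ideal_prod_eq_0[OF _ I that] by blast
  moreover have "I \<subseteq> ideal_prod (idl.span (range var)) I" using ideal_prod_mono[OF A subset_refl, of I] eq by simp
  moreover obtain q where "q \<in> I" "e \<in> Poly_Mapping.keys q" using e(1) by auto
  ultimately show False by (auto simp: in_keys_iff)
qed

lemma ideal_depth_eqI:
  fixes I :: "('n::finite, 'k::field) mpoly set"
  assumes I: "idl.subspace I" "I \<noteq> {0}"
    and rs: "regular_on I rs" "set rs \<subseteq> idl.span (range var)"
    and max: "\<And>ss. regular_on I ss \<Longrightarrow> set ss \<subseteq> idl.span (range var) \<Longrightarrow> length ss \<le> length rs"
  shows "ideal_depth I = enat (length rs)"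
proof -
  have ne: "ideal_prod A I \<noteq> I" if "A \<subseteq> idl.span (range var)" for A
    using nakayama[OF I that] .
  have "ideal_depth I = Sup {enat (length ss) | ss. set ss \<subseteq> idl.span (range var) \<and> regular_on I ss}"
    unfolding ideal_depth_def depth_def variables_ideal_def genideal_eq_span
      smult_submodule_ideal_module[OF I(1)] regular_sequence_iff_regular_on[OF I(1)]
    using ne by (auto intro!: arg_cong[where f=Sup])
  also have "\<dots> = enat (length rs)"
    using rs max by (intro antisym Sup_least Sup_upper) auto
  finally show ?thesis .
qed

text \<open>The zero module equals its product with every ideal.\<close>

lemma ideal_depth_zero: "ideal_depth ({0} :: ('n, 'k::field) mpoly set) = \<infinity>"
proof -
  have "ideal_prod A {0} = {0}" for A :: "('n, 'k::field) mpoly set"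
    using ideal_prod_subset_right[of "{0}" A] idl.subspace_0[of "ideal_prod A {0}"] by auto
  then show ?thesis by (simp add: ideal_depth_def depth_def smult_submodule_ideal_module)
qed

section \<open>Multigraded slices of the Koszul complex\<close>

definition indicator_exponent :: "'n::finite set \<Rightarrow> 'n \<Rightarrow>\<^sub>0 nat" where
  "indicator_exponent A = (\<Sum>v\<in>A. Poly_Mapping.single v 1)"

lemma lookup_indicator_exponent:
  "Poly_Mapping.lookup (indicator_exponent A) v = (if v \<in> A then 1 else 0)"
  by (simp add: indicator_exponent_def lookup_sum lookup_single when_def)

lemma keys_indicator_exponent [simp]: "Poly_Mapping.keys (indicator_exponent A) = A"
  by (auto simp: in_keys_iff lookup_indicator_exponent split: if_splits)

lemma face_ideal_nonzero:
  assumes "UNIV \<notin> FF"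
  shows "face_ideal FF \<noteq> ({0} :: ('n::finite, 'k::field) mpoly set)"
proof -
  have "monomial (indicator_exponent UNIV) \<in> (face_ideal FF :: ('n, 'k) mpoly set)"
    using assms by (auto simp: face_ideal_def supported_def monomial_def top.extremum_unique)
  moreover have "monomial (indicator_exponent UNIV) \<noteq> (0 :: ('n, 'k) mpoly)"
    by (simp add: monomial_def flip: keys_eq_empty)
  ultimately show ?thesis by blast
qed

lemma indicator_exponent_minus:
  "v \<in> A \<Longrightarrow> indicator_exponent A - Poly_Mapping.single v 1 = indicator_exponent (A - {v})"
  by (rule poly_mapping_eqI) (auto simp: lookup_indicator_exponent lookup_minus lookup_single when_def)

lemma single_var_mult: "v \<in> A \<Longrightarrow>
  var v * Poly_Mapping.single (indicator_exponent (A - {v})) c = Poly_Mapping.single (indicator_exponent A) (c :: 'k::field)"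
  by (simp add: var_def monomial_def mult_single indicator_exponent_def sum.remove[of A v])

lemma lookup_koszul_sign_mult:
  "Poly_Mapping.lookup (koszul_sign f v A * p :: ('n, 'k::field) mpoly) e = koszul_sign f v A * Poly_Mapping.lookup p e"
  unfolding koszul_sign_def by (cases "even (card {u \<in> A. f u < f v})") auto

lemma koszul_sign_mult_single:
  "(koszul_sign f v A :: ('n, 'k::field) mpoly) * Poly_Mapping.single e c = Poly_Mapping.single e (koszul_sign f v A * c)"
  unfolding koszul_sign_def by (cases "even (card {u \<in> A. f u < f v})") (auto simp: single_uminus)

text \<open>
  If \<open>W\<close> comes last in the order, the Koszul signs do not see it, and slices have the usual simplicial
  signs.
\<close>

lemma koszul_sign_Un_last:
  assumes "\<And>w. w \<in> W \<Longrightarrow> f v < f w"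
  shows "koszul_sign f v (W \<union> A) = koszul_sign f v A"
  unfolding koszul_sign_def using assms by (intro arg_cong[where f="\<lambda>S. (-1) ^ card S"]) (auto dest: less_asym')

text \<open>
  The simplicial coboundary, with sets of vertices as simplices. It is a Koszul differential as well,
  so its square vanishes and it has contractions.
\<close>

abbreviation coboundary :: "('n \<Rightarrow> nat) \<Rightarrow> ('n set \<Rightarrow> 'k) \<Rightarrow> 'n set \<Rightarrow> 'k::field" where
  "coboundary f \<equiv> koszul_d f (\<lambda>_. 1)"

text \<open>
  Taking the coefficient of the squarefree monomial of \<open>B\<close> in the value at \<open>W \<union> B\<close>, for \<open>B\<close> disjoint from
  \<open>W\<close>, is a homomorphism from the Koszul complex to simplicial cochains. This is the part of degree
  \<open>-1\<close> on \<open>W\<close> and \<open>0\<close> elsewhere.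
\<close>

lemma lookup_koszul_d_slice:
  fixes \<psi> :: "'n::finite set \<Rightarrow> ('n, 'k::field) mpoly"
  assumes last: "\<And>v w. v \<notin> W \<Longrightarrow> w \<in> W \<Longrightarrow> f v < f w" and A: "A \<inter> W = {}"
  shows "Poly_Mapping.lookup (koszul_d f var \<psi> (W \<union> A)) (indicator_exponent A) =
    coboundary f (\<lambda>B. Poly_Mapping.lookup (\<psi> (W \<union> B)) (indicator_exponent B)) A"
proof -
  have "Poly_Mapping.lookup (koszul_d f var \<psi> (W \<union> A)) (indicator_exponent A) =
    (\<Sum>v\<in>W \<union> A. koszul_sign f v (W \<union> A) * (if v \<in> A then Poly_Mapping.lookup (\<psi> (W \<union> A - {v})) (indicator_exponent (A - {v})) else 0))"
    unfolding koszul_d_def lookup_sum mult.assoc lookup_koszul_sign_mult lookup_var_mult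
    by (rule sum.cong) (auto simp: indicator_exponent_minus[unfolded One_nat_def])
  also have "\<dots> = (\<Sum>v\<in>A. koszul_sign f v (W \<union> A) * (if v \<in> A then Poly_Mapping.lookup (\<psi> (W \<union> A - {v})) (indicator_exponent (A - {v})) else 0))"
    by (rule sum.mono_neutral_right) auto
  also have "\<dots> = coboundary f (\<lambda>B. Poly_Mapping.lookup (\<psi> (W \<union> B)) (indicator_exponent B)) A"
    unfolding koszul_d_def
  proof (rule sum.cong)
    fix v assume v: "v \<in> A"
    then have "W \<union> A - {v} = W \<union> (A - {v})" and "v \<notin> W" using A by auto
    then show "koszul_sign f v (W \<union> A) * (if v \<in> A then Poly_Mapping.lookup (\<psi> (W \<union> A - {v})) (indicator_exponent (A - {v})) else 0)
      = koszul_sign f v A * 1 * Poly_Mapping.lookup (\<psi> (W \<union> (A - {v}))) (indicator_exponent (A - {v}))"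
      using v last koszul_sign_Un_last[of W f v A, where ?'b='k] by simp
  qed simp
  finally show ?thesis .
qed

text \<open>Conversely a simplicial cochain is placed into this degree of the Koszul complex.\<close>

lemma koszul_d_of_slice:
  fixes c :: "'n::finite set \<Rightarrow> 'k::field"
  assumes last: "\<And>v w. v \<notin> W \<Longrightarrow> w \<in> W \<Longrightarrow> f v < f w"
  defines "\<psi> \<equiv> \<lambda>A. if W \<subseteq> A then Poly_Mapping.single (indicator_exponent (A - W)) (c (A - W)) else 0"
  shows "koszul_d f var \<psi> A = (if W \<subseteq> A then Poly_Mapping.single (indicator_exponent (A - W)) (coboundary f c (A - W)) else 0)"
proof (cases "W \<subseteq> A")
  case True
  have "koszul_d f var \<psi> A = (\<Sum>v\<in>A - W. koszul_sign f v A * var v * \<psi> (A - {v}))"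
    unfolding koszul_d_def by (rule sum.mono_neutral_right) (auto simp: \<psi>_def)
  also have "\<dots> = (\<Sum>v\<in>A - W. Poly_Mapping.single (indicator_exponent (A - W)) (koszul_sign f v (A - W) * c (A - W - {v})))"
  proof (rule sum.cong)
    fix v assume v: "v \<in> A - W"
    then have W: "W \<subseteq> A - {v}" and e: "A - {v} - W = A - W - {v}" using True by auto
    have s: "koszul_sign f v A = (koszul_sign f v (A - W) :: 'k)"
      using koszul_sign_Un_last[of W f v "A - W"] last v True by (simp add: Un_absorb1)
    have "koszul_sign f v A * var v * \<psi> (A - {v}) = koszul_sign f v A * (var v * Poly_Mapping.single (indicator_exponent (A - W - {v})) (c (A - W - {v})))"
      using W by (simp add: \<psi>_def e mult.assoc)
    also have "\<dots> = Poly_Mapping.single (indicator_exponent (A - W)) (koszul_sign f v (A - W) * c (A - W - {v}))"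
      using v by (simp add: single_var_mult koszul_sign_mult_single s)
    finally show "koszul_sign f v A * var v * \<psi> (A - {v}) = Poly_Mapping.single (indicator_exponent (A - W)) (koszul_sign f v (A - W) * c (A - W - {v}))" .
  qed simp
  also have "\<dots> = Poly_Mapping.single (indicator_exponent (A - W)) (coboundary f c (A - W))"
    unfolding koszul_d_def by (rule poly_mapping_eqI) (simp add: lookup_sum lookup_single when_def)
  finally show ?thesis using True by simp
next
  case False
  then show ?thesis unfolding koszul_d_def by (auto simp: \<psi>_def intro!: sum.neutral)
qed

lemma ordering_with_last:
  fixes W :: "'n::finite set"
  obtains f :: "'n \<Rightarrow> nat" where "inj f" "\<And>v w. v \<notin> W \<Longrightarrow> w \<in> W \<Longrightarrow> f v < f w"
proof -
  obtain f0 :: "'n \<Rightarrow> nat" and n where f0: "f0 ` UNIV = {i. i < n}" "inj f0"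
    using finite_imp_inj_to_nat_seg[of "UNIV :: 'n set"] by auto
  have b: "f0 v < n" for v using f0(1) by auto
  show ?thesis
  proof (rule that[of "\<lambda>v. f0 v + (if v \<in> W then n else 0)"])
    show "inj (\<lambda>v. f0 v + (if v \<in> W then n else 0))"
    proof (rule injI)
      fix x y assume "f0 x + (if x \<in> W then n else 0) = f0 y + (if y \<in> W then n else 0)"
      then have "f0 x = f0 y" using b[of x] b[of y] by (auto split: if_splits)
      then show "x = y" using f0(2) by (auto dest: injD)
    qed
  qed (use b in \<open>auto simp: trans_less_add2\<close>)
qed

abbreviation face :: "'n set set \<Rightarrow> 'n set \<Rightarrow> bool" where
  "face FF A \<equiv> \<exists>F\<in>FF. A \<subseteq> F"

text \<open>
  A simplicial cocycle \<open>c\<close> on the faces outside \<open>W\<close>, extended arbitrarily to nonfaces, yields a Koszul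
  cochain whose coboundary is supported on nonfaces, that is, has values in the ideal. If the sequence
  is long, this coboundary is also one of a cochain \<open>\<psi>'\<close> with values in the ideal. The difference is a
  cocycle on the full simplex outside \<open>W\<close>, which is a cone with apex \<open>u\<close>, hence a coboundary; and it
  agrees with \<open>c\<close> on faces, where the slice of \<open>\<psi>'\<close> vanishes. So a class of degree \<open>m - 1\<close> that is
  nontrivial on the faces forces every regular sequence to have length at most \<open>|W| + m + 1\<close>.
\<close>

theorem koszul_obstruction:
  fixes FF :: "'n::finite set set" and c :: "'n set \<Rightarrow> 'k::field"
  assumes f: "inj f" and last: "\<And>v w. v \<notin> W \<Longrightarrow> w \<in> W \<Longrightarrow> f v < f w"
    and u: "u \<notin> W"
    and reg: "regular_on (face_ideal FF :: ('n, 'k) mpoly set) rs" and rs: "set rs \<subseteq> idl.span (range var)"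
    and len: "card W + m + 1 < length rs"
    and cocycle: "\<And>A. A \<inter> W = {} \<Longrightarrow> card A = Suc m \<Longrightarrow> face FF A \<Longrightarrow> coboundary f c A = 0"
  obtains \<eta> where "\<And>A. A \<inter> W = {} \<Longrightarrow> card A = m \<Longrightarrow> face FF A \<Longrightarrow> c A = coboundary f \<eta> A"
proof -
  define \<psi> where "\<psi> = (\<lambda>A. if W \<subseteq> A then Poly_Mapping.single (indicator_exponent (A - W)) (c (A - W)) else 0)"
  let ?i = "card W + m + 1"
  have d\<psi>: "koszul_d f var \<psi> A = (if W \<subseteq> A then Poly_Mapping.single (indicator_exponent (A - W)) (coboundary f c (A - W)) else 0)" for A
    unfolding \<psi>_def by (rule koszul_d_of_slice[OF last])
  have in_sr: "koszul_d f var \<psi> A \<in> face_ideal FF" if A: "card A = ?i" for A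
  proof (cases "W \<subseteq> A \<and> coboundary f c (A - W) \<noteq> 0")
    case True
    then have "card (A - W) = Suc m" using A by (simp add: card_Diff_subset)
    then have "\<not> face FF (A - W)" using cocycle[of "A - W"] True by auto
    then show ?thesis using True unfolding d\<psi> by (auto simp: face_ideal_def supported_def)
  next
    case False
    then show ?thesis unfolding d\<psi> using idl.subspace_0[OF subspace_face_ideal, of FF] by (auto simp del: idl.subspace_0)
  qed
  obtain \<psi>' where \<psi>': "\<And>A. Suc (card A) = ?i \<Longrightarrow> \<psi>' A \<in> face_ideal FF"
    "\<And>A. card A = ?i \<Longrightarrow> koszul_d f var \<psi> A = koszul_d f var \<psi>' A"
    by (rule koszul_exact[OF f subspace_face_ideal reg rs len, of "koszul_d f var \<psi>"])
      (use in_sr koszul_d_d[OF f] in auto)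
  \<comment> \<open>the difference of \<open>c\<close> and the slice of \<open>\<psi>'\<close>, a cocycle on all sets outside \<open>W\<close>\<close>
  define b where "b A = (if A \<inter> W = {} then c A - Poly_Mapping.lookup (\<psi>' (W \<union> A)) (indicator_exponent A) else 0)" for A
  have closed: "coboundary f b A = 0" if A: "A \<inter> W = {}" "card A = Suc m" for A
  proof -
    have "card (W \<union> A) = ?i" using A by (subst card_Un_disjoint) auto
    then have eq: "koszul_d f var \<psi> (W \<union> A) = koszul_d f var \<psi>' (W \<union> A)" by (rule \<psi>'(2))
    have "W \<union> A - W = A" using A by auto
    then have "Poly_Mapping.lookup (koszul_d f var \<psi> (W \<union> A)) (indicator_exponent A) = coboundary f c A"
      unfolding d\<psi> by simp
    moreover have "Poly_Mapping.lookup (koszul_d f var \<psi>' (W \<union> A)) (indicator_exponent A) =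
        coboundary f (\<lambda>B. Poly_Mapping.lookup (\<psi>' (W \<union> B)) (indicator_exponent B)) A"
      by (rule lookup_koszul_d_slice[OF last A(1)])
    moreover have "coboundary f b A = coboundary f c A - coboundary f (\<lambda>B. Poly_Mapping.lookup (\<psi>' (W \<union> B)) (indicator_exponent B)) A"
    proof -
      have "(A - {v}) \<inter> W = {}" for v using A by auto
      then show ?thesis unfolding koszul_d_def by (simp add: b_def right_diff_distrib sum_subtractf)
    qed
    ultimately show ?thesis using eq by simp
  qed
  \<comment> \<open>contraction towards the apex \<open>u\<close>\<close>
  define a where "a v = (if v = u then 1 else 0 :: 'k)" for v
  define \<eta> where "\<eta> = koszul_h f a b"
  have "c A = coboundary f \<eta> A" if A: "A \<inter> W = {}" "card A = m" "face FF A" for A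
  proof -
    have "b A = coboundary f \<eta> A + koszul_h f a (coboundary f b) A"
      using koszul_homotopy[OF f, of a "\<lambda>_. 1" b A] by (simp add: a_def \<eta>_def)
    also have "koszul_h f a (coboundary f b) A = 0"
      unfolding koszul_h_def
    proof (rule sum.neutral, rule ballI)
      fix v assume v: "v \<in> - A"
      show "koszul_sign f v A * a v * coboundary f b (insert v A) = 0"
      proof (cases "v = u")
        case True
        then have "coboundary f b (insert v A) = 0" using A v u by (intro closed) auto
        then show ?thesis by simp
      qed (simp add: a_def)
    qed
    finally have "b A = coboundary f \<eta> A" by simp
    moreover have "Poly_Mapping.lookup (\<psi>' (W \<union> A)) (indicator_exponent A) = 0"
    proof (rule ccontr)
      assume "Poly_Mapping.lookup (\<psi>' (W \<union> A)) (indicator_exponent A) \<noteq> 0"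
      then have "indicator_exponent A \<in> Poly_Mapping.keys (\<psi>' (W \<union> A))" by (simp add: in_keys_iff)
      moreover have "card (W \<union> A) = card W + m" using A by (subst card_Un_disjoint) auto
      then have "\<psi>' (W \<union> A) \<in> face_ideal FF" by (intro \<psi>'(1)) simp
      ultimately have "\<not> face FF A" by (auto simp: face_ideal_def supported_def)
      then show False using A by simp
    qed
    ultimately show ?thesis using A by (simp add: b_def)
  qed
  then show ?thesis by (rule that)
qed

section \<open>Upper bounds for the length of regular sequences\<close>

lemma coboundary_pair:
  assumes "f u < f v"
  shows "coboundary f \<eta> {u, v} = (\<eta> {v} - \<eta> {u} :: 'k::field)"
proof -
  have "{w \<in> {u, v}. f w < f u} = {}" "{w \<in> {u, v}. f w < f v} = {u}" "u \<noteq> v" using assms by auto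
  then have "koszul_sign f u {u, v} = (1 :: 'k)" "koszul_sign f v {u, v} = (- 1 :: 'k)"
    unfolding koszul_sign_def by (simp_all only:) simp_all
  moreover have "{u, v} - {u} = {v}" "{u, v} - {v} = {u}" using \<open>u \<noteq> v\<close> by auto
  ultimately show ?thesis using \<open>u \<noteq> v\<close> by (simp add: koszul_d_def)
qed

lemma coboundary_singleton: "coboundary f \<eta> {u} = (\<eta> {} :: 'k::field)"
proof -
  have "{w \<in> {u}. f w < f u} = {}" by auto
  then have "koszul_sign f u {u} = (1 :: 'k)" unfolding koszul_sign_def by (simp only:) simp
  then show ?thesis by (simp add: koszul_d_def)
qed

lemma coboundary_pair_eq_0_iff:
  assumes "inj f" "u \<noteq> v"
  shows "coboundary f \<eta> {u, v} = 0 \<longleftrightarrow> \<eta> {u} = (\<eta> {v} :: 'k::field)"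
proof (cases "f u < f v")
  case True
  then show ?thesis by (auto simp: coboundary_pair)
next
  case False
  with assms have "f v < f u" by (metis injD linorder_neqE_nat)
  then show ?thesis using coboundary_pair[of f v u \<eta>] by (auto simp: insert_commute)
qed

text \<open>
  Evaluation in the top degree of the Koszul complex: the coboundaries lie in the ideal of the
  variables, so \<open>1\<close> is not one of them.
\<close>

lemma length_le_full:
  fixes rs :: "('n::finite, 'k::field) mpoly list"
  assumes "regular_on (face_ideal {}) rs" "set rs \<subseteq> idl.span (range var)"
  shows "length rs \<le> card (UNIV :: 'n set)"
proof (rule ccontr)
  assume "\<not> ?thesis"
  then have len: "card (UNIV :: 'n set) < length rs" by simp
  obtain f :: "'n \<Rightarrow> nat" where f: "inj f" using finite_imp_inj_to_nat_seg[of "UNIV :: 'n set"] by auto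
  have all: "x \<in> face_ideal {}" for x :: "('n, 'k) mpoly" by (simp add: face_ideal_def supported_def)
  have card: "card A \<noteq> Suc (card (UNIV :: 'n set))" for A :: "'n set"
    using card_mono[of UNIV A] by simp
  obtain \<psi> where "\<And>A :: 'n set. card A = card (UNIV :: 'n set) \<Longrightarrow> (1 :: ('n, 'k) mpoly) = koszul_d f var \<psi> A"
    by (rule koszul_exact[OF f subspace_face_ideal assms len, of "\<lambda>_. 1"]) (use all card in auto)
  then have "(1 :: ('n, 'k) mpoly) = koszul_d f var \<psi> (UNIV :: 'n set)" by simp
  moreover have "Poly_Mapping.lookup (koszul_d f var \<psi> (UNIV :: 'n set)) 0 = 0"
    unfolding koszul_d_def lookup_sum mult.assoc lookup_koszul_sign_mult lookup_var_mult by simp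
  ultimately show False by (metis lookup_one_zero zero_neq_one)
qed

text \<open>
  The obstruction with \<open>W = F\<close>, where the faces outside \<open>W\<close> reduce to the empty face and the class is its
  augmentation.
\<close>

lemma length_le_simplex:
  fixes rs :: "('n::finite, 'k::field) mpoly list"
  assumes "F \<noteq> UNIV" and reg: "regular_on (face_ideal {F}) rs" "set rs \<subseteq> idl.span (range var)"
  shows "length rs \<le> card F + 1"
proof (rule ccontr)
  assume "\<not> ?thesis"
  then have len: "card F + 0 + 1 < length rs" by simp
  obtain u where u: "u \<notin> F" using assms(1) by auto
  obtain f :: "'n \<Rightarrow> nat" where f: "inj f" "\<And>v w. v \<notin> F \<Longrightarrow> w \<in> F \<Longrightarrow> f v < f w"
    using ordering_with_last[of F] by blast
  obtain \<eta> where \<eta>: "\<And>A. A \<inter> F = {} \<Longrightarrow> card A = 0 \<Longrightarrow> face {F} A \<Longrightarrow> (1::'k) = coboundary f \<eta> A"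
  proof (rule koszul_obstruction[OF f u reg len, of "\<lambda>_. 1"])
    fix A assume A: "A \<inter> F = {}" "card A = Suc 0" "face {F} A"
    then have "A = {}" by auto
    then show "coboundary f (\<lambda>_. 1 :: 'k) A = 0" using A by simp
  qed blast+
  then show False using \<eta>[of "{}"] by (simp add: koszul_d_def)
qed

text \<open>
  Without the vertices of \<open>W\<close> the complex falls apart into the two groups of facets, and the class is
  the indicator function of one of them.
\<close>

lemma length_le_disconnected:
  fixes rs :: "('n::finite, 'k::field) mpoly list"
  assumes FF: "FF = AA \<union> BB" and cross: "\<And>F G. F \<in> AA \<Longrightarrow> G \<in> BB \<Longrightarrow> F \<inter> G \<subseteq> W"
    and a: "F0 \<in> AA" "a \<in> F0" "a \<notin> W" and b: "G0 \<in> BB" "b \<in> G0" "b \<notin> W"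
    and reg: "regular_on (face_ideal FF) rs" "set rs \<subseteq> idl.span (range var)"
  shows "length rs \<le> card W + 2"
proof (rule ccontr)
  assume "\<not> ?thesis"
  then have len: "card W + 1 + 1 < length rs" by simp
  obtain f :: "'n \<Rightarrow> nat" where f: "inj f" "\<And>v w. v \<notin> W \<Longrightarrow> w \<in> W \<Longrightarrow> f v < f w"
    using ordering_with_last[of W] by blast
  define c :: "'n set \<Rightarrow> 'k" where "c A = (if A \<inter> \<Union>AA = {} then 0 else 1)" for A
  obtain \<eta> where \<eta>: "\<And>A. A \<inter> W = {} \<Longrightarrow> card A = 1 \<Longrightarrow> face FF A \<Longrightarrow> c A = coboundary f \<eta> A"
  proof (rule koszul_obstruction[OF f a(3) reg len, of c])
    fix A assume A: "A \<inter> W = {}" "card A = Suc 1" "face FF A"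
    then have "card A = 2" by simp
    then obtain u v where uv: "A = {u, v}" "u \<noteq> v" unfolding card_2_iff by blast
    obtain F where F: "F \<in> FF" "A \<subseteq> F" using A by auto
    have "c {u} = c {v}"
    proof (cases "F \<in> AA")
      case True
      then show ?thesis using F uv by (auto simp: c_def)
    next
      case False
      then have "F \<in> BB" using F FF by auto
      then have "A \<inter> \<Union>AA = {}" using cross A(1) F(2) by blast
      then show ?thesis using uv by (auto simp: c_def)
    qed
    then show "coboundary f c A = 0" unfolding uv(1) using coboundary_pair_eq_0_iff[OF f(1) uv(2)] by blast
  qed blast+
  have "c {a} = \<eta> {}" using \<eta>[of "{a}"] a FF by (auto simp: coboundary_singleton)
  moreover have "c {b} = \<eta> {}" using \<eta>[of "{b}"] b FF by (auto simp: coboundary_singleton)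
  moreover have "c {a} = 1" using a by (auto simp: c_def)
  moreover have "c {b} = 0" using b cross by (auto simp: c_def)
  ultimately show False by simp
qed

section \<open>The nerve graph of the facets\<close>

text \<open>
  Connectedness is recorded as an order of construction, since this is the form in which facets are
  added in the depth lemma.
\<close>

inductive nerve_connected :: "'n set \<Rightarrow> 'n set set \<Rightarrow> bool" for C where
  conn_single: "nerve_connected C {F}"
| conn_insert: "nerve_connected C AA \<Longrightarrow> F \<notin> AA \<Longrightarrow> B \<in> AA \<Longrightarrow> \<not> F \<inter> B \<subseteq> C \<Longrightarrow> nerve_connected C (insert F AA)"

text \<open>Each new facet is a leaf.\<close>

inductive nerve_tree :: "'n set \<Rightarrow> 'n set set \<Rightarrow> bool" for C where
  tree_single: "nerve_tree C {F}"
| tree_insert: "nerve_tree C AA \<Longrightarrow> F \<notin> AA \<Longrightarrow> B \<in> AA \<Longrightarrow> \<not> F \<inter> B \<subseteq> C \<Longrightarrow>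
    (\<And>B'. B' \<in> AA \<Longrightarrow> B' \<noteq> B \<Longrightarrow> F \<inter> B' \<subseteq> C) \<Longrightarrow> nerve_tree C (insert F AA)"

lemma conn_nonempty: "nerve_connected C AA \<Longrightarrow> AA \<noteq> {}"
  by (induction rule: nerve_connected.induct) auto

lemma conn_neighbour:
  assumes "nerve_connected C AA" "F \<in> AA" "AA \<noteq> {F}"
  shows "\<exists>B\<in>AA. B \<noteq> F \<and> \<not> F \<inter> B \<subseteq> C"
  using assms
proof (induction rule: nerve_connected.induct)
  case (conn_insert AA G B)
  show ?case
  proof (cases "F = G")
    case True
    then show ?thesis using conn_insert.hyps(2-4) by (intro bexI[of _ B]) auto
  next
    case False
    then have F: "F \<in> AA" using conn_insert by auto
    show ?thesis
    proof (cases "AA = {F}")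
      case True
      then show ?thesis using conn_insert False by (auto simp: Int_commute)
    next
      case False
      then show ?thesis using conn_insert.IH F by blast
    qed
  qed
qed auto

text \<open>
  A construction that fails to produce a tree adds at some point a facet \<open>F\<close> with two neighbours \<open>B\<close>, \<open>B'\<close>
  in a connected part: a cycle through \<open>F\<close>.
\<close>

lemma connected_tree_or_cycle:
  assumes "nerve_connected C AA"
  shows "nerve_tree C AA \<or> (\<exists>AA' F B B'. AA' \<subseteq> AA \<and> nerve_connected C AA' \<and> F \<in> AA \<and> F \<notin> AA' \<and> B \<in> AA' \<and> B' \<in> AA' \<and> B \<noteq> B' \<and>
     \<not> F \<inter> B \<subseteq> C \<and> \<not> F \<inter> B' \<subseteq> C)"
  using assms
proof (induction rule: nerve_connected.induct)
  case (conn_single F)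
  then show ?case by (simp add: tree_single)
next
  case (conn_insert AA F B)
  show ?case
  proof (cases "\<exists>B'\<in>AA. B' \<noteq> B \<and> \<not> F \<inter> B' \<subseteq> C")
    case True
    then show ?thesis using conn_insert.hyps by blast
  next
    case False
    from conn_insert.IH show ?thesis
    proof
      assume "nerve_tree C AA"
      then have "nerve_tree C (insert F AA)" using conn_insert.hyps False by (intro tree_insert) auto
      then show ?thesis by simp
    qed blast
  qed
qed

text \<open>Removing an edge disconnects a tree.\<close>

lemma tree_cut:
  assumes "nerve_tree C TT" "A \<in> TT" "B \<in> TT" "A \<noteq> B" "\<not> A \<inter> B \<subseteq> C"
  shows "\<exists>AA BB. TT = AA \<union> BB \<and> AA \<inter> BB = {} \<and> A \<in> AA \<and> B \<in> BB \<and>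
    (\<forall>F\<in>AA. \<forall>G\<in>BB. (F, G) \<noteq> (A, B) \<longrightarrow> F \<inter> G \<subseteq> C)"
  using assms
proof (induction rule: nerve_tree.induct)
  case (tree_single F)
  then show ?case by auto
next
  case (tree_insert TT F B0)
  consider "A = F" | "B = F" | "A \<noteq> F" "B \<noteq> F" by blast
  then show ?case
  proof cases
    case 1
    then have "B \<in> TT" using tree_insert.prems by auto
    then have "B = B0" using tree_insert 1 by blast
    then show ?thesis using tree_insert.hyps 1 \<open>B \<in> TT\<close> by (intro exI[of _ "{F}"] exI[of _ TT]) auto
  next
    case 2
    then have "A \<in> TT" using tree_insert.prems by auto
    then have "A = B0" using tree_insert 2 by (metis Int_commute)
    then show ?thesis using tree_insert.hyps 2 \<open>A \<in> TT\<close>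
      by (intro exI[of _ TT] exI[of _ "{F}"]) (auto simp: Int_commute)
  next
    case 3
    then have AB: "A \<in> TT" "B \<in> TT" using tree_insert.prems by auto
    obtain AA BB where *: "TT = AA \<union> BB" "AA \<inter> BB = {}" "A \<in> AA" "B \<in> BB"
      "\<forall>F\<in>AA. \<forall>G\<in>BB. (F, G) \<noteq> (A, B) \<longrightarrow> F \<inter> G \<subseteq> C"
      using tree_insert.IH[OF AB tree_insert.prems(3,4)] by blast
    have leaf: "F \<inter> G \<subseteq> C" if "G \<in> TT" "G \<noteq> B0" for G using tree_insert.hyps that by blast
    show ?thesis
    proof (cases "B0 \<in> AA")
      case True
      have "\<forall>F'\<in>insert F AA. \<forall>G\<in>BB. (F', G) \<noteq> (A, B) \<longrightarrow> F' \<inter> G \<subseteq> C"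
      proof (intro ballI impI)
        fix F' G assume "F' \<in> insert F AA" "G \<in> BB" "(F', G) \<noteq> (A, B)"
        then show "F' \<inter> G \<subseteq> C" using * leaf[of G] True by blast
      qed
      then show ?thesis using * tree_insert.hyps(2) by (intro exI[of _ "insert F AA"] exI[of _ BB]) auto
    next
      case False
      have "\<forall>F'\<in>AA. \<forall>G\<in>insert F BB. (F', G) \<noteq> (A, B) \<longrightarrow> F' \<inter> G \<subseteq> C"
      proof (intro ballI impI)
        fix F' G assume "F' \<in> AA" "G \<in> insert F BB" "(F', G) \<noteq> (A, B)"
        then show "F' \<inter> G \<subseteq> C" using * leaf[of F'] False by blast
      qed
      then show ?thesis using * tree_insert.hyps(2) by (intro exI[of _ AA] exI[of _ "insert F BB"]) auto
    qed
  qed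
qed

text \<open>
  The class goes once around the cycle through \<open>F\<close>, \<open>B\<close> and \<open>B'\<close>. On \<open>F\<close> it is the coboundary of the
  indicator function \<open>e\<close> of \<open>F \<inter> B\<close>, and it vanishes on all other facets; both agree where \<open>F\<close> meets
  another facet, because triple intersections lie in \<open>C\<close>. A potential \<open>\<eta>\<close> would be constant on the
  connected part that contains \<open>B\<close> and \<open>B'\<close>, while on \<open>F\<close> it would differ from \<open>e\<close> by a constant;
  comparing a point of \<open>F \<inter> B\<close> with one of \<open>F \<inter> B'\<close> gives \<open>1 = 0\<close>.
\<close>

lemma length_le_cycle:
  fixes rs :: "('n::finite, 'k::field) mpoly list"
  assumes triple: "\<And>F G H. F \<in> FF \<Longrightarrow> G \<in> FF \<Longrightarrow> H \<in> FF \<Longrightarrow> F \<noteq> G \<Longrightarrow> F \<noteq> H \<Longrightarrow> G \<noteq> H \<Longrightarrow> F \<inter> G \<inter> H \<subseteq> C"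
    and conn: "nerve_connected C AA" "AA \<subseteq> FF" and F: "F \<in> FF" "F \<notin> AA"
    and B: "B \<in> AA" "\<not> F \<inter> B \<subseteq> C" "B' \<in> AA" "\<not> F \<inter> B' \<subseteq> C" "B \<noteq> B'"
    and reg: "regular_on (face_ideal FF) rs" "set rs \<subseteq> idl.span (range var)"
  shows "length rs \<le> card C + 3"
proof (rule ccontr)
  assume "\<not> ?thesis"
  then have len: "card C + 2 + 1 < length rs" by simp
  obtain f :: "'n \<Rightarrow> nat" where f: "inj f" "\<And>v w. v \<notin> C \<Longrightarrow> w \<in> C \<Longrightarrow> f v < f w"
    using ordering_with_last[of C] by blast
  obtain p q where p: "p \<in> F" "p \<in> B" "p \<notin> C" and q: "q \<in> F" "q \<in> B'" "q \<notin> C" using B by blast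
  \<comment> \<open>on singletons, the indicator function of \<open>B\<close>\<close>
  define e :: "'n set \<Rightarrow> 'k" where "e A = (if A \<inter> B = {} then 0 else 1)" for A
  define c :: "'n set \<Rightarrow> 'k" where "c A = (if A \<subseteq> F then coboundary f e A else 0)" for A
  \<comment> \<open>on an edge of a facet other than \<open>F\<close> the class vanishes\<close>
  have c0: "c {u, v} = 0" if uv: "u \<noteq> v" "{u, v} \<subseteq> G" "{u, v} \<inter> C = {}" "G \<in> FF" "G \<noteq> F" for u v G
  proof (cases "{u, v} \<subseteq> F")
    case True
    have "e {u} = e {v}"
    proof (cases "G = B")
      case True
      then show ?thesis using uv by (auto simp: e_def)
    next
      case False
      then have "F \<inter> G \<inter> B \<subseteq> C" using triple[of F G B] F B conn uv by auto
      then have "{u, v} \<inter> B = {}" using uv True by blast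
      then show ?thesis by (auto simp: e_def)
    qed
    then show ?thesis using coboundary_pair_eq_0_iff[OF f(1) uv(1), of e] by (simp add: c_def)
  next
    case False
    then show ?thesis unfolding c_def by (simp only: if_False)
  qed
  obtain \<eta> where \<eta>: "\<And>A. A \<inter> C = {} \<Longrightarrow> card A = 2 \<Longrightarrow> face FF A \<Longrightarrow> c A = coboundary f \<eta> A"
  proof (rule koszul_obstruction[OF f p(3) reg len, of c])
    fix A assume A: "A \<inter> C = {}" "card A = Suc 2" "face FF A"
    then obtain G where G: "G \<in> FF" "A \<subseteq> G" by auto
    show "coboundary f c A = 0"
    proof (cases "A \<subseteq> F")
      case True
      then have "c (A - {v}) = coboundary f e (A - {v})" for v by (auto simp: c_def)
      then have "coboundary f c A = coboundary f (coboundary f e) A" unfolding koszul_d_def[of f _ _ A] by simp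
      then show ?thesis by (simp add: koszul_d_d[OF f(1)])
    next
      case False
      then have "G \<noteq> F" using G by auto
      have "c (A - {v}) = 0" if "v \<in> A" for v
      proof -
        have "card (A - {v}) = 2" using A that by simp
        then obtain x y where "A - {v} = {x, y}" "x \<noteq> y" by (auto simp: card_2_iff)
        then show ?thesis using c0[of x y G] A G \<open>G \<noteq> F\<close> by auto
      qed
      then show ?thesis by (simp add: koszul_d_def)
    qed
  qed blast+
  have const: "\<eta> {u} = \<eta> {v}" if "G \<in> AA" "u \<in> G" "v \<in> G" "u \<notin> C" "v \<notin> C" for G u v
  proof (cases "u = v")
    case False
    have G: "G \<in> FF" "G \<noteq> F" using that conn F by auto
    have "face FF {u, v}" using that G by (intro bexI[of _ G]) auto
    then have "coboundary f \<eta> {u, v} = c {u, v}" using \<eta>[of "{u, v}"] False that by simp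
    also have "\<dots> = 0" using c0[of u v G] False that G by auto
    finally show ?thesis using coboundary_pair_eq_0_iff[OF f(1) False] by blast
  qed simp
  have "\<forall>u\<in>\<Union>AA' - C. \<forall>v\<in>\<Union>AA' - C. \<eta> {u} = \<eta> {v}" if "nerve_connected C AA'" "AA' \<subseteq> AA" for AA'
    using that
  proof (induction rule: nerve_connected.induct)
    case (conn_single G)
    then show ?case using const by auto
  next
    case (conn_insert AA' G B0)
    then obtain w where w: "w \<in> G" "w \<in> B0" "w \<notin> C" by blast
    have "\<eta> {u} = \<eta> {w}" if "u \<in> \<Union>(insert G AA') - C" for u
    proof (cases "u \<in> G")
      case True
      then show ?thesis using const[of G u w] that w conn_insert.prems by auto
    next
      case False
      then have "u \<in> \<Union>AA' - C" "w \<in> \<Union>AA' - C" using that w conn_insert.hyps by auto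
      then show ?thesis using conn_insert.IH conn_insert.prems by blast
    qed
    then show ?case by metis
  qed
  then have pq: "\<eta> {p} = \<eta> {q}" using conn p q B by blast
  have "F \<inter> B \<inter> B' \<subseteq> C" using triple[of F B B'] F B conn by auto
  then have qB: "q \<notin> B" "q \<noteq> p" using q p by auto
  have "c {q, p} = coboundary f e {q, p}" using p q by (simp add: c_def)
  moreover have "c {q, p} = coboundary f \<eta> {q, p}" using \<eta>[of "{q, p}"] p q qB F by auto
  moreover have "coboundary f \<eta> {q, p} = 0" using coboundary_pair_eq_0_iff[OF f(1) qB(2)] pq by metis
  ultimately have "e {q} = e {p}" using coboundary_pair_eq_0_iff[OF f(1) qB(2), of e] by simp
  then show False using p qB by (simp add: e_def)
qed

section \<open>Regular sequences from colourings\<close>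

text \<open>
  The cone vertices form a regular sequence. When the facet \<open>G\<close> is added to \<open>GG'\<close>, the depth lemma asks
  about the complex of intersections with \<open>G\<close>; it is a cone over \<open>C\<close> as well and has fewer facets than
  the new complex.
\<close>

lemma weakly_regular_cone_variables:
  fixes Ds :: "'n::finite set list"
  assumes "\<forall>D\<in>set Ds. \<exists>c\<in>C. D = {c}" "distinct Ds" "\<forall>G\<in>GG. C \<subseteq> G"
  shows "weakly_regular (face_ideal GG :: ('n, 'k::field) mpoly set) (map colour_sum Ds)"
  using assms
proof (induction "card GG" arbitrary: GG Ds rule: less_induct)
  case less
  show ?case
  proof (cases "GG = {} \<or> Ds = []")
    case True
    have "face_ideal {} = (UNIV :: ('n, 'k) mpoly set)" by (simp add: face_ideal_def supported_def)
    then show ?thesis using True by (auto simp: weakly_regular_def)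
  next
    case False
    then obtain G GG' where GG: "GG = insert G GG'" "G \<notin> GG'" by (metis mk_disjoint_insert ex_in_conv)
    from False obtain D Ds' where Ds: "Ds = Ds' @ [D]" by (metis rev_exhaust)
    have card: "card GG' < card GG" using GG by simp
    have d: "disjoint (set Ds)" using less.prems(1) by (force simp: disjoint_def)
    have "weakly_regular (face_ideal ((\<lambda>H. H \<inter> G) ` GG') :: ('n, 'k) mpoly set) (map colour_sum Ds')"
    proof (rule less.hyps)
      show "card ((\<lambda>H. H \<inter> G) ` GG') < card GG" using card card_image_le[of GG' "\<lambda>H. H \<inter> G"] by simp
    qed (use less.prems GG Ds in auto)
    then have 1: "weakly_regular (idl.span (face_ideal GG' \<union> face_ideal {G} :: ('n, 'k) mpoly set)) (map colour_sum Ds')"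
      by (simp add: face_ideal_sum)
    have 2: "weakly_regular (face_ideal GG' :: ('n, 'k) mpoly set) (map colour_sum Ds)"
      using less.prems GG by (intro less.hyps card) auto
    have 3: "weakly_regular (face_ideal {G} :: ('n, 'k) mpoly set) (map colour_sum Ds)"
    proof (intro weakly_regular_colours d)
      fix D assume "D \<in> set Ds"
      then show "D \<inter> G \<noteq> {}" using less.prems GG by fastforce
    qed (use less.prems in auto)
    show ?thesis
      using depth_lemma[OF subspace_face_ideal subspace_face_ideal 1, of "colour_sum D"] 2 3 by (simp add: GG Ds face_ideal_insert[of G GG'])
  qed
qed

text \<open>
  If \<open>h\<close> extends the cone vertices to a regular sequence on each simplex, it does so on the whole complex:
  on intersections the depth lemma only asks for the cone vertices.
\<close>

lemma weakly_regular_cone: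
  fixes Ds :: "'n::finite set list"
  assumes Ds: "\<forall>D\<in>set Ds. \<exists>c\<in>C. D = {c}" "distinct Ds" and "finite GG" "\<forall>G\<in>GG. C \<subseteq> G"
    and "\<And>G. G \<in> GG \<Longrightarrow> weakly_regular (face_ideal {G} :: ('n, 'k::field) mpoly set) (map colour_sum Ds @ [h])"
  shows "weakly_regular (face_ideal GG :: ('n, 'k) mpoly set) (map colour_sum Ds @ [h])"
  using assms(3-)
proof (induction GG rule: finite_induct)
  case empty
  have "face_ideal {} = (UNIV :: ('n, 'k) mpoly set)" by (simp add: face_ideal_def supported_def)
  then show ?case by (auto simp: weakly_regular_def)
next
  case (insert G GG)
  have "weakly_regular (idl.span (face_ideal GG \<union> face_ideal {G} :: ('n, 'k) mpoly set)) (map colour_sum Ds)"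
    unfolding face_ideal_sum by (rule weakly_regular_cone_variables[OF Ds]) (use insert.prems in auto)
  then show ?case
    unfolding face_ideal_insert[of G GG] using insert by (intro depth_lemma) auto
qed

lemma colours_append:
  assumes Ds: "\<forall>D\<in>set Ds. \<exists>c\<in>C. D = {c}" "distinct Ds"
    and Es: "\<And>E. E \<in> set Es \<Longrightarrow> E \<inter> C = {}" "disjoint (set Es)" "distinct Es"
  shows "disjoint (set (Ds @ Es))" "distinct (Ds @ Es)"
proof -
  have *: "D \<inter> E = {}" if D: "D \<in> set Ds" and E: "E \<in> set Es" for D E
  proof -
    obtain c where "c \<in> C" "D = {c}" using bspec[OF Ds(1) D] by (elim bexE)
    then show ?thesis using Es(1)[OF E] by auto
  qed
  have ne: "D \<noteq> {}" if "D \<in> set Ds" for D using bspec[OF Ds(1) that] by auto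
  have Dd: "D \<inter> D' = {}" if D: "D \<in> set Ds" "D' \<in> set Ds" and ne: "D \<noteq> D'" for D D'
  proof -
    obtain c c' where "D = {c}" "D' = {c'}"
      using bspec[OF Ds(1) D(1)] bspec[OF Ds(1) D(2)] by (elim bexE)
    then show ?thesis using ne by auto
  qed
  have Ed: "E \<inter> E' = {}" if "E \<in> set Es" "E' \<in> set Es" "E \<noteq> E'" for E E'
    using Es(2) that by (auto simp: disjoint_def)
  show "disjoint (set (Ds @ Es))"
    unfolding disjoint_def
  proof (intro ballI impI)
    fix A B assume AB: "A \<in> set (Ds @ Es)" "B \<in> set (Ds @ Es)" "A \<noteq> B"
    then consider "A \<in> set Ds" "B \<in> set Ds" | "A \<in> set Ds" "B \<in> set Es" | "A \<in> set Es" "B \<in> set Ds"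
      | "A \<in> set Es" "B \<in> set Es" by auto
    then show "A \<inter> B = {}" using AB(3) *[of A B] *[of B A] Dd[of A B] Ed[of A B]
      by cases (simp_all add: Int_commute)
  qed
  have "D \<notin> set Es" if "D \<in> set Ds" for D using *[OF that, of D] ne[OF that] by auto
  then show "distinct (Ds @ Es)" using Ds Es by auto
qed

text \<open>
  The new facet \<open>F\<close> meets the previous ones in the union of its intersections with its neighbours, as the
  intersections with the other facets are just \<open>C\<close>. On each of these the sum of all variables outside
  \<open>C\<close> is nonzero, so by \<open>weakly_regular_cone\<close> it is regular on their union; the depth lemma then admits
  the further element \<open>h\<close>.
\<close>

lemma weakly_regular_conn:
  fixes Ds :: "'n::finite set list"
  assumes Ds: "\<forall>D\<in>set Ds. \<exists>c\<in>C. D = {c}" "distinct Ds"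
    and "nerve_connected C GG" "\<forall>G\<in>GG. C \<subseteq> G"
    and "\<And>G. G \<in> GG \<Longrightarrow> weakly_regular (face_ideal {G} :: ('n, 'k::field) mpoly set) (map colour_sum (Ds @ [- C]) @ [h])"
  shows "weakly_regular (face_ideal GG :: ('n, 'k) mpoly set) (map colour_sum (Ds @ [- C]) @ [h])"
  using assms(3-)
proof (induction rule: nerve_connected.induct)
  case (conn_single F)
  then show ?case by auto
next
  case (conn_insert AA F B)
  let ?N = "(\<lambda>G. G \<inter> F) ` {G \<in> AA. \<not> G \<inter> F \<subseteq> C}"
  have C: "C \<subseteq> G" if "G \<in> insert F AA" for G using conn_insert.prems that by blast
  have "face_ideal ((\<lambda>G. G \<inter> F) ` AA) = (face_ideal ?N :: ('n, 'k) mpoly set)"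
  proof (rule face_ideal_cong)
    fix H assume "H \<in> (\<lambda>G. G \<inter> F) ` AA"
    then obtain G where G: "G \<in> AA" "H = G \<inter> F" by auto
    show "\<exists>G\<in>?N. H \<subseteq> G"
    proof (cases "G \<inter> F \<subseteq> C")
      case True
      then have "H \<subseteq> B \<inter> F" using G C[of B] C[of F] conn_insert.hyps by auto
      moreover have "B \<inter> F \<in> ?N" using conn_insert.hyps by (auto simp: Int_commute)
      ultimately show ?thesis by blast
    next
      case False
      then show ?thesis using G by auto
    qed
  qed auto
  moreover have "weakly_regular (face_ideal ?N :: ('n, 'k) mpoly set) (map colour_sum Ds @ [colour_sum (- C)])"
  proof (rule weakly_regular_cone[OF Ds])
    fix H assume "H \<in> ?N"
    then obtain G where G: "G \<in> AA" "H = G \<inter> F" "\<not> H \<subseteq> C" by auto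
    have "weakly_regular (face_ideal {H} :: ('n, 'k) mpoly set) (map colour_sum (Ds @ [- C]))"
    proof (rule weakly_regular_colours)
      show "disjoint (set (Ds @ [- C]))" "distinct (Ds @ [- C])"
        using colours_append[OF Ds, of "[- C]"] by (auto simp: disjoint_def)
      fix D assume "D \<in> set (Ds @ [- C])"
      then show "D \<inter> H \<noteq> {}" using G C[of G] C[of F] Ds by fastforce
    qed
    then show "weakly_regular (face_ideal {H} :: ('n, 'k) mpoly set) (map colour_sum Ds @ [colour_sum (- C)])" by simp
  next
    show "\<forall>G\<in>?N. C \<subseteq> G" using C by auto
  qed simp
  ultimately have "weakly_regular (idl.span (face_ideal AA \<union> face_ideal {F} :: ('n, 'k) mpoly set)) (map colour_sum (Ds @ [- C]))"
    by (simp add: face_ideal_sum)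
  then show ?case
    unfolding face_ideal_insert[of F AA] using conn_insert by (intro depth_lemma) auto
qed

text \<open>
  Here \<open>F\<close> meets the previous facets in the single simplex \<open>F \<inter> B\<close> with its only neighbour, on which all
  colour sums together are regular.
\<close>

lemma weakly_regular_tree:
  fixes Ds :: "'n::finite set list"
  assumes Ds: "disjoint (set Ds)" "distinct Ds"
    and "nerve_tree C GG" "\<forall>G\<in>GG. C \<subseteq> G"
    and "\<And>G. G \<in> GG \<Longrightarrow> weakly_regular (face_ideal {G} :: ('n, 'k::field) mpoly set) (map colour_sum Ds @ [h])"
    and "\<And>F G D. F \<in> GG \<Longrightarrow> G \<in> GG \<Longrightarrow> F \<noteq> G \<Longrightarrow> \<not> F \<inter> G \<subseteq> C \<Longrightarrow> D \<in> set Ds \<Longrightarrow> D \<inter> (F \<inter> G) \<noteq> {}"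
  shows "weakly_regular (face_ideal GG :: ('n, 'k) mpoly set) (map colour_sum Ds @ [h])"
  using assms(3-)
proof (induction rule: nerve_tree.induct)
  case (tree_single F)
  then show ?case by auto
next
  case (tree_insert AA F B)
  have "face_ideal ((\<lambda>G. G \<inter> F) ` AA) = (face_ideal {F \<inter> B} :: ('n, 'k) mpoly set)"
  proof (rule face_ideal_cong)
    fix H assume "H \<in> (\<lambda>G. G \<inter> F) ` AA"
    then obtain G where G: "G \<in> AA" "H = G \<inter> F" by auto
    have "C \<subseteq> F \<inter> B" using tree_insert.prems tree_insert.hyps by auto
    then have "H \<subseteq> F \<inter> B" using G tree_insert.hyps(5)[of G] by (cases "G = B") auto
    then show "\<exists>G\<in>{F \<inter> B}. H \<subseteq> G" by blast
  qed (use tree_insert.hyps in auto)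
  moreover have "weakly_regular (face_ideal {F \<inter> B} :: ('n, 'k) mpoly set) (map colour_sum Ds)"
    by (rule weakly_regular_colours[OF Ds]) (use tree_insert.prems(3)[of F B] tree_insert.hyps in blast)
  ultimately have "weakly_regular (idl.span (face_ideal AA \<union> face_ideal {F} :: ('n, 'k) mpoly set)) (map colour_sum Ds)"
    by (simp add: face_ideal_sum)
  then show ?case
    unfolding face_ideal_insert[of F AA] using tree_insert by (intro depth_lemma) auto
qed

text \<open>
  If no vertex of \<open>F\<close> were left over, choosing the colour of each vertex would inject \<open>F\<close> into the set of
  colours.
\<close>

lemma transversalI:
  fixes F :: "'n::finite set"
  assumes meet: "\<And>D. D \<in> DD \<Longrightarrow> D \<inter> F \<noteq> {}" and card: "card DD < card F"
  shows "transversal DD F"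
proof (rule ccontr)
  assume "\<not> ?thesis"
  then have *: "F \<subseteq> \<Union>DD" "\<And>D v w. D \<in> DD \<Longrightarrow> v \<in> F \<inter> D \<Longrightarrow> w \<in> F \<inter> D \<Longrightarrow> v = w"
    using meet by (auto simp: transversal_def)
  then have "\<forall>v\<in>F. \<exists>D. D \<in> DD \<and> v \<in> D" by blast
  then obtain h where h: "\<And>v. v \<in> F \<Longrightarrow> h v \<in> DD \<and> v \<in> h v"
    using bchoice[of F "\<lambda>v D. D \<in> DD \<and> v \<in> D"] by blast
  have "inj_on h F"
  proof (rule inj_onI)
    fix x y assume xy: "x \<in> F" "y \<in> F" "h x = h y"
    show "x = y" by (rule *(2)[of "h x"]) (use xy h in auto)
  qed
  then have "card F \<le> card DD" using h by (intro card_inj_on_le[of h]) auto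
  then show False using card by simp
qed

lemma colour_sum_in_vars: "colour_sum D \<in> idl.span (range var)"
  unfolding colour_sum_def by (intro idl.span_sum idl.span_base) auto

lemma mixed_powers_in_vars:
  assumes "\<And>v. N v > 0"
  shows "mixed_powers N \<in> idl.span (range var)"
  unfolding mixed_powers_def
proof (rule idl.span_sum)
  fix v :: 'a
  have "var v ^ N v = var v ^ (N v - 1) * (var v :: ('a, 'b) mpoly)"
    using assms[of v] by (metis power_minus_mult)
  then show "var v ^ N v \<in> idl.span (range var :: ('a, 'b) mpoly set)"
    by (simp only:) (intro idl.span_scale idl.span_base rangeI)
qed

lemma exponents_exist: "\<exists>N :: 'n::finite \<Rightarrow> nat. inj N \<and> (\<forall>v. N v > 0)"
proof -
  obtain f :: "'n \<Rightarrow> nat" where "inj f" using finite_imp_inj_to_nat_seg[of "UNIV :: 'n set"] by auto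
  then show ?thesis by (intro exI[of _ "\<lambda>v. Suc (f v)"]) (auto simp: inj_def)
qed

text \<open>
  Appending a variable outside a facet to the sequence for \<open>R/I\<close> gives one for \<open>I\<close>, so a colouring
  determines the depth once the upper bound matches.
\<close>

lemma depth_from_colouring:
  fixes Ds :: "'n::finite set list" and FF :: "'n set set"
  assumes N: "inj N" "\<And>v. N v > 0" and Ds: "disjoint (set Ds)" "distinct Ds"
    and F: "F \<in> FF" "transversal (set Ds) F" and UNIV: "UNIV \<notin> FF"
    and reg: "weakly_regular (face_ideal FF :: ('n, 'k::field) mpoly set) (map colour_sum Ds @ [mixed_powers N])"
    and max: "\<And>ss :: ('n, 'k) mpoly list. regular_on (face_ideal FF) ss \<Longrightarrow> set ss \<subseteq> idl.span (range var) \<Longrightarrow> length ss \<le> length Ds + 2"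
  shows "ideal_depth (face_ideal FF :: ('n, 'k) mpoly set) = enat (length Ds + 2)"
proof -
  obtain u where u: "u \<notin> F" using F(1) UNIV by (metis UNIV_eq_I)
  let ?rs = "(map colour_sum Ds @ [mixed_powers N]) @ [var u] :: ('n, 'k) mpoly list"
  have "regular_on (face_ideal FF) ?rs"
    by (rule regular_on_of_weakly_regular[OF subspace_face_ideal reg weakly_regular_colours_powers_var[OF N Ds F(2) u]])
  moreover have "set ?rs \<subseteq> idl.span (range var)"
    using colour_sum_in_vars mixed_powers_in_vars[OF N(2)] by (auto intro: idl.span_base)
  moreover have "length ?rs = length Ds + 2" by simp
  moreover have "face_ideal FF \<noteq> ({0} :: ('n, 'k) mpoly set)" using UNIV by (rule face_ideal_nonzero)
  ultimately show ?thesis using ideal_depth_eqI[OF subspace_face_ideal, of FF ?rs] max by metis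
qed

text \<open>Each member of the disjoint family is numbered on its own.\<close>

lemma colouring_exists:
  fixes EE :: "'n::finite set set"
  assumes "disjoint EE" "\<And>E. E \<in> EE \<Longrightarrow> t \<le> card E"
  shows "\<exists>col :: 'n \<Rightarrow> nat. \<forall>E\<in>EE. \<forall>j<t. \<exists>v\<in>E. col v = j"
proof -
  have "\<forall>E :: 'n set. \<exists>h. bij_betw h E {0..<card E}" by (simp add: ex_bij_betw_finite_nat)
  then obtain h where h: "\<And>E :: 'n set. bij_betw (h E) E {0..<card E}" by metis
  define col where "col v = h (THE E. E \<in> EE \<and> v \<in> E) v" for v
  have "\<exists>v\<in>E. col v = j" if E: "E \<in> EE" and j: "j < t" for E j
  proof -
    have "j \<in> h E ` E" using h[of E] assms(2)[OF E] j by (simp add: bij_betw_def)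
    then obtain v where v: "v \<in> E" "h E v = j" by auto
    have "(THE E. E \<in> EE \<and> v \<in> E) = E"
      using E v assms(1) by (intro the_equality) (auto simp: disjoint_def)
    then show ?thesis using v by (auto simp: col_def)
  qed
  then show ?thesis by blast
qed

section \<open>Depth from the nerve graph\<close>

text \<open>
  At least two facets, all containing \<open>C\<close>, with triple intersections in \<open>C\<close>. The existence of a second facet
  is stated for each facet to be used directly.
\<close>

locale nerve_graph =
  fixes C :: "'n::finite set" and FF :: "'n set set"
  assumes nonempty: "FF \<noteq> {}"
    and two: "\<And>F. F \<in> FF \<Longrightarrow> \<exists>G\<in>FF. G \<noteq> F"
    and antichain: "\<And>F G. F \<in> FF \<Longrightarrow> G \<in> FF \<Longrightarrow> F \<subseteq> G \<Longrightarrow> F = G"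
    and core: "\<And>F. F \<in> FF \<Longrightarrow> C \<subseteq> F"
    and triple: "\<And>F G H. F \<in> FF \<Longrightarrow> G \<in> FF \<Longrightarrow> H \<in> FF \<Longrightarrow> F \<noteq> G \<Longrightarrow> F \<noteq> H \<Longrightarrow> G \<noteq> H \<Longrightarrow>
      F \<inter> G \<inter> H \<subseteq> C"
begin

lemma UNIV_not_face: "UNIV \<notin> FF"
  using two antichain by (metis subset_UNIV)

lemma core_less: "F \<in> FF \<Longrightarrow> C \<subset> F"
  using two[of F] antichain[of F] core by blast

lemma core_vars:
  obtains Ds where "\<forall>D\<in>set Ds. \<exists>c\<in>C. D = {c}" "distinct Ds" "length Ds = card C"
proof -
  obtain cs where cs: "set cs = C" "distinct cs" using finite_distinct_list[of C] by auto
  show ?thesis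
    by (rule that[of "map (\<lambda>c. {c}) cs"]) (use cs in \<open>auto simp: distinct_map distinct_card[symmetric]\<close>)
qed

lemma core_var_meets:
  assumes "\<forall>D\<in>set Ds. \<exists>c\<in>C. D = {c}" "D \<in> set Ds" "C \<subseteq> F"
  shows "D \<inter> F \<noteq> {}"
  using bspec[OF assms(1,2)] assms(3) by auto

text \<open>The colours are the cone vertices only, and \<open>W = C\<close>.\<close>

lemma depth_disconnected:
  assumes FF: "FF = AA \<union> BB" and AB: "AA \<noteq> {}" "BB \<noteq> {}"
    and cross: "\<And>F G. F \<in> AA \<Longrightarrow> G \<in> BB \<Longrightarrow> F \<inter> G \<subseteq> C"
  shows "ideal_depth (face_ideal FF :: ('n, 'k::field) mpoly set) = enat (card C + 2)"
proof -
  obtain N :: "'n \<Rightarrow> nat" where N: "inj N" "\<And>v. N v > 0" using exponents_exist by blast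
  obtain Ds where Ds: "\<forall>D\<in>set Ds. \<exists>c\<in>C. D = {c}" "distinct Ds" "length Ds = card C" using core_vars .
  have d: "disjoint (set Ds)" using colours_append(1)[OF Ds(1,2), of "[]"] by (simp add: disjoint_def)
  have t: "transversal (set Ds) F" if "F \<in> FF" for F
    using core_var_meets[OF Ds(1) _ core[OF that]] psubset_card_mono[OF _ core_less[OF that]] Ds
    by (intro transversalI) (auto simp: distinct_card)
  obtain F G where FG: "F \<in> AA" "G \<in> BB" using AB by auto
  obtain a b where a: "a \<in> F" "a \<notin> C" and b: "b \<in> G" "b \<notin> C"
    using core_less[of F] core_less[of G] FF FG by blast
  have "ideal_depth (face_ideal FF :: ('n, 'k) mpoly set) = enat (length Ds + 2)"
  proof (rule depth_from_colouring[OF N d Ds(2), of F])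
    show "weakly_regular (face_ideal FF :: ('n, 'k) mpoly set) (map colour_sum Ds @ [mixed_powers N])"
      by (rule weakly_regular_cone[OF Ds(1,2)]) (use core t in \<open>auto intro: weakly_regular_colours_powers[OF N d Ds(2)]\<close>)
    fix ss :: "('n, 'k) mpoly list" assume "regular_on (face_ideal FF) ss" "set ss \<subseteq> idl.span (range var)"
    then show "length ss \<le> length Ds + 2"
      unfolding Ds(3) by (intro length_le_disconnected[OF FF cross FG(1) a FG(2) b])
  qed (use FG FF t UNIV_not_face in auto)
  then show ?thesis using Ds by simp
qed

text \<open>The colours are the cone vertices and the set of all other vertices.\<close>

lemma depth_cycle:
  assumes conn: "nerve_connected C FF" and AA: "nerve_connected C AA" "AA \<subseteq> FF" and F: "F \<in> FF" "F \<notin> AA"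
    and B: "B \<in> AA" "\<not> F \<inter> B \<subseteq> C" "B' \<in> AA" "\<not> F \<inter> B' \<subseteq> C" "B \<noteq> B'"
  shows "ideal_depth (face_ideal FF :: ('n, 'k::field) mpoly set) = enat (card C + 3)"
proof -
  obtain N :: "'n \<Rightarrow> nat" where N: "inj N" "\<And>v. N v > 0" using exponents_exist by blast
  obtain Ds where Ds: "\<forall>D\<in>set Ds. \<exists>c\<in>C. D = {c}" "distinct Ds" "length Ds = card C" using core_vars .
  let ?Ds = "Ds @ [- C]"
  have d: "disjoint (set ?Ds)" "distinct ?Ds"
    using colours_append[OF Ds(1,2), of "[- C]"] by (auto simp: disjoint_def)
  have t: "transversal (set ?Ds) G" if G: "G \<in> FF" for G
  proof (rule transversalI)
    obtain H where H: "H \<in> FF" "H \<noteq> G" "\<not> G \<inter> H \<subseteq> C"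
      using conn_neighbour[OF conn G] two[OF G] by blast
    have "C \<subset> G \<inter> H" using H core G by blast
    moreover have "G \<inter> H \<subset> G" using H G antichain[of G H] by blast
    ultimately have "card C < card (G \<inter> H)" "card (G \<inter> H) < card G" by (auto intro: psubset_card_mono)
    moreover have "card (set ?Ds) = card C + 1" using d(2) Ds(3) by (metis distinct_card length_append_singleton Suc_eq_plus1)
    ultimately show "card (set ?Ds) < card G" by simp
    fix D assume "D \<in> set ?Ds"
    then show "D \<inter> G \<noteq> {}" using core_var_meets[OF Ds(1) _ core[OF G]] core_less[OF G] by auto
  qed
  have "ideal_depth (face_ideal FF :: ('n, 'k) mpoly set) = enat (length ?Ds + 2)"
  proof (rule depth_from_colouring[OF N d, of F])
    show "weakly_regular (face_ideal FF :: ('n, 'k) mpoly set) (map colour_sum ?Ds @ [mixed_powers N])"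
      by (rule weakly_regular_conn[OF Ds(1,2) conn]) (use core t in \<open>auto intro!: weakly_regular_colours_powers[OF N d] simp del: map_append\<close>)
    fix ss :: "('n, 'k) mpoly list" assume "regular_on (face_ideal FF) ss" "set ss \<subseteq> idl.span (range var)"
    then have "length ss \<le> card C + 3"
      by (intro length_le_cycle[OF triple AA F B])
    then show "length ss \<le> length ?Ds + 2" using Ds(3) by simp
  qed (use F t UNIV_not_face in auto)
  then show ?thesis using Ds by simp
qed

text \<open>
  Outside \<open>C\<close> the intersections of adjacent facets are pairwise disjoint and have at least
  \<open>t = |A \<inter> B| - |C|\<close> elements. They can thus be coloured independently so that all \<open>t\<close> colours occur on
  each of them, which gives \<open>|C| + t\<close> colour sums. For the upper bound the tree is cut at the edge
  between \<open>A\<close> and \<open>B\<close>, and \<open>W = A \<inter> B\<close>.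
\<close>

lemma depth_tree:
  assumes tree: "nerve_tree C FF" and A: "A \<in> FF" and B: "B \<in> FF" "A \<noteq> B" "\<not> A \<inter> B \<subseteq> C"
    and min: "\<And>F G. F \<in> FF \<Longrightarrow> G \<in> FF \<Longrightarrow> F \<noteq> G \<Longrightarrow> \<not> F \<inter> G \<subseteq> C \<Longrightarrow> card (A \<inter> B) \<le> card (F \<inter> G)"
    and neighbour: "\<And>F. F \<in> FF \<Longrightarrow> \<exists>G\<in>FF. G \<noteq> F \<and> \<not> F \<inter> G \<subseteq> C"
  shows "ideal_depth (face_ideal FF :: ('n, 'k::field) mpoly set) = enat (card (A \<inter> B) + 2)"
proof -
  obtain N :: "'n \<Rightarrow> nat" where N: "inj N" "\<And>v. N v > 0" using exponents_exist by blast
  obtain Ds where Ds: "\<forall>D\<in>set Ds. \<exists>c\<in>C. D = {c}" "distinct Ds" "length Ds = card C" using core_vars .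
  define t where "t = card (A \<inter> B) - card C"
  have CAB: "C \<subseteq> A \<inter> B" using core A B by blast
  then have t_eq: "card C + t = card (A \<inter> B)" using card_mono[OF _ CAB] by (simp add: t_def)
  let ?EE = "{F \<inter> G - C | F G. F \<in> FF \<and> G \<in> FF \<and> F \<noteq> G \<and> \<not> F \<inter> G \<subseteq> C}"
  have "disjoint ?EE"
    unfolding disjoint_def
  proof (intro ballI impI)
    fix E E' assume "E \<in> ?EE" "E' \<in> ?EE" and ne: "E \<noteq> E'"
    then obtain F G F' G' where *: "E = F \<inter> G - C" "F \<in> FF" "G \<in> FF" "F \<noteq> G"
      "E' = F' \<inter> G' - C" "F' \<in> FF" "G' \<in> FF" "F' \<noteq> G'" by blast
    have "(F' \<noteq> F \<and> F' \<noteq> G) \<or> (G' \<noteq> F \<and> G' \<noteq> G)" using * ne by (auto simp: Int_commute)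
    then have "F \<inter> G \<inter> F' \<subseteq> C \<or> F \<inter> G \<inter> G' \<subseteq> C"
      using triple[OF *(2,3,6,4)] triple[OF *(2,3,7,4)] by metis
    then show "E \<inter> E' = {}" unfolding *(1) *(5) by blast
  qed
  moreover have "t \<le> card E" if E: "E \<in> ?EE" for E
  proof -
    obtain F G where FG: "E = F \<inter> G - C" "F \<in> FF" "G \<in> FF" "F \<noteq> G" "\<not> F \<inter> G \<subseteq> C"
      using E unfolding mem_Collect_eq by (elim exE conjE)
    have "C \<subseteq> F \<inter> G" using core[OF FG(2)] core[OF FG(3)] by (rule Int_greatest)
    then have "card E = card (F \<inter> G) - card C" using FG by (simp add: card_Diff_subset)
    then show ?thesis using min[OF FG(2-5)] by (simp add: t_def)
  qed
  ultimately have "\<exists>col :: 'n \<Rightarrow> nat. \<forall>E\<in>?EE. \<forall>j<t. \<exists>v\<in>E. col v = j" by (rule colouring_exists)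
  then obtain col :: "'n \<Rightarrow> nat" where col: "\<forall>E\<in>?EE. \<forall>j<t. \<exists>v\<in>E. col v = j" by (elim exE)
  define K where "K j = {v. v \<notin> C \<and> col v = j}" for j :: nat
  have K: "K j \<inter> (F \<inter> G) \<noteq> {}" if FG: "F \<in> FF" "G \<in> FF" "F \<noteq> G" "\<not> F \<inter> G \<subseteq> C" and j: "j < t" for F G j
  proof -
    have "F \<inter> G - C \<in> ?EE" using FG by blast
    then have "\<exists>v\<in>F \<inter> G - C. col v = j" using bspec[OF col] j by simp
    then show ?thesis by (auto simp: K_def)
  qed
  let ?Es = "map K [0..<t]"
  have K_disj: "K i \<inter> K j = {}" if "i \<noteq> j" for i j using that by (auto simp: K_def)
  have K_ne: "K j \<noteq> {}" if "j < t" for j using K[OF A B that] by auto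
  have "inj_on K {0..<t}"
  proof (rule inj_onI)
    fix i j assume "i \<in> {0..<t}" "j \<in> {0..<t}" "K i = K j"
    then show "i = j" using K_disj[of i j] K_ne[of i] by auto
  qed
  then have Es1: "distinct ?Es" by (simp add: distinct_map)
  have Es2: "disjoint (set ?Es)"
    unfolding disjoint_def
  proof (intro ballI impI)
    fix A B assume "A \<in> set ?Es" "B \<in> set ?Es" and ne: "A \<noteq> B"
    then obtain i j where ij: "A = K i" "B = K j" by auto
    with ne have "i \<noteq> j" by auto
    then show "A \<inter> B = {}" using K_disj ij by simp
  qed
  have EsC: "E \<inter> C = {}" if "E \<in> set ?Es" for E using that by (auto simp: K_def)
  let ?Ds = "Ds @ ?Es"
  have d: "disjoint (set ?Ds)" "distinct ?Ds" using colours_append[OF Ds(1,2) EsC Es2 Es1] by auto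
  have len: "length ?Ds = card (A \<inter> B)" using Ds(3) t_eq by simp
  have meets: "D \<inter> (F \<inter> G) \<noteq> {}"
    if FG: "F \<in> FF" "G \<in> FF" "F \<noteq> G" "\<not> F \<inter> G \<subseteq> C" and D: "D \<in> set ?Ds" for F G D
  proof -
    have "C \<subseteq> F \<inter> G" using core[OF FG(1)] core[OF FG(2)] by (rule Int_greatest)
    with D show ?thesis using core_var_meets[OF Ds(1)] K[OF FG] by auto
  qed
  have t: "transversal (set ?Ds) F" if F: "F \<in> FF" for F
  proof (rule transversalI)
    obtain G where G: "G \<in> FF" "G \<noteq> F" "\<not> F \<inter> G \<subseteq> C" using neighbour[OF F] by blast
    have "F \<inter> G \<subset> F" using G F antichain[of F G] by blast
    then have "card (F \<inter> G) < card F" by (auto intro: psubset_card_mono)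
    moreover have "card (A \<inter> B) \<le> card (F \<inter> G)" using min[OF F G(1)] G by auto
    moreover have "card (set ?Ds) = card (A \<inter> B)" using d(2) len by (metis distinct_card)
    ultimately show "card (set ?Ds) < card F" by linarith
    fix D assume "D \<in> set ?Ds"
    then show "D \<inter> F \<noteq> {}" using meets[OF F G(1)] G by blast
  qed
  obtain AA BB where cut: "FF = AA \<union> BB" "A \<in> AA" "B \<in> BB"
    "\<forall>F\<in>AA. \<forall>G\<in>BB. (F, G) \<noteq> (A, B) \<longrightarrow> F \<inter> G \<subseteq> C"
    using tree_cut[OF tree A B] by blast
  have cross: "F \<inter> G \<subseteq> A \<inter> B" if "F \<in> AA" "G \<in> BB" for F G using cut(4) that CAB by blast
  obtain a b where a: "a \<in> A" "a \<notin> A \<inter> B" and b: "b \<in> B" "b \<notin> A \<inter> B"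
    using antichain[of A B] antichain[of B A] A B by blast
  have "ideal_depth (face_ideal FF :: ('n, 'k) mpoly set) = enat (length ?Ds + 2)"
  proof (rule depth_from_colouring[OF N d, of A])
    show "weakly_regular (face_ideal FF :: ('n, 'k) mpoly set) (map colour_sum ?Ds @ [mixed_powers N])"
      by (rule weakly_regular_tree[OF d tree]) (use core t meets in \<open>auto intro!: weakly_regular_colours_powers[OF N d] simp del: map_append\<close>)
    fix ss :: "('n, 'k) mpoly list" assume "regular_on (face_ideal FF) ss" "set ss \<subseteq> idl.span (range var)"
    then show "length ss \<le> length ?Ds + 2"
      unfolding len by (intro length_le_disconnected[OF cut(1) cross cut(2) a cut(3) b])
  qed (use A t UNIV_not_face in auto)
  then show ?thesis using len by simp
qed

text \<open>A maximal connected family of facets is everything or splits off the rest.\<close>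

lemma depth_field_independent:
  "ideal_depth (face_ideal FF :: ('n, 'k::field) mpoly set) = ideal_depth (face_ideal FF :: ('n, 'l::field) mpoly set)"
proof -
  obtain F where F: "F \<in> FF" using nonempty by auto
  \<comment> \<open>a connected family of facets with the largest possible number of members\<close>
  have "\<exists>AA. (nerve_connected C AA \<and> AA \<subseteq> FF) \<and> (\<forall>BB. nerve_connected C BB \<and> BB \<subseteq> FF \<longrightarrow> card BB \<le> card AA)"
    by (rule ex_has_greatest_nat[of "\<lambda>AA. nerve_connected C AA \<and> AA \<subseteq> FF" "{F}" _ "card FF + 1"])
      (use F in \<open>auto intro: conn_single card_mono[OF finite] le_imp_less_Suc\<close>)
  then obtain AA where AA: "nerve_connected C AA" "AA \<subseteq> FF"
    and max: "\<And>BB. nerve_connected C BB \<Longrightarrow> BB \<subseteq> FF \<Longrightarrow> card BB \<le> card AA" by blast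
  show ?thesis
  proof (cases "AA = FF")
    case False
    have "F \<inter> G \<subseteq> C" if "F \<in> AA" "G \<in> FF - AA" for F G
    proof (rule ccontr)
      assume "\<not> F \<inter> G \<subseteq> C"
      then have "nerve_connected C (insert G AA)" using that by (intro conn_insert[OF AA(1) _ that(1)]) (auto simp: Int_commute)
      then have "card (insert G AA) \<le> card AA" using that AA by (intro max) auto
      then show False using that by simp
    qed
    moreover have "FF = AA \<union> (FF - AA)" using AA by auto
    moreover have "FF - AA \<noteq> {}" using AA False by auto
    ultimately show ?thesis using conn_nonempty[OF AA(1)] depth_disconnected[of AA "FF - AA"] by metis
  next
    case True
    then have conn: "nerve_connected C FF" using AA by simp
    from connected_tree_or_cycle[OF conn] show ?thesis
    proof
      assume tree: "nerve_tree C FF"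
      have neighbour: "\<exists>G\<in>FF. G \<noteq> F \<and> \<not> F \<inter> G \<subseteq> C" if "F \<in> FF" for F
        using conn_neighbour[OF conn that] two[OF that] by blast
      let ?P = "\<lambda>p. fst p \<in> FF \<and> snd p \<in> FF \<and> fst p \<noteq> snd p \<and> \<not> fst p \<inter> snd p \<subseteq> C"
      obtain G where "?P (F, G)" using neighbour[OF F] F by auto
      from ex_has_least_nat[of ?P, OF this, of "\<lambda>p. card (fst p \<inter> snd p)"]
      obtain p where p: "?P p" "\<And>q. ?P q \<Longrightarrow> card (fst p \<inter> snd p) \<le> card (fst q \<inter> snd q)"
        by blast
      define A where "A = fst p"
      define B where "B = snd p"
      have AB: "A \<in> FF" "B \<in> FF" "A \<noteq> B" "\<not> A \<inter> B \<subseteq> C"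
        and min: "\<And>F G. F \<in> FF \<Longrightarrow> G \<in> FF \<Longrightarrow> F \<noteq> G \<Longrightarrow> \<not> F \<inter> G \<subseteq> C \<Longrightarrow> card (A \<inter> B) \<le> card (F \<inter> G)"
        using p(1) p(2)[of "(_, _)"] by (simp_all add: A_def B_def)
      show ?thesis
        using depth_tree[OF tree AB min neighbour, where ?'k='k] depth_tree[OF tree AB min neighbour, where ?'k='l]
        by simp
    next
      assume "\<exists>AA' F B B'. AA' \<subseteq> FF \<and> nerve_connected C AA' \<and> F \<in> FF \<and> F \<notin> AA' \<and> B \<in> AA' \<and> B' \<in> AA' \<and> B \<noteq> B' \<and>
         \<not> F \<inter> B \<subseteq> C \<and> \<not> F \<inter> B' \<subseteq> C"
      then obtain AA' F B B' where *: "nerve_connected C AA'" "AA' \<subseteq> FF" "F \<in> FF" "F \<notin> AA'" "B \<in> AA'" "\<not> F \<inter> B \<subseteq> C"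
        "B' \<in> AA'" "\<not> F \<inter> B' \<subseteq> C" "B \<noteq> B'" by blast
      show ?thesis using depth_cycle[OF conn *, where ?'k='k] depth_cycle[OF conn *, where ?'k='l] by simp
    qed
  qed
qed

end

section \<open>At most one facet\<close>

text \<open>The variables themselves, as sums over one-element colour classes.\<close>

lemma depth_unit_ideal:
  "ideal_depth (face_ideal {} :: ('n::finite, 'k::field) mpoly set) = enat (card (UNIV :: 'n set))"
proof -
  obtain vs where vs: "set vs = (UNIV :: 'n set)" "distinct vs" using finite_distinct_list[of "UNIV :: 'n set"] by auto
  let ?Ds = "map (\<lambda>v. {v}) vs"
  let ?rs = "map colour_sum ?Ds :: ('n, 'k) mpoly list"
  have d: "disjoint (set ?Ds)" "distinct ?Ds" using vs by (auto simp: disjoint_def distinct_map)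
  have "vs \<noteq> []" using vs by auto
  then obtain ws w where ws: "?rs = ws @ [w]" by (metis Nil_is_map_conv rev_exhaust)
  have "weakly_regular (face_ideal {UNIV} :: ('n, 'k) mpoly set) ?rs" by (rule weakly_regular_colours[OF d]) auto
  then have "weakly_regular {0} (ws @ [w])" unfolding ws face_ideal_UNIV .
  moreover have "weakly_regular (face_ideal {} :: ('n, 'k) mpoly set) ws" by (auto simp: weakly_regular_def face_ideal_def supported_def)
  ultimately have "regular_on (face_ideal {}) ?rs" unfolding ws by (intro regular_on_of_weakly_regular) auto
  moreover have "length ?rs = card (UNIV :: 'n set)" using vs by (simp add: distinct_card[symmetric])
  moreover have "set ?rs \<subseteq> idl.span (range var)" using colour_sum_in_vars by auto
  ultimately show ?thesis
    using ideal_depth_eqI[OF subspace_face_ideal face_ideal_nonzero, of "{}" ?rs] length_le_full by (metis empty_iff)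
qed

lemma depth_linear_prime:
  fixes F :: "'n::finite set"
  assumes F: "F \<noteq> UNIV"
  shows "ideal_depth (face_ideal {F} :: ('n, 'k::field) mpoly set) = enat (card F + 1)"
proof -
  obtain u where u: "u \<notin> F" using F by auto
  obtain vs where vs: "set vs = F" "distinct vs" using finite_distinct_list[of F] by auto
  let ?Ds = "map (\<lambda>v. {v}) vs"
  let ?rs = "map colour_sum ?Ds @ [var u] :: ('n, 'k) mpoly list"
  have d: "disjoint (set ?Ds)" "distinct ?Ds" using vs by (auto simp: disjoint_def distinct_map)
  have m: "D \<inter> F \<noteq> {}" if "D \<in> set ?Ds" for D using that vs by auto
  have "regular_on (face_ideal {F}) ?rs"
    by (intro regular_on_of_weakly_regular subspace_face_ideal weakly_regular_colours[OF d] weakly_regular_colours_var[OF d _ u] m)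
  moreover have "length ?rs = card F + 1" using vs by (simp add: distinct_card[symmetric])
  moreover have "set ?rs \<subseteq> idl.span (range var)" using colour_sum_in_vars by (auto intro: idl.span_base)
  ultimately show ?thesis
    using ideal_depth_eqI[OF subspace_face_ideal face_ideal_nonzero, of "{F}" ?rs] length_le_simplex[OF F] F by (metis singletonD)
qed

text \<open>
  For two facets the condition on triples is void, and \<open>C\<close> is their intersection; then the nerve is
  disconnected. From three facets on, \<open>C\<close> is the common triple intersection.
\<close>

theorem face_ideal_depth_field_independent:
  fixes FF :: "'n::finite set set"
  assumes antichain: "\<And>F G. F \<in> FF \<Longrightarrow> G \<in> FF \<Longrightarrow> F \<subseteq> G \<Longrightarrow> F = G"
    and triple: "\<And>F G H. F \<in> FF \<Longrightarrow> G \<in> FF \<Longrightarrow> H \<in> FF \<Longrightarrow> F \<noteq> G \<Longrightarrow> F \<noteq> H \<Longrightarrow> G \<noteq> H \<Longrightarrow> F \<inter> G \<inter> H = T"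
  shows "ideal_depth (face_ideal FF :: ('n, 'k::field) mpoly set) = ideal_depth (face_ideal FF :: ('n, 'l::field) mpoly set)"
proof -
  consider "FF = {}" | F where "FF = {F}" | F G where "FF = {F, G}" "F \<noteq> G"
    | F G H where "F \<in> FF" "G \<in> FF" "H \<in> FF" "F \<noteq> G" "F \<noteq> H" "G \<noteq> H"
  proof -
    have "card FF = 0 \<or> card FF = 1 \<or> card FF = 2 \<or> 3 \<le> card FF" by linarith
    moreover have "\<exists>E\<subseteq>FF. card E = 3" if "3 \<le> card FF" using that obtain_subset_with_card_n by metis
    ultimately consider "FF = {}" | "card FF = 1" | "card FF = 2" | E where "E \<subseteq> FF" "card E = 3"
      by auto
    then show ?thesis
    proof cases
      case 2
      then obtain F where "FF = {F}" by (auto simp: card_1_singleton_iff)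
      then show ?thesis by (rule that(2))
    next
      case 3
      then obtain F G where "FF = {F, G}" "F \<noteq> G" by (auto simp: card_2_iff)
      then show ?thesis by (rule that(3))
    next
      case (4 E)
      then obtain F G H where "E = {F, G, H}" "F \<noteq> G" "F \<noteq> H" "G \<noteq> H" by (auto simp: card_3_iff)
      then show ?thesis using 4 that(4)[of F G H] by simp
    qed (rule that(1))
  qed
  then show ?thesis
  proof cases
    case 1
    then show ?thesis by (simp add: depth_unit_ideal)
  next
    case (2 F)
    then show ?thesis by (cases "F = UNIV") (simp_all add: depth_linear_prime face_ideal_UNIV ideal_depth_zero)
  next
    case (3 F G)
    interpret nerve_graph "F \<inter> G" FF
    proof
      show "FF \<noteq> {}" using 3 by simp
      show "A = B" if "A \<in> FF" "B \<in> FF" "A \<subseteq> B" for A B using antichain that .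
      show "\<exists>B\<in>FF. B \<noteq> A" if "A \<in> FF" for A using that 3 by auto
      show "F \<inter> G \<subseteq> A" if "A \<in> FF" for A using that 3 by auto
      show "A \<inter> B \<inter> D \<subseteq> F \<inter> G" if "A \<in> FF" "B \<in> FF" "D \<in> FF" "A \<noteq> B" "A \<noteq> D" "B \<noteq> D" for A B D
        using that unfolding 3(1) by (elim insertE emptyE) simp_all
    qed
    show ?thesis by (rule depth_field_independent)
  next
    case (4 F G H)
    have T: "T \<subseteq> E" if E: "E \<in> FF" for E
    proof -
      have "\<exists>A\<in>FF. \<exists>B\<in>FF. E \<noteq> A \<and> E \<noteq> B \<and> A \<noteq> B" using 4 by metis
      then show ?thesis using triple E by blast
    qed
    interpret nerve_graph T FF
    proof
      show "FF \<noteq> {}" using 4 by auto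
      show "A = B" if "A \<in> FF" "B \<in> FF" "A \<subseteq> B" for A B using antichain that .
      show "\<exists>B\<in>FF. B \<noteq> A" if "A \<in> FF" for A using 4 by metis
      show "T \<subseteq> A" if "A \<in> FF" for A using T that .
      show "A \<inter> B \<inter> D \<subseteq> T" if "A \<in> FF" "B \<in> FF" "D \<in> FF" "A \<noteq> B" "A \<noteq> D" "B \<noteq> D" for A B D
        using triple[OF that] by simp
    qed
    show ?thesis by (rule depth_field_independent)
  qed
qed

section \<open>Facets and minimal primes\<close>

text \<open>
  The maximal sets of variables that contain the support of no generator, that is, the complements of the
  minimal vertex covers.
\<close>

definition facets :: "('n \<Rightarrow>\<^sub>0 nat) set \<Rightarrow> 'n set set" where
  "facets G = {F. (\<forall>e\<in>G. \<not> Poly_Mapping.keys e \<subseteq> F) \<and>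
     (\<forall>H. (\<forall>e\<in>G. \<not> Poly_Mapping.keys e \<subseteq> H) \<longrightarrow> F \<subseteq> H \<longrightarrow> H = F)}"

lemma face_extends_to_facet:
  fixes G :: "('n::finite \<Rightarrow>\<^sub>0 nat) set"
  assumes "\<forall>e\<in>G. \<not> Poly_Mapping.keys e \<subseteq> A"
  shows "\<exists>F\<in>facets G. A \<subseteq> F"
proof -
  obtain F where "A \<subseteq> F" "\<forall>e\<in>G. \<not> Poly_Mapping.keys e \<subseteq> F"
    "\<forall>H\<in>{F. \<forall>e\<in>G. \<not> Poly_Mapping.keys e \<subseteq> F}. F \<subseteq> H \<longrightarrow> F = H"
    using finite_has_maximal2[of "{F. \<forall>e\<in>G. \<not> Poly_Mapping.keys e \<subseteq> F}" A] assms by auto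
  then show ?thesis unfolding facets_def by blast
qed

text \<open>
  Squarefreeness enters here: a squarefree monomial divides another monomial as soon as its support is
  contained in the support of the other.
\<close>

lemma monomial_ideal_eq_face_ideal:
  fixes G :: "('n::finite \<Rightarrow>\<^sub>0 nat) set"
  assumes "\<forall>e\<in>G. squarefree_exponent e"
  shows "monomial_ideal G = (face_ideal (facets G) :: ('n, 'k::field) mpoly set)"
proof
  show "monomial_ideal G \<subseteq> (face_ideal (facets G) :: ('n, 'k) mpoly set)"
    unfolding monomial_ideal_def genideal_eq_span
  proof (rule idl.span_minimal)
    show "monomial ` G \<subseteq> (face_ideal (facets G) :: ('n, 'k) mpoly set)"
      by (auto simp: face_ideal_def supported_def monomial_def facets_def)
  qed simp
  show "face_ideal (facets G) \<subseteq> (monomial_ideal G :: ('n, 'k) mpoly set)"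
  proof
    fix p :: "('n, 'k) mpoly" assume p: "p \<in> face_ideal (facets G)"
    have "Poly_Mapping.single a c \<in> idl.span (monomial ` G)" if a: "a \<in> Poly_Mapping.keys p" for a and c :: 'k
    proof -
      have "\<not> (\<exists>F\<in>facets G. Poly_Mapping.keys a \<subseteq> F)" using p a by (auto simp: face_ideal_def supported_def)
      then obtain e where e: "e \<in> G" "Poly_Mapping.keys e \<subseteq> Poly_Mapping.keys a"
        using face_extends_to_facet by blast
      have "Poly_Mapping.lookup e v \<le> Poly_Mapping.lookup a v" for v
      proof (cases "v \<in> Poly_Mapping.keys e")
        case True
        then have "Poly_Mapping.lookup a v > 0" using subsetD[OF e(2) True] by (simp add: in_keys_iff)
        moreover have "Poly_Mapping.lookup e v \<le> 1" using assms e by (auto simp: squarefree_exponent_def)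
        ultimately show ?thesis by linarith
      qed (simp add: in_keys_iff)
      then have "a = (a - e) + e" by (intro poly_mapping_eqI) (simp add: lookup_add lookup_minus)
      then have "Poly_Mapping.single a c = Poly_Mapping.single (a - e) c * monomial e"
        by (simp add: monomial_def mult_single)
      then show ?thesis by (simp only:) (intro idl.span_scale idl.span_base imageI e(1))
    qed
    then have "(\<Sum>a\<in>Poly_Mapping.keys p. Poly_Mapping.single a (Poly_Mapping.lookup p a)) \<in> idl.span (monomial ` G)"
      by (intro idl.span_sum)
    then show "p \<in> monomial_ideal G"
      unfolding monomial_ideal_def genideal_eq_span by (simp flip: poly_mapping_sum_single)
  qed
qed

lemma primeideal_face_ideal: "primeideal (face_ideal {F} :: ('n::finite, 'k::field) mpoly set) poly_ring_over"
proof (rule primeidealI)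
  show "ideal (face_ideal {F} :: ('n, 'k) mpoly set) poly_ring_over" by (simp add: ideal_iff_subspace)
  show "cring (poly_ring_over :: ('n, 'k) mpoly ring)" by (rule cring_from_type_algebra)
  have "(1 :: ('n, 'k) mpoly) \<notin> face_ideal {F}" by (simp add: face_ideal_def supported_def)
  then show "carrier poly_ring_over \<noteq> (face_ideal {F} :: ('n, 'k) mpoly set)" by auto
qed (use face_ideal_prime in auto)

text \<open>A monomial is a product of variables.\<close>

lemma prime_contains_var:
  fixes Q :: "('n::finite, 'k::field) mpoly set"
  assumes Q: "primeideal Q poly_ring_over" and e: "monomial e \<in> Q"
  shows "\<exists>v\<in>Poly_Mapping.keys e. var v \<in> Q"
proof -
  have ideal: "ideal Q poly_ring_over" using Q by (rule primeideal.axioms(1))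
  have one: "1 \<notin> Q"
  proof
    assume "1 \<in> Q"
    have "x \<in> Q" for x
      using idl.subspace_scale[OF ideal[unfolded ideal_iff_subspace] \<open>1 \<in> Q\<close>, of x] by simp
    then show False using primeideal.I_notcarr[OF Q] by auto
  qed
  have mult: "x \<in> Q \<or> y \<in> Q" if "x * y \<in> Q" for x y using primeideal.I_prime[OF Q, of x y] that by simp
  have pow: "x ^ k \<in> Q \<Longrightarrow> k > 0 \<and> x \<in> Q" for x k
    by (induction k) (use one mult in auto)
  have prod: "(\<Prod>v\<in>A. h v) \<in> Q \<Longrightarrow> \<exists>v\<in>A. h v \<in> Q" for h and A :: "'n set"
    by (induction A rule: infinite_finite_induct) (use one mult in auto)
  have "e = (\<Sum>v\<in>UNIV. Poly_Mapping.single v (Poly_Mapping.lookup e v))"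
    by (rule poly_mapping_eqI) (simp add: lookup_sum lookup_single when_def)
  then have "monomial e = (\<Prod>v\<in>UNIV. var v ^ Poly_Mapping.lookup e v :: ('n, 'k) mpoly)"
    unfolding var_power prod_monomial by simp
  then obtain v where "var v ^ Poly_Mapping.lookup e v \<in> Q" using prod e by auto
  then have "Poly_Mapping.lookup e v > 0 \<and> var v \<in> Q" by (rule pow)
  then show ?thesis by (auto simp: in_keys_iff)
qed

text \<open>
  If a prime \<open>Q\<close> lies between the ideal and the prime of \<open>F\<close>, the variables outside \<open>Q\<close> form a face that
  contains \<open>F\<close>, hence \<open>F\<close> itself by maximality.
\<close>

lemma facet_minimal_prime:
  fixes G :: "('n::finite \<Rightarrow>\<^sub>0 nat) set"
  assumes sf: "\<forall>e\<in>G. squarefree_exponent e" and F: "F \<in> facets G"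
  shows "(face_ideal {F} :: ('n, 'k::field) mpoly set) \<in> minimal_primes poly_ring_over (monomial_ideal G)"
  unfolding minimal_primes_def
proof (intro CollectI conjI allI impI primeideal_face_ideal)
  show "monomial_ideal G \<subseteq> (face_ideal {F} :: ('n, 'k) mpoly set)"
    unfolding monomial_ideal_eq_face_ideal[OF sf] using F by (intro face_ideal_mono) auto
  fix Q :: "('n, 'k) mpoly set"
  assume Q: "primeideal Q poly_ring_over" "monomial_ideal G \<subseteq> Q" "Q \<subseteq> face_ideal {F}"
  let ?H = "{v. var v \<notin> Q}"
  have "\<forall>e\<in>G. \<not> Poly_Mapping.keys e \<subseteq> ?H"
  proof
    fix e assume "e \<in> G"
    then have "monomial e \<in> (monomial_ideal G :: ('n, 'k) mpoly set)"
      unfolding monomial_ideal_def genideal_eq_span by (intro idl.span_base) auto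
    then show "\<not> Poly_Mapping.keys e \<subseteq> ?H" using prime_contains_var[OF Q(1), of e] Q(2) by blast
  qed
  moreover have "F \<subseteq> ?H" using Q(3) var_in_face_ideal_iff[of _ F, where ?'b='k] by blast
  ultimately have "?H = F" using F by (auto simp: facets_def)
  then have "var ` (- F) \<subseteq> Q" by auto
  moreover have "idl.subspace Q" using Q(1) ideal_iff_subspace primeideal.axioms(1) by blast
  ultimately have "idl.span (var ` (- F)) \<subseteq> Q" by (rule idl.span_minimal)
  then show "Q = face_ideal {F}" using face_ideal_subset_span_vars[of F] Q(3) by blast
qed

lemma set_add_face_ideal:
  "face_ideal {F} <+>\<^bsub>poly_ring_over\<^esub> face_ideal {G} = (face_ideal {F \<inter> G} :: ('n, 'k::field) mpoly set)"
proof -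
  have "face_ideal {F} <+>\<^bsub>poly_ring_over\<^esub> face_ideal {G} = idl.span (face_ideal {F} \<union> face_ideal {G} :: ('n, 'k) mpoly set)"
    unfolding idl.span_Un span_face_ideal by (auto simp: set_add_def set_mult_def)
  then show ?thesis by (simp add: face_ideal_sum)
qed

theorem theorem2p10:
  fixes G :: "('n::finite \<Rightarrow>\<^sub>0 nat) set"
    and I J :: "('n, 'k::field) mpoly set"
    and I' :: "('n, 'l::field) mpoly set"
  assumes squarefree: "\<forall>e\<in>G. squarefree_exponent e"
    and I: "I = monomial_ideal G"
    and I': "I' = monomial_ideal G"
    and J: "ideal J poly_ring_over"
    and triple_sums: "\<forall>P \<in> minimal_primes poly_ring_over I.
        \<forall>Q \<in> minimal_primes poly_ring_over I. \<forall>R \<in> minimal_primes poly_ring_over I.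
          P \<noteq> Q \<longrightarrow> P \<noteq> R \<longrightarrow> Q \<noteq> R \<longrightarrow>
          P <+>\<^bsub>poly_ring_over\<^esub> Q <+>\<^bsub>poly_ring_over\<^esub> R = J"
  shows "ideal_depth I' = ideal_depth I"
proof -
  have face_ideal_inject: "A = B" if "face_ideal {A} = (face_ideal {B} :: ('n, 'k) mpoly set)" for A B
  proof -
    have "v \<in> A \<longleftrightarrow> v \<in> B" for v
      using var_in_face_ideal_iff[of v A, where ?'b='k] var_in_face_ideal_iff[of v B, where ?'b='k] that by simp
    then show ?thesis by blast
  qed
  have "A \<inter> B \<inter> C = {v. var v \<notin> J}"
    if "A \<in> facets G" "B \<in> facets G" "C \<in> facets G" "A \<noteq> B" "A \<noteq> C" "B \<noteq> C" for A B C
  proof -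
    have P: "face_ideal {F} \<in> minimal_primes poly_ring_over I" if "F \<in> facets G" for F
      unfolding I by (rule facet_minimal_prime[OF squarefree that])
    have "face_ideal {A} \<noteq> (face_ideal {B} :: ('n, 'k) mpoly set)" "face_ideal {A} \<noteq> (face_ideal {C} :: ('n, 'k) mpoly set)"
      "face_ideal {B} \<noteq> (face_ideal {C} :: ('n, 'k) mpoly set)" using that(4-6) face_ideal_inject by auto
    then have "face_ideal {A} <+>\<^bsub>poly_ring_over\<^esub> face_ideal {B} <+>\<^bsub>poly_ring_over\<^esub> face_ideal {C} = J"
      using bspec[OF bspec[OF bspec[OF triple_sums P[OF that(1)]] P[OF that(2)]] P[OF that(3)]] by simp
    then have "J = face_ideal {A \<inter> B \<inter> C}" by (simp add: set_add_face_ideal)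
    then show ?thesis by (auto simp: var_in_face_ideal_iff)
  qed
  moreover have "A = B" if "A \<in> facets G" "B \<in> facets G" "A \<subseteq> B" for A B
    using that by (auto simp: facets_def)
  ultimately show ?thesis
    unfolding I I' monomial_ideal_eq_face_ideal[OF squarefree] by (intro face_ideal_depth_field_independent) auto
qed

end
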